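(* Let $0<q<1$, $r<0$, $0<c\le q^2$, $d\in\mathbb{R}$ with $|d|<1$ and $|c/d|<1$. Let $$c(y)=\frac{(c/dy,\,d/y,\,dry,\,q/dry;q)_\infty}{(y^{-2},\,c,\,r,\,q/r;q)_\infty},$$ and assume that the zeroes of $y\mapsto c(y)$ are simple and that $c(y)=0$ implies $c(y^{-1})\neq0$. For $k\in\mathbb{Z}$ put $$f_k(\mu(y))={}_2\varphi_1(dy,d/y;c;q,rq^k),\qquad w_k^2=d^{2k}\,\frac{(cq^{1-k}/d^2r;q)_\infty}{(q^{1-k}/r;q)_\infty},\qquad \mu(y)=\tfrac12(y+y^{-1}).$$ Then for all $k,l\in\mathbb{Z}$ $$\frac1{2\pi}\int_0^\pi f_k(\cos\chi)f_l(\cos\chi)\frac{d\chi}{|c(e^{i\chi})|^2}+\sum_{p\in\mathbb{Z},\ |q^p/dr|>1}\Bigl(\operatorname*{Res}_{y=q^p/dr}\frac1{c(y^{-1})c(y)y}\Bigr)f_k\bigl(\mu(\tfrac{q^p}{dr})\bigr)f_l\bigl(\mu(\tfrac{q^p}{dr})\bigr)=\frac{\delta_{k,l}}{w_k^2}.$$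
   Context: Here $c$ without argument is the real parameter, $c(y)$ the function; $c/dy=c/(dy)$, $q/dry=q/(dry)$, $q^p/dr=q^p/(dr)$. $(x;q)_n=\prod_{k=0}^{n-1}(1-xq^k)$, $(x;q)_\infty=\prod_{k\ge0}(1-xq^k)$, $(x_1,\dots,x_m;q)_\infty=\prod_j(x_j;q)_\infty$. ${}_2\varphi_1(\alpha,\beta;\gamma;q,z)=\sum_{n\ge0}\frac{(\alpha;q)_n(\beta;q)_n}{(q;q)_n(\gamma;q)_n}z^n$ for $|z|<1$, and denotes its analytic continuation to $\mathbb{C}\setminus[1,\infty)$ otherwise.
   Formalization: The assumption "c(y)=0 implies c(1/y)≠0" is read as also requiring that the quotient defining c has nonzero denominator at 1/y; this excludes exactly (dr)^2 an integer power of q, where, with c extended meromorphically, the residues are twice what is needed and the identity fails. *)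

theory Defs
  imports "HOL-Complex_Analysis.Complex_Analysis"
begin

definition qpoch :: "'a::comm_ring_1 \<Rightarrow> 'a \<Rightarrow> nat \<Rightarrow> 'a" where
  "qpoch x q n = (\<Prod>k<n. 1 - x * q ^ k)"

definition qpoch_inf :: "'a::real_normed_field \<Rightarrow> 'a \<Rightarrow> 'a" where
  "qpoch_inf x q = (\<Prod>k. 1 - x * q ^ k)"

definition qpochs_inf :: "'a::real_normed_field list \<Rightarrow> 'a \<Rightarrow> 'a" where
  "qpochs_inf xs q = (\<Prod>x\<leftarrow>xs. qpoch_inf x q)"

definition phi21_series :: "complex \<Rightarrow> complex \<Rightarrow> complex \<Rightarrow> complex \<Rightarrow> complex \<Rightarrow> complex" where
  "phi21_series \<alpha> \<beta> \<gamma> q z =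
     (\<Sum>n. qpoch \<alpha> q n * qpoch \<beta> q n / (qpoch q q n * qpoch \<gamma> q n) * z ^ n)"

text \<open>
  The cut plane is connected, so two continuations \<open>F\<close> agree on it and the value does not depend
  on the choice made by \<open>SOME\<close>. Values on the cut \<open>[1,\<infinity>)\<close> are unspecified.
\<close>
definition phi21 :: "complex \<Rightarrow> complex \<Rightarrow> complex \<Rightarrow> complex \<Rightarrow> complex \<Rightarrow> complex" where
  "phi21 \<alpha> \<beta> \<gamma> q z =
     (if norm z < 1 then phi21_series \<alpha> \<beta> \<gamma> q z
      else (SOME F. F holomorphic_on (UNIV - complex_of_real ` {1..}) \<and>
                    (\<forall>u. norm u < 1 \<longrightarrow> F u = phi21_series \<alpha> \<beta> \<gamma> q u)) z)"

definition mu :: "complex \<Rightarrow> complex" where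
  "mu y = (y + inverse y) / 2"

definition c_fun :: "real \<Rightarrow> real \<Rightarrow> real \<Rightarrow> real \<Rightarrow> complex \<Rightarrow> complex" where
  "c_fun q c d r y =
     qpochs_inf [c / (d * y), d / y, d * r * y, q / (d * r * y)] q
     / qpochs_inf [inverse y ^ 2, c, r, q / r] q"

text \<open>
  The points at which the quotient defining \<open>c_fun\<close> makes sense (the remaining denominator factors
  do not depend on \<open>y\<close> and do not vanish for \<open>0 < q < 1\<close>, \<open>0 < c < 1\<close>, \<open>r < 0\<close>). Elsewhere the
  convention \<open>x / 0 = 0\<close> gives \<open>c_fun\<close> the value \<open>0\<close>, which is not a zero of \<open>c_fun\<close>.
\<close>
definition c_dom :: "real \<Rightarrow> complex set" where
  "c_dom q = {y. y \<noteq> 0 \<and> qpoch_inf (inverse y ^ 2) (complex_of_real q) \<noteq> 0}"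

definition c_zeros :: "real \<Rightarrow> real \<Rightarrow> real \<Rightarrow> real \<Rightarrow> complex set" where
  "c_zeros q c d r = {y \<in> c_dom q. c_fun q c d r y = 0}"

text \<open>
  \<open>f_fun\<close> is a function of \<open>x = mu y\<close>; the lemma \<open>f_fun_mu\<close> below shows that it does not depend on the
  choice of \<open>y\<close>.
\<close>
definition f_fun :: "real \<Rightarrow> real \<Rightarrow> real \<Rightarrow> real \<Rightarrow> int \<Rightarrow> complex \<Rightarrow> complex" where
  "f_fun q c d r k x =
     (let y = (SOME y. y \<noteq> 0 \<and> mu y = x)
      in phi21 (d * y) (d / y) c q (complex_of_real (r * q powi k)))"

text \<open>This is the quantity \<open>w\<^sub>k\<^sup>2\<close> itself, not \<open>w\<^sub>k\<close>.\<close>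
definition w_sq :: "real \<Rightarrow> real \<Rightarrow> real \<Rightarrow> real \<Rightarrow> int \<Rightarrow> real" where
  "w_sq q c d r k =
     d powi (2 * k) * (qpoch_inf (c * q powi (1 - k) / (d ^ 2 * r)) q
                       / qpoch_inf (q powi (1 - k) / r) q)"

lemma phi21_commute: "phi21 \<alpha> \<beta> \<gamma> q z = phi21 \<beta> \<alpha> \<gamma> q z"
proof -
  have "phi21_series \<alpha> \<beta> \<gamma> q = phi21_series \<beta> \<alpha> \<gamma> q"
    by (rule ext) (simp add: phi21_series_def mult.commute)
  then show ?thesis
    by (simp add: phi21_def)
qed

lemma mu_eq_mu_cases:
  assumes "x \<noteq> 0" "y \<noteq> 0" "mu x = mu y"
  shows "x = y \<or> x = inverse y"
proof -
  have mu: "mu z = (z * z + 1) / (2 * z)" if "z \<noteq> 0" for z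
    using that by (simp add: mu_def divide_simps)
  have "(x * x + 1) * (2 * y) = (y * y + 1) * (2 * x)"
    using assms(3) unfolding mu[OF assms(1)] mu[OF assms(2)]
    by (subst (asm) frac_eq_eq) (use assms(1,2) in simp_all)
  moreover have "2 * ((x - y) * (x * y - 1)) = (x * x + 1) * (2 * y) - (y * y + 1) * (2 * x)"
    by (simp add: algebra_simps)
  ultimately have "2 * ((x - y) * (x * y - 1)) = 0"
    by (simp only: diff_self)
  then have "x = y \<or> y * x = 1"
    by (simp add: mult.commute)
  then show ?thesis
    using inverse_unique[of y x] by metis
qed

lemma f_fun_mu:
  assumes "y \<noteq> 0"
  shows "f_fun q c d r k (mu y) = phi21 (d * y) (d / y) c q (complex_of_real (r * q powi k))"
proof -
  define y' where "y' = (SOME y'. y' \<noteq> 0 \<and> mu y' = mu y)"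
  have "y' \<noteq> 0 \<and> mu y' = mu y"
    unfolding y'_def by (rule someI[where x = y]) (use assms in simp)
  then have "y' = y \<or> y' = inverse y"
    using mu_eq_mu_cases[of y' y] assms by simp
  moreover have "f_fun q c d r k (mu y) = phi21 (d * y') (d / y') c q (complex_of_real (r * q powi k))"
    by (simp add: f_fun_def y'_def Let_def)
  moreover have "phi21 (d * inverse y) (d / inverse y) c q (complex_of_real (r * q powi k))
      = phi21 (d * y) (d / y) c q (complex_of_real (r * q powi k))"
    by (subst phi21_commute) (simp add: divide_inverse)
  ultimately show ?thesis
    by metis
qed

end

theory Submission
  imports Defs
begin

text \<open>
  As sequences in \<open>k\<close>, \<open>f\<^sub>k(\<mu>(y))\<close> and the solution \<open>\<Phi>\<^sub>k(y) \<sim> (dy)\<^bsup>-k\<^esup>\<close> (\<open>k \<rightarrow> -\<infinity>\<close>) satisfy the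
  same three-term recurrence. Their Casoratians, evaluated at \<open>k \<rightarrow> \<plusminus>\<infinity>\<close>, give
  \<open>f\<^sub>k = c(y) \<Phi>\<^sub>k(y) + c(1/y) \<Phi>\<^sub>k(1/y)\<close> on the unit circle, so that the integral of \<open>f\<^sub>k f\<^sub>l / |c|\<^sup>2\<close>
  over the half circle is the integral of \<open>f\<^sub>k(\<mu>(y)) \<Phi>\<^sub>l(y) / (c(1/y) y)\<close> over the full circle. By symmetry
  let \<open>l \<le> k\<close>. Shrinking the contour towards \<open>0\<close> between the poles \<open>drq\<^sup>j\<close> picks up exactly the negatives of the
  residues in the sum, since at these poles \<open>f\<^sub>l = c(y) \<Phi>\<^sub>l(y)\<close>; on the small circles
  \<open>f\<^sub>k \<Phi>\<^sub>l / c(1/y)\<close> tends to \<open>\<delta>\<^sub>k\<^sub>l / w\<^sub>k\<^sup>2\<close>. Both \<open>f\<^sub>k\<close> and \<open>\<Phi>\<^sub>k\<close> are continued to all \<open>k\<close> by Heine's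
  transformation.
\<close>

section \<open>Infinite q-products and the theta function\<close>

text \<open>The origin is the obstacle: \<open>f\<^sub>k(\<mu>(y))\<close> has an essential
  singularity at \<open>y = 0\<close>, and the poles of 1/c(1/y) accumulate there. Only their
  product is tame, and only on circles that keep a fixed ratio to the poles. There the growing
  q-product in \<open>f\<^sub>k\<close> cancels against the theta function in 1/c(1/y), and what
  remains behaves like \<open>y^(k-l)\<close>; this is why \<open>l \<le> k\<close> is arranged
  first.

  All series are taken in Heine form with \<open>d y\<close> as the expansion parameter. Convergence
  then depends on \<open>|d y| < 1\<close> alone, whatever the size of \<open>r q^k\<close>, so one
  formula serves every \<open>k\<close> and a punctured neighbourhood of the closed disc. The bound
  \<open>c \<le> q^2\<close> gives \<open>c/q < 1\<close>, which the behaviour of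
  \<open>\<Phi>\<^sub>k\<close> for \<open>k \<rightarrow> \<infinity>\<close> requires.

  The connection formula is proved on the unit circle only. At the poles inside, the two series are
  compared term by term instead. Both arguments need \<open>(d r)^2\<close> not to be an integer
  power of \<open>q\<close>, which the assumptions on the zeros of c(y) imply.\<close>

locale q_base =
  fixes q :: real
  assumes q_pos: "0 < q" and q_less_1: "q < 1"
begin

abbreviation Q :: complex where "Q \<equiv> complex_of_real q"
abbreviation ip :: "complex \<Rightarrow> complex" where "ip x \<equiv> qpoch_inf x Q"
abbreviation fp :: "complex \<Rightarrow> nat \<Rightarrow> complex" where "fp x n \<equiv> qpoch x Q n"

lemma q_nonzero [simp]: "q \<noteq> 0"
  using q_pos by simp

lemma abs_q [simp]: "\<bar>q\<bar> = q"
  using q_pos by simp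

lemma norm_Q [simp]: "norm Q = q"
  using q_pos by simp

lemma summable_q_power: "summable (\<lambda>n. q ^ n)"
  using q_pos q_less_1 by (intro summable_geometric) auto

lemma convergent_prod_qpoch: "convergent_prod (\<lambda>k. 1 - x * Q ^ k)"
proof -
  have "summable (\<lambda>k. norm ((1 - x * Q ^ k) - 1))"
    using summable_mult[OF summable_q_power, of "norm x"] q_pos
    by (simp add: norm_mult norm_power)
  then show ?thesis
    using abs_convergent_prod_conv_summable abs_convergent_prod_imp_convergent_prod by blast
qed

lemma has_prod_qpoch: "(\<lambda>k. 1 - x * Q ^ k) has_prod ip x"
  unfolding qpoch_inf_def using convergent_prod_qpoch by (rule convergent_prod_has_prod)

lemma qpoch_tendsto: "(\<lambda>n. fp x n) \<longlonglongrightarrow> ip x"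
  unfolding qpoch_def using has_prod_imp_tendsto'[OF has_prod_qpoch] .

lemma ip_eq_0_iff: "ip x = 0 \<longleftrightarrow> (\<exists>n. x * Q ^ n = 1)"
  by (subst has_prod_eq_0_iff[OF has_prod_qpoch]) (auto simp: image_iff)

lemma fp_0 [simp]: "fp x 0 = 1"
  by (simp add: qpoch_def)

lemma fp_Suc: "fp x (Suc n) = fp x n * (1 - x * Q ^ n)"
  by (simp add: qpoch_def)

lemma fp_add: "fp x (m + n) = fp x m * fp (x * Q ^ m) n"
  by (induction n) (simp_all add: fp_Suc power_add mult_ac)

lemma ip_split: "ip x = fp x n * ip (x * Q ^ n)"
proof -
  have "(\<lambda>m. fp x (m + n)) \<longlonglongrightarrow> ip x"
    using LIMSEQ_ignore_initial_segment[OF qpoch_tendsto] .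
  moreover have "(\<lambda>m. fp x (m + n)) \<longlonglongrightarrow> fp x n * ip (x * Q ^ n)"
    using tendsto_mult[OF tendsto_const qpoch_tendsto[of "x * Q ^ n"], of "fp x n"]
    by (simp add: fp_add[symmetric] add.commute)
  ultimately show ?thesis
    using LIMSEQ_unique by blast
qed

lemma ip_rec: "ip x = (1 - x) * ip (x * Q)"
  using ip_split[of x 1] by (simp add: qpoch_def)

lemma ip_0 [simp]: "ip 0 = 1"
  unfolding qpoch_inf_def by simp

lemma ip_eq_0I: "x * Q ^ n = 1 \<Longrightarrow> ip x = 0"
  using ip_eq_0_iff by blast

lemma ip_nonzero_norm: "norm x < 1 \<Longrightarrow> ip x \<noteq> 0"
proof
  assume x: "norm x < 1" and "ip x = 0"
  then obtain n where "x * Q ^ n = 1"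
    using ip_eq_0_iff by blast
  then have "norm x * q ^ n = 1"
    using q_pos by (metis norm_mult norm_one norm_power norm_Q)
  moreover have "norm x * q ^ n \<le> norm x * 1"
    using q_pos q_less_1 by (intro mult_left_mono power_le_one) auto
  ultimately show False using x by simp
qed

lemma ip_nonzero_nonpos: "x \<le> 0 \<Longrightarrow> ip (complex_of_real x) \<noteq> 0"
proof
  assume x: "x \<le> 0" and "ip (complex_of_real x) = 0"
  then obtain n where "complex_of_real x * Q ^ n = 1"
    using ip_eq_0_iff by blast
  then have "x * q ^ n = 1"
    by (metis of_real_1 of_real_eq_iff of_real_mult of_real_power)
  moreover have "x * q ^ n \<le> 0"
    using x q_pos by (simp add: mult_nonpos_nonneg)
  ultimately show False by simp
qed

lemma ip_nonzero_shift: "ip x \<noteq> 0 \<Longrightarrow> ip (x * Q ^ n) \<noteq> 0"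
  using ip_split[of x n] by auto

lemma fp_nonzero: "ip x \<noteq> 0 \<Longrightarrow> fp x n \<noteq> 0"
  using ip_split[of x n] by auto

lemma fp_over_ip: "ip x \<noteq> 0 \<Longrightarrow> fp x n / ip x = 1 / ip (x * Q ^ n)"
  using ip_split[of x n] by (auto simp: divide_simps)

lemma ip_Q_nonzero [simp]: "ip Q \<noteq> 0"
  using q_less_1 by (intro ip_nonzero_norm) simp

lemma fp_Q_nonzero [simp]: "fp Q n \<noteq> 0"
  by (rule fp_nonzero) simp

section \<open>Bounds for q-products\<close>

lemma sum_q_power_le: "(\<Sum>k<n. q ^ k) \<le> 1 / (1 - q)"
  using sum_le_suminf[OF summable_q_power, of "{..<n}"] suminf_geometric[of q] q_pos q_less_1
  by simp

lemma prod_le_exp: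
  assumes "0 \<le> t"
  shows "(\<Prod>k<n. 1 + t * q ^ k) \<le> exp (t / (1 - q))"
proof -
  have "(\<Prod>k<n. 1 + t * q ^ k) \<le> exp (\<Sum>k<n. t * q ^ k)"
    using assms q_pos by (intro prod_le_exp_sum) simp
  also have "(\<Sum>k<n. t * q ^ k) = t * (\<Sum>k<n. q ^ k)"
    by (simp add: sum_distrib_left)
  also have "exp (t * (\<Sum>k<n. q ^ k)) \<le> exp (t / (1 - q))"
    using mult_left_mono[OF sum_q_power_le assms] by simp
  finally show ?thesis .
qed

lemma norm_fp_le:
  assumes "norm x \<le> t"
  shows "norm (fp x n) \<le> exp (t / (1 - q))"
proof -
  have "norm (fp x n) = (\<Prod>k<n. norm (1 - x * Q ^ k))"
    by (simp add: qpoch_def prod_norm)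
  also have "\<dots> \<le> (\<Prod>k<n. 1 + t * q ^ k)"
  proof (intro prod_mono conjI)
    fix k
    have "norm (1 - x * Q ^ k) \<le> norm (1::complex) + norm (x * Q ^ k)"
      by (rule norm_triangle_ineq4)
    also have "\<dots> \<le> 1 + t * q ^ k"
      using assms q_pos by (simp add: norm_mult norm_power mult_right_mono)
    finally show "norm (1 - x * Q ^ k) \<le> 1 + t * q ^ k" .
  qed simp
  also have "\<dots> \<le> exp (t / (1 - q))"
    using assms by (intro prod_le_exp) (use norm_ge_zero order_trans in blast)
  finally show ?thesis .
qed

lemma norm_ip_le:
  assumes "norm x \<le> t"
  shows "norm (ip x) \<le> exp (t / (1 - q))"
  using norm_fp_le[OF assms]
  by (intro Lim_bounded[OF tendsto_norm[OF qpoch_tendsto]]) auto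

lemma inverse_fp_bounded:
  assumes "ip x \<noteq> 0"
  obtains B where "B > 0" "\<And>n. norm (1 / fp x n) \<le> B"
proof -
  have "(\<lambda>n. 1 / fp x n) \<longlonglongrightarrow> 1 / ip x"
    using assms by (intro tendsto_intros qpoch_tendsto)
  then have "Bseq (\<lambda>n. 1 / fp x n)"
    using convergent_imp_Bseq convergentI by blast
  then show ?thesis
    using that unfolding Bseq_def by blast
qed

section \<open>Holomorphy and limits of the infinite product\<close>

lemma ip_holomorphic_UNIV: "ip holomorphic_on UNIV"
proof (rule holomorphic_uniform_sequence[of UNIV "\<lambda>n x. fp x n"])
  show "(\<lambda>x. fp x n) holomorphic_on UNIV" for n
    unfolding qpoch_def by (intro holomorphic_intros)
next
  fix z :: complex
  have "uniformly_convergent_on (cball z 1) (\<lambda>N x. \<Prod>n<N. 1 - x * Q ^ n)"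
  proof (rule uniformly_convergent_on_prod')
    show "uniformly_convergent_on (cball z 1) (\<lambda>N x. \<Sum>n<N. norm ((1 - x * Q ^ n) - 1))"
    proof (rule Weierstrass_m_test')
      fix n x assume "x \<in> cball z 1"
      then have "norm x \<le> norm z + 1"
        by (metis add.commute add_le_cancel_left dist_norm mem_cball norm_minus_commute norm_triangle_sub order_trans)
      then show "norm (norm ((1 - x * Q ^ n) - 1)) \<le> (norm z + 1) * q ^ n"
        using q_pos by (simp add: norm_mult norm_power mult_right_mono)
    qed (intro summable_mult summable_q_power)
  qed (intro continuous_intros compact_cball)+
  then obtain l where l: "uniform_limit (cball z 1) (\<lambda>N x. \<Prod>n<N. 1 - x * Q ^ n) l sequentially"
    using uniformly_convergent_on_def by blast
  have "l x = ip x" if "x \<in> cball z 1" for x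
    using tendsto_uniform_limitI[OF l that] qpoch_tendsto[of x, unfolded qpoch_def] LIMSEQ_unique
    by blast
  then have "uniform_limit (cball z 1) (\<lambda>N x. fp x N) ip sequentially"
    unfolding qpoch_def using l by (subst uniform_limit_cong'[where g = "\<lambda>N x. \<Prod>n<N. 1 - x * Q ^ n" and i = l]) auto
  then show "\<exists>d>0. cball z d \<subseteq> UNIV \<and> uniform_limit (cball z d) (\<lambda>N x. fp x N) ip sequentially"
    by (intro exI[of _ 1]) auto
qed auto

lemma ip_holomorphic [holomorphic_intros]:
  assumes "f holomorphic_on S"
  shows "(\<lambda>w. ip (f w)) holomorphic_on S"
  using holomorphic_on_compose_gen[OF assms ip_holomorphic_UNIV] by (simp add: o_def)

lemma fp_holomorphic [holomorphic_intros]: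
  assumes "f holomorphic_on S"
  shows "(\<lambda>w. fp (f w) n) holomorphic_on S"
  unfolding qpoch_def by (intro holomorphic_intros assms)

lemma isCont_ip: "isCont ip x"
  using holomorphic_on_imp_continuous_on[OF ip_holomorphic_UNIV]
  by (simp add: continuous_on_eq_continuous_at)

lemma tendsto_ip [tendsto_intros]: "(f \<longlongrightarrow> l) F \<Longrightarrow> ((\<lambda>x. ip (f x)) \<longlongrightarrow> ip l) F"
  by (rule isCont_tendsto_compose[OF isCont_ip])

lemma Q_power_tendsto_0: "(\<lambda>n. Q ^ n) \<longlonglongrightarrow> 0"
  using q_pos q_less_1 by (intro LIMSEQ_power_zero) simp

lemma ip_shift_tendsto: "(\<lambda>n. ip (x * Q ^ n)) \<longlonglongrightarrow> 1"
proof -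
  have "(\<lambda>n. ip (x * Q ^ n)) \<longlonglongrightarrow> ip (x * 0)"
    by (intro tendsto_intros Q_power_tendsto_0)
  then show ?thesis by simp
qed

lemma cnj_ip: "cnj (ip x) = ip (cnj x)"
proof -
  have "cnj (fp x n) = fp (cnj x) n" for n
    by (simp add: qpoch_def)
  then have "(\<lambda>n. fp (cnj x) n) \<longlonglongrightarrow> cnj (ip x)"
    using tendsto_cnj[OF qpoch_tendsto[of x]] by simp
  then show ?thesis
    using qpoch_tendsto LIMSEQ_unique by blast
qed

lemma ip_of_real: "ip (complex_of_real x) = complex_of_real (qpoch_inf x q)"
proof -
  have "convergent_prod (\<lambda>k. 1 - x * q ^ k)"
    using convergent_prod_qpoch[of "complex_of_real x"] 
    by (subst convergent_prod_of_real_iff[symmetric]) (simp add: o_def)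
  then have "(\<lambda>k. 1 - x * q ^ k) has_prod qpoch_inf x q"
    unfolding qpoch_inf_def by (rule convergent_prod_has_prod)
  then have "(\<lambda>k. complex_of_real (1 - x * q ^ k)) has_prod complex_of_real (qpoch_inf x q)"
    by (subst has_prod_of_real_iff)
  then show ?thesis
    using has_prod_qpoch[of "complex_of_real x"] by (simp add: has_prod_unique2)
qed

section \<open>The theta function (x, q/x; q) and its zeros\<close>

definition th :: "complex \<Rightarrow> complex" where
  "th x = ip x * ip (Q / x)"

lemma th_mult_Q:
  assumes "x \<noteq> 0"
  shows "th (x * Q) * x = - th x"
proof -
  have "th (x * Q) * x = ip (x * Q) * (x * ip (1 / x))"
    by (simp add: th_def)
  also have "x * ip (1 / x) = - ((1 - x) * ip (Q / x))"
    using assms by (subst ip_rec) (simp add: field_simps)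
  also have "ip (x * Q) * \<dots> = - th x"
    by (simp add: th_def ip_rec[of x])
  finally show ?thesis .
qed

lemma th_flip: "x \<noteq> 0 \<Longrightarrow> th (Q / x) = th x"
  by (simp add: th_def mult.commute)

text \<open>Iterating \<open>th_mult_Q\<close> gives th(x q^k) x^k = (-1)^k q^(-k(k-1)/2) th(x). The
  sign and the quadratic exponent do not involve \<open>x\<close>, so comparing two arguments
  removes them; cross-multiplication keeps the identity valid at zeros of \<open>th\<close>.\<close>

lemma th_shift_ratio:
  assumes "x \<noteq> 0" "y \<noteq> 0"
  shows "th (x * Q powi k) * x powi k * th y = th (y * Q powi k) * y powi k * th x"
proof (induction k rule: int_induct[of _ 0])
  case (step1 i)
  have a: "th (x * Q powi (i + 1)) * (x * Q powi i) = - th (x * Q powi i)"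
    using th_mult_Q[of "x * Q powi i"] assms by (simp add: power_int_add mult.assoc)
  have b: "th (y * Q powi (i + 1)) * (y * Q powi i) = - th (y * Q powi i)"
    using th_mult_Q[of "y * Q powi i"] assms by (simp add: power_int_add mult.assoc)
  have "th (x * Q powi (i + 1)) * x powi (i + 1) * th y * Q powi i
      = (th (x * Q powi (i + 1)) * (x * Q powi i)) * x powi i * th y"
    using assms by (simp add: power_int_add mult_ac)
  also have "\<dots> = - (th (x * Q powi i) * x powi i * th y)"
    by (simp add: a)
  also have "\<dots> = (th (y * Q powi (i + 1)) * (y * Q powi i)) * y powi i * th x"
    by (simp add: b step1)
  also have "\<dots> = th (y * Q powi (i + 1)) * y powi (i + 1) * th x * Q powi i"
    using assms by (simp add: power_int_add mult_ac)
  finally show ?case by simp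
next
  case (step2 i)
  have s: "Q powi (i - 1) * Q = Q powi i" "x powi (i - 1) * x = x powi i" "y powi (i - 1) * y = y powi i"
    using assms by (simp_all add: power_int_diff)
  have a: "th (x * Q powi i) * (x * Q powi (i - 1)) = - th (x * Q powi (i - 1))"
    using th_mult_Q[of "x * Q powi (i - 1)"] assms s by (simp add: mult.assoc)
  have b: "th (y * Q powi i) * (y * Q powi (i - 1)) = - th (y * Q powi (i - 1))"
    using th_mult_Q[of "y * Q powi (i - 1)"] assms s by (simp add: mult.assoc)
  show ?case
    using a b step2(2) unfolding s(2,3)[symmetric] by algebra
qed simp

lemma th_eq_0_iff:
  assumes "x \<noteq> 0"
  shows "th x = 0 \<longleftrightarrow> (\<exists>k::int. x = Q powi k)"
proof
  assume "th x = 0"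
  then consider n where "x * Q ^ n = 1" | n where "Q / x * Q ^ n = 1"
    unfolding th_def by (metis ip_eq_0_iff mult_eq_0_iff)
  then show "\<exists>k::int. x = Q powi k"
  proof cases
    case 1
    then have "x = Q powi (- int n)"
      by (simp add: power_int_minus divide_simps)
    then show ?thesis ..
  next
    case 2
    then have "x = Q powi (int (Suc n))"
      using assms by (subst power_int_of_nat) (simp add: divide_simps)
    then show ?thesis ..
  qed
next
  assume "\<exists>k::int. x = Q powi k"
  then obtain k :: int where k: "x = Q powi k" ..
  show "th x = 0"
  proof (cases "k \<le> 0")
    case True
    then have "x * Q ^ nat (- k) = 1"
      by (simp add: k power_int_def power_inverse[symmetric] divide_simps)
    then show ?thesis by (simp add: th_def ip_eq_0I)
  next
    case False
    then have "k = int (Suc (nat (k - 1)))" by simp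
    then have "x = Q ^ Suc (nat (k - 1))"
      using k by (metis power_int_of_nat)
    then have "Q / x * Q ^ nat (k - 1) = 1" by (simp add: divide_simps)
    then have "ip (Q / x) = 0" by (rule ip_eq_0I)
    then show ?thesis by (simp add: th_def)
  qed
qed

end

section \<open>Heine transformation and the q-difference equation\<close>

text \<open>Iterated \<open>suminf\<close> is turned into \<open>infsum\<close>, where absolute
  summability on the product set justifies the interchange. A product of two geometric majorants is
  what Heine's double series offers.\<close>

lemma suminf_swap_geometric:
  fixes f :: "nat \<Rightarrow> nat \<Rightarrow> complex" and \<alpha> \<beta> C :: real
  assumes \<alpha>: "0 \<le> \<alpha>" "\<alpha> < 1" and \<beta>: "0 \<le> \<beta>" "\<beta> < 1"
    and bound: "\<And>n m. norm (f n m) \<le> C * \<alpha> ^ n * \<beta> ^ m"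
  shows "(\<Sum>n. \<Sum>m. f n m) = (\<Sum>m. \<Sum>n. f n m)" "summable (\<lambda>n. \<Sum>m. f n m)"
proof -
  have inf_eq: "infsum g UNIV = suminf g" if "summable (\<lambda>n. norm (g n))" for g :: "nat \<Rightarrow> complex"
    using norm_summable_imp_has_sum[OF that summable_sums[OF summable_norm_cancel[OF that]]]
    by (rule infsumI)
  have geo: "(\<lambda>n. t ^ n) sums (1 / (1 - t))" if "0 \<le> t" "t < 1" for t :: real
    using that by (intro geometric_sums) auto
  have row: "summable (\<lambda>m. norm (f n m))" for n
    by (rule summable_comparison_test[OF _ summable_mult[OF sums_summable[OF geo[OF \<beta>]], of "C * \<alpha> ^ n"]])
      (use bound in auto)
  have col: "summable (\<lambda>n. norm (f n m))" for m
    by (rule summable_comparison_test[OF _ summable_mult[OF sums_summable[OF geo[OF \<alpha>]], of "C * \<beta> ^ m"]])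
      (use bound in \<open>auto simp: mult_ac\<close>)
  have row_le: "(\<Sum>m. norm (f n m)) \<le> C / (1 - \<beta>) * \<alpha> ^ n" for n
  proof -
    have "(\<lambda>m. C * \<alpha> ^ n * \<beta> ^ m) sums (C * \<alpha> ^ n * (1 / (1 - \<beta>)))"
      by (intro sums_mult geo \<beta>)
    then show ?thesis
      using sums_le[OF bound summable_sums[OF row]] by (simp add: mult_ac)
  qed
  have col_le: "(\<Sum>n. norm (f n m)) \<le> C / (1 - \<alpha>) * \<beta> ^ m" for m
  proof -
    have 1: "(\<lambda>n. C * \<beta> ^ m * \<alpha> ^ n) sums (C * \<beta> ^ m * (1 / (1 - \<alpha>)))"
      by (intro sums_mult geo \<alpha>)
    have 2: "norm (f n m) \<le> C * \<beta> ^ m * \<alpha> ^ n" for n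
      using bound[of n m] by (simp add: mult_ac)
    show ?thesis
      using sums_le[OF 2 summable_sums[OF col] 1] by (simp add: mult_ac)
  qed
  have nonneg_inf: "infsum g UNIV = suminf g" "g summable_on UNIV"
    if "summable g" "\<And>n. 0 \<le> g n" for g :: "nat \<Rightarrow> real"
    using sums_nonneg_imp_has_sum[OF summable_sums[OF that(1)] that(2)]
    by (auto intro: infsumI has_sum_imp_summable)
  have rows: "summable (\<lambda>n. \<Sum>m. norm (f n m))"
    by (rule summable_comparison_test[OF _ summable_mult[OF sums_summable[OF geo[OF \<alpha>]], of "C / (1 - \<beta>)"]])
      (use row_le suminf_nonneg[OF row] in auto)
  have cols: "summable (\<lambda>m. \<Sum>n. norm (f n m))"
    by (rule summable_comparison_test[OF _ summable_mult[OF sums_summable[OF geo[OF \<beta>]], of "C / (1 - \<alpha>)"]])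
      (use col_le suminf_nonneg[OF col] in auto)
  have "(\<lambda>p. norm (case p of (n, m) \<Rightarrow> f n m)) summable_on UNIV \<times> UNIV"
    unfolding Infinite_Sum.abs_summable_on_Sigma_iff
  proof (intro conjI ballI)
    show "(\<lambda>m. norm (case (n, m) of (n, m) \<Rightarrow> f n m)) summable_on UNIV" for n
      using nonneg_inf(2)[OF row] by simp
    have "infsum (\<lambda>m. norm (f n m)) UNIV = (\<Sum>m. norm (f n m))" for n
      using nonneg_inf(1)[OF row] by simp
    then show "(\<lambda>n. norm (\<Sum>\<^sub>\<infinity>m. norm (case (n, m) of (n, m) \<Rightarrow> f n m))) summable_on UNIV"
      using nonneg_inf(2)[OF rows] suminf_nonneg[OF row] by simp
  qed
  then have "(\<lambda>(n, m). f n m) summable_on UNIV \<times> UNIV"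
    by (rule Infinite_Sum.abs_summable_summable)
  then have "infsum (\<lambda>n. infsum (\<lambda>m. f n m) UNIV) UNIV = infsum (\<lambda>m. infsum (\<lambda>n. f n m) UNIV) UNIV"
    by (rule infsum_swap_banach)
  then have "infsum (\<lambda>n. \<Sum>m. f n m) UNIV = infsum (\<lambda>m. \<Sum>n. f n m) UNIV"
    by (simp add: inf_eq row col)
  moreover have *: "summable (\<lambda>n. norm (\<Sum>m. f n m))"
    by (rule summable_comparison_test[OF _ rows]) (use summable_norm[OF row] in auto)
  moreover have "summable (\<lambda>m. norm (\<Sum>n. f n m))"
    by (rule summable_comparison_test[OF _ cols]) (use summable_norm[OF col] in auto)
  ultimately show "(\<Sum>n. \<Sum>m. f n m) = (\<Sum>m. \<Sum>n. f n m)"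
    by (simp add: inf_eq)
  show "summable (\<lambda>n. \<Sum>m. f n m)"
    using * by (rule summable_norm_cancel)
qed

context q_base
begin

lemma norm_prod_diff_le:
  assumes "norm b \<le> \<beta>" "0 < \<beta>" "norm c \<le> \<gamma>"
  shows "norm (\<Prod>i<n. b - c * Q ^ i) \<le> \<beta> ^ n * exp (\<gamma> / \<beta> / (1 - q))"
proof -
  have "norm (\<Prod>i<n. b - c * Q ^ i) = (\<Prod>i<n. norm (b - c * Q ^ i))"
    by (simp add: prod_norm)
  also have "\<dots> \<le> (\<Prod>i<n. \<beta> * (1 + \<gamma> / \<beta> * q ^ i))"
  proof (intro prod_mono conjI)
    fix i
    have "norm (b - c * Q ^ i) \<le> norm b + norm (c * Q ^ i)"
      by (rule norm_triangle_ineq4)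
    also have "\<dots> \<le> \<beta> + \<gamma> * q ^ i"
      using assms q_pos by (intro add_mono) (auto simp: norm_mult norm_power mult_right_mono)
    finally show "norm (b - c * Q ^ i) \<le> \<beta> * (1 + \<gamma> / \<beta> * q ^ i)"
      using assms by (simp add: distrib_left)
  qed simp
  also have "\<dots> = \<beta> ^ n * (\<Prod>i<n. 1 + \<gamma> / \<beta> * q ^ i)"
    by (simp add: prod.distrib)
  also have "\<dots> \<le> \<beta> ^ n * exp (\<gamma> / \<beta> / (1 - q))"
    using assms order_trans[OF norm_ge_zero assms(3)]
    by (intro mult_left_mono prod_le_exp) auto
  finally show ?thesis .
qed

text \<open>General term of Heine's transformed series. The product stands for (c/b;q)_n b^n but
  makes sense at \<open>b = 0\<close>; \<open>ip (A * Q ^ n)\<close> stands for (A;q)_inf / (A;q)_n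
  but makes sense when (A;q)_n vanishes. Both cases occur: the first at \<open>y = 0\<close>, the
  second at the poles.\<close>

definition hterm :: "complex \<Rightarrow> complex \<Rightarrow> complex \<Rightarrow> complex \<Rightarrow> nat \<Rightarrow> complex" where
  "hterm A b c z n = fp z n * (\<Prod>i<n. b - c * Q ^ i) * ip (A * Q ^ n) / fp Q n"

definition hsum :: "complex \<Rightarrow> complex \<Rightarrow> complex \<Rightarrow> complex \<Rightarrow> complex" where
  "hsum A b c z = (\<Sum>n. hterm A b c z n)"

definition heine :: "complex \<Rightarrow> complex \<Rightarrow> complex \<Rightarrow> complex \<Rightarrow> complex" where
  "heine a b c z = ip b / (ip c * ip z) * hsum (a * z) b c z"

lemma norm_mult_Q_power_le: "norm A \<le> \<alpha> \<Longrightarrow> norm (A * Q ^ n) \<le> \<alpha>"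
proof -
  assume "norm A \<le> \<alpha>"
  moreover have "norm A * q ^ n \<le> norm A * 1"
    using q_pos q_less_1 by (intro mult_left_mono power_le_one) auto
  ultimately show ?thesis
    by (simp add: norm_mult norm_power)
qed

text \<open>One constant serves all parameters in a polydisc; this is what locally uniform
  convergence in \<open>y\<close> and in \<open>z\<close> needs. Each factor except the power of
  \<open>b\<close> is bounded independently of \<open>n\<close>.\<close>

lemma hterm_bound:
  assumes "0 < \<beta>"
  obtains C where "C > 0"
    "\<And>A b c z n. norm A \<le> \<alpha> \<Longrightarrow> norm b \<le> \<beta> \<Longrightarrow> norm c \<le> \<gamma> \<Longrightarrow> norm z \<le> \<zeta> \<Longrightarrow>
      norm (hterm A b c z n) \<le> C * \<beta> ^ n"
proof -
  obtain B where B: "B > 0" "\<And>n. norm (1 / fp Q n) \<le> B"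
    using inverse_fp_bounded[of Q] by auto
  define E where "E = exp (\<zeta> / (1 - q)) * exp (\<gamma> / \<beta> / (1 - q)) * exp (\<alpha> / (1 - q)) * B"
  have "norm (hterm A b c z n) \<le> E * \<beta> ^ n"
    if "norm A \<le> \<alpha>" "norm b \<le> \<beta>" "norm c \<le> \<gamma>" "norm z \<le> \<zeta>" for A b c z n
  proof -
    have "norm (hterm A b c z n)
        = norm (fp z n) * norm (\<Prod>i<n. b - c * Q ^ i) * norm (ip (A * Q ^ n)) * norm (1 / fp Q n)"
      by (simp add: hterm_def norm_mult norm_divide)
    also have "\<dots> \<le> exp (\<zeta> / (1 - q)) * (\<beta> ^ n * exp (\<gamma> / \<beta> / (1 - q))) * exp (\<alpha> / (1 - q)) * B"
      using that assms B
      by (intro mult_mono norm_fp_le norm_prod_diff_le norm_ip_le norm_mult_Q_power_le)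
        auto
    finally show ?thesis by (simp add: E_def mult_ac)
  qed
  moreover have "E > 0" using B by (simp add: E_def)
  ultimately show ?thesis using that by blast
qed

lemma hterm_summable_norm:
  assumes "norm b < 1"
  shows "summable (\<lambda>n. norm (hterm A b c z n))"
proof -
  \<comment> \<open>The lower bound 1/2 keeps \<beta> positive when \<open>b = 0\<close>, as
    \<open>hterm_bound\<close> demands.\<close>
  define \<beta> where "\<beta> = max (norm b) (1 / 2)"
  have \<beta>: "0 < \<beta>" "\<beta> < 1" "norm b \<le> \<beta>"
    using assms by (auto simp: \<beta>_def)
  obtain C where C: "C > 0" "\<And>n. norm (hterm A b c z n) \<le> C * \<beta> ^ n"
    using hterm_bound[OF \<beta>(1), of "norm A" "norm c" "norm z"] \<beta>(3) by (metis order_refl)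
  show ?thesis
    by (rule summable_comparison_test[OF _ summable_mult[OF summable_geometric, of \<beta> C]])
      (use C \<beta> in auto)
qed

lemma hterm_summable: "norm b < 1 \<Longrightarrow> summable (hterm A b c z)"
  using hterm_summable_norm summable_norm_cancel by blast

text \<open>Stated for four holomorphic parameter functions because \<open>y\<close> enters several
  slots at once. On a closed disc the norm of \<open>b\<close> attains a maximum below 1, which
  gives a uniform geometric majorant.\<close>

lemma hsum_holomorphic:
  assumes S: "open S"
    and hol: "A holomorphic_on S" "b holomorphic_on S" "c holomorphic_on S" "z holomorphic_on S"
    and b: "\<And>w. w \<in> S \<Longrightarrow> norm (b w) < 1"
  shows "(\<lambda>w. hsum (A w) (b w) (c w) (z w)) holomorphic_on S"
proof (rule holomorphic_uniform_sequence[of S "\<lambda>N w. \<Sum>n<N. hterm (A w) (b w) (c w) (z w) n"])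
  show "(\<lambda>w. \<Sum>n<N. hterm (A w) (b w) (c w) (z w) n) holomorphic_on S" for N
    unfolding hterm_def by (intro holomorphic_intros hol) auto
next
  fix x assume "x \<in> S"
  then obtain d where d: "d > 0" "cball x d \<subseteq> S"
    using S open_contains_cball by blast
  have bdd: "\<exists>t. \<forall>w\<in>cball x d. norm (f w) \<le> t" if "f holomorphic_on S" for f
  proof -
    have "compact (f ` cball x d)"
      using that d(2)
      by (intro compact_continuous_image compact_cball)
        (use holomorphic_on_imp_continuous_on continuous_on_subset in blast)
    then show ?thesis
      using compact_imp_bounded bounded_iff by (metis image_eqI)
  qed
  obtain \<alpha> \<gamma> \<zeta> where *: "\<And>w. w \<in> cball x d \<Longrightarrow> norm (A w) \<le> \<alpha>"
    "\<And>w. w \<in> cball x d \<Longrightarrow> norm (c w) \<le> \<gamma>" "\<And>w. w \<in> cball x d \<Longrightarrow> norm (z w) \<le> \<zeta>"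
    using bdd[OF hol(1)] bdd[OF hol(3)] bdd[OF hol(4)] by blast
  have "continuous_on (cball x d) (\<lambda>w. norm (b w))"
    using hol(2) d(2) by (intro continuous_on_norm)
      (use holomorphic_on_imp_continuous_on continuous_on_subset in blast)
  then obtain w0 where w0: "w0 \<in> cball x d" "\<And>w. w \<in> cball x d \<Longrightarrow> norm (b w) \<le> norm (b w0)"
    using continuous_attains_sup[of "cball x d" "\<lambda>w. norm (b w)"] d(1) by auto
  define \<beta> where "\<beta> = max (norm (b w0)) (1 / 2)"
  have \<beta>: "0 < \<beta>" "\<beta> < 1" "\<And>w. w \<in> cball x d \<Longrightarrow> norm (b w) \<le> \<beta>"
    using w0(1) b d(2) order_trans[OF w0(2) max.cobounded1] by (auto simp: \<beta>_def subset_eq)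
  obtain C where C: "C > 0" "\<And>A b c z n. norm A \<le> \<alpha> \<Longrightarrow> norm b \<le> \<beta> \<Longrightarrow> norm c \<le> \<gamma> \<Longrightarrow> norm z \<le> \<zeta> \<Longrightarrow>
      norm (hterm A b c z n) \<le> C * \<beta> ^ n"
    using hterm_bound[OF \<beta>(1), of \<alpha> \<gamma> \<zeta>] by blast
  have "uniform_limit (cball x d) (\<lambda>N w. \<Sum>n<N. hterm (A w) (b w) (c w) (z w) n)
      (\<lambda>w. \<Sum>n. hterm (A w) (b w) (c w) (z w) n) sequentially"
    using C(2) * \<beta> by (intro Weierstrass_m_test[where M = "\<lambda>n. C * \<beta> ^ n"] summable_mult summable_geometric) auto
  then show "\<exists>d>0. cball x d \<subseteq> S \<and>
      uniform_limit (cball x d) (\<lambda>N w. \<Sum>n<N. hterm (A w) (b w) (c w) (z w) n)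
        (\<lambda>w. hsum (A w) (b w) (c w) (z w)) sequentially"
    unfolding hsum_def using d by blast
qed (rule S)

lemma bounded_coeff_sums:
  fixes u :: "nat \<Rightarrow> complex"
  assumes "\<And>n. norm (u n) \<le> C" "norm z < 1"
  shows "summable (\<lambda>n. u n * z ^ n)"
proof (rule summable_comparison_test[OF _ summable_mult[OF summable_geometric, of "norm z" C]])
  show "\<exists>N. \<forall>n\<ge>N. norm (u n * z ^ n) \<le> C * norm z ^ n"
    using assms(1) by (auto simp: norm_mult norm_power intro!: mult_right_mono)
qed (use assms in auto)

lemma coeff_2phi1_bounded:
  assumes "ip c \<noteq> 0"
  obtains C where "C > 0" "\<And>n. norm (fp a n * fp b n / (fp Q n * fp c n)) \<le> C"
proof -
  obtain B1 where B1: "B1 > 0" "\<And>n. norm (1 / fp Q n) \<le> B1"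
    using inverse_fp_bounded[of Q] by auto
  obtain B2 where B2: "B2 > 0" "\<And>n. norm (1 / fp c n) \<le> B2"
    using inverse_fp_bounded[OF assms] by auto
  define C where "C = exp (norm a / (1 - q)) * exp (norm b / (1 - q)) * (B1 * B2)"
  have "norm (fp a n * fp b n / (fp Q n * fp c n)) \<le> C" for n
  proof -
    have "norm (fp a n * fp b n / (fp Q n * fp c n))
        = norm (fp a n) * norm (fp b n) * (norm (1 / fp Q n) * norm (1 / fp c n))"
      by (simp add: norm_mult norm_divide)
    also have "\<dots> \<le> C"
      unfolding C_def using B1 B2 by (intro mult_mono norm_fp_le) auto
    finally show ?thesis .
  qed
  moreover have "C > 0" using B1 B2 by (simp add: C_def)
  ultimately show ?thesis using that by blast
qed

lemma coeff_binomial_bounded: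
  obtains C where "C > 0" "\<And>n. norm (fp a n / fp Q n) \<le> C"
  using coeff_2phi1_bounded[of 0 a 0] by (auto simp: qpoch_def)

lemma power_series_isCont_0:
  fixes u :: "nat \<Rightarrow> complex"
  assumes "\<And>n. norm (u n) \<le> C"
  shows "isCont (\<lambda>z. \<Sum>n. u n * z ^ n) 0"
proof (rule isCont_powser)
  show "summable (\<lambda>n. u n * (1 / 2) ^ n)"
    using assms by (rule bounded_coeff_sums) auto
qed auto

text \<open>Comparing coefficients gives (1 - z) F(z) = (1 - a z) F(q z). Iterating moves the
  argument to 0, where \<open>F\<close> is continuous with value 1, and the accumulated factors
  become the two infinite products.\<close>

theorem q_binomial:
  assumes z: "norm z < 1"
  shows "(\<lambda>n. fp a n / fp Q n * z ^ n) sums (ip (a * z) / ip z)"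
proof -
  obtain C where C: "\<And>n. norm (fp a n / fp Q n) \<le> C"
    using coeff_binomial_bounded by blast
  define F where "F z = (\<Sum>n. fp a n / fp Q n * z ^ n)" for z
  have sm: "summable (\<lambda>n. fp a n / fp Q n * z ^ n)" if "norm z < 1" for z
    using C that by (rule bounded_coeff_sums)
  have small: "norm (z * Q ^ n) < 1" if "norm z < 1" for z n
    using norm_mult_Q_power_le[OF order_refl, of z n] that by simp
  have step: "(1 - z) * F z = (1 - a * z) * F (z * Q)" if z: "norm z < 1" for z
  proof -
    have "(\<lambda>n. fp a n / fp Q n * (1 - Q ^ n) * z ^ n) sums (F z - F (z * Q))"
    proof -
      have "(\<lambda>n. fp a n / fp Q n * z ^ n - fp a n / fp Q n * (z * Q) ^ n) sums (F z - F (z * Q))"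
        unfolding F_def using small[OF z, of 1] by (intro sums_diff summable_sums sm z) simp
      then show ?thesis
        by (rule sums_cong[THEN iffD1, rotated]) (simp add: power_mult_distrib algebra_simps diff_divide_distrib)
    qed
    \<comment> \<open>The factor \<open>1 - Q ^ n\<close> removes the term at \<open>n = 0\<close>,
      so the index may be shifted.\<close>
    then have "(\<lambda>n. fp a (Suc n) / fp Q (Suc n) * (1 - Q ^ Suc n) * z ^ Suc n) sums (F z - F (z * Q))"
      by (subst sums_Suc_iff) simp
    moreover have "fp a (Suc n) / fp Q (Suc n) * (1 - Q ^ Suc n) = fp a n / fp Q n * (1 - a * Q ^ n)" for n
      using fp_Q_nonzero[of "Suc n"] unfolding fp_Suc by (simp add: divide_simps)
    ultimately have "(\<lambda>n. fp a n / fp Q n * (1 - a * Q ^ n) * z ^ Suc n) sums (F z - F (z * Q))"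
      by (simp only:)
    moreover have "(\<lambda>n. z * (fp a n / fp Q n * z ^ n - a * (fp a n / fp Q n * (z * Q) ^ n)))
        sums (z * (F z - a * F (z * Q)))"
      unfolding F_def using small[OF z, of 1]
      by (intro sums_mult sums_diff summable_sums sm z) simp
    then have "(\<lambda>n. fp a n / fp Q n * (1 - a * Q ^ n) * z ^ Suc n) sums (z * (F z - a * F (z * Q)))"
      by (rule sums_cong[THEN iffD1, rotated]) (simp add: power_mult_distrib algebra_simps diff_divide_distrib)
    ultimately have "F z - F (z * Q) = z * (F z - a * F (z * Q))"
      by (rule sums_unique2)
    then show ?thesis by (simp add: algebra_simps)
  qed
  have iter: "fp z n * F z = fp (a * z) n * F (z * Q ^ n)" for n
  proof (induction n)
    case (Suc n)
    have "fp z (Suc n) * F z = (1 - z * Q ^ n) * (fp (a * z) n * F (z * Q ^ n))"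
      by (simp add: fp_Suc Suc[symmetric] mult_ac)
    also have "\<dots> = fp (a * z) n * ((1 - z * Q ^ n) * F (z * Q ^ n))"
      by (simp add: mult_ac)
    also have "\<dots> = fp (a * z) (Suc n) * F (z * Q ^ Suc n)"
      unfolding step[OF small[OF z]] by (simp add: fp_Suc mult_ac)
    finally show ?case .
  qed simp
  have "isCont F 0"
    using power_series_isCont_0[OF C] unfolding F_def .
  moreover have "(\<lambda>n. z * Q ^ n) \<longlonglongrightarrow> z * 0"
    by (intro tendsto_intros Q_power_tendsto_0)
  ultimately have "(\<lambda>n. F (z * Q ^ n)) \<longlonglongrightarrow> F 0"
    by (auto intro: isCont_tendsto_compose)
  moreover have "F 0 = 1"
    using powser_zero[of "\<lambda>n. fp a n / fp Q n"] by (simp add: F_def)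
  ultimately have "(\<lambda>n. fp (a * z) n * F (z * Q ^ n)) \<longlonglongrightarrow> ip (a * z) * 1"
    by (intro tendsto_mult qpoch_tendsto) simp
  moreover have "(\<lambda>n. fp z n * F z) \<longlonglongrightarrow> ip z * F z"
    by (intro tendsto_intros qpoch_tendsto)
  ultimately have "ip z * F z = ip (a * z)"
    unfolding iter using LIMSEQ_unique by fastforce
  then have "F z = ip (a * z) / ip z"
    using ip_nonzero_norm[OF z] by (simp add: field_simps)
  then show ?thesis
    using summable_sums[OF sm[OF z]] by (simp add: F_def)
qed

lemma prod_diff_eq:
  assumes "b \<noteq> 0"
  shows "(\<Prod>i<n. b - c * Q ^ i) = fp (c / b) n * b ^ n"
proof -
  have "(\<Prod>i<n. b - c * Q ^ i) = (\<Prod>i<n. (1 - c / b * Q ^ i) * b)"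
    using assms by (intro prod.cong) (auto simp: field_simps)
  then show ?thesis by (simp add: qpoch_def prod.distrib)
qed

text \<open>(b;q)_n / (c;q)_n equals a constant times (c q^n;q)_inf / (b q^n;q)_inf, which the
  q-binomial theorem expands in powers of \<open>b q^n\<close>. After interchanging the sums, the
  sum over \<open>n\<close> is again a q-binomial series, now at \<open>z q^m\<close>.\<close>

theorem heine_transformation:
  assumes z: "norm z < 1" and b: "norm b < 1" "b \<noteq> 0" and c: "ip c \<noteq> 0"
  shows "phi21_series a b c Q z = heine a b c z"
proof -
  obtain C1 where C1: "C1 > 0" "\<And>n. norm (fp a n / fp Q n) \<le> C1"
    using coeff_binomial_bounded by blast
  obtain C2 where C2: "C2 > 0" "\<And>n. norm (fp (c / b) n / fp Q n) \<le> C2"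
    using coeff_binomial_bounded by blast
  have ipb: "ip b \<noteq> 0" using b ip_nonzero_norm by blast
  have ipz: "ip z \<noteq> 0" using z ip_nonzero_norm by blast
  have small: "norm (x * Q ^ n) < 1" if "norm x < 1" for x n
    using norm_mult_Q_power_le[OF order_refl, of x n] that by simp
  define f where "f n m = fp a n / fp Q n * z ^ n * (fp (c / b) m / fp Q m * (b * Q ^ n) ^ m)" for n m
  have inner1: "(\<Sum>m. f n m) = fp a n / fp Q n * z ^ n * (ip (c * Q ^ n) / ip (b * Q ^ n))" for n
    using sums_mult[OF q_binomial[OF small[OF b(1)], of "c / b" n], of "fp a n / fp Q n * z ^ n"] b(2)
    unfolding f_def by (simp add: sums_iff)
  have f_alt: "f n m = fp (c / b) m / fp Q m * b ^ m * (fp a n / fp Q n * (z * Q ^ m) ^ n)" for n m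
    by (simp add: f_def power_mult_distrib power_mult[symmetric] mult.commute[of n m] mult_ac)
  have inner2: "(\<Sum>n. f n m) = fp (c / b) m / fp Q m * b ^ m * (ip (a * z * Q ^ m) / ip (z * Q ^ m))" for m
    using sums_mult[OF q_binomial[OF small[OF z], of a m], of "fp (c / b) m / fp Q m * b ^ m"]
    unfolding f_alt by (simp add: sums_iff mult.assoc)
  have "norm (f n m) \<le> C1 * C2 * norm z ^ n * norm b ^ m" for n m
  proof -
    have "norm (f n m) = norm (fp a n / fp Q n) * norm z ^ n * (norm (fp (c / b) m / fp Q m) * norm (b * Q ^ n) ^ m)"
      by (simp add: f_def norm_mult norm_power norm_divide)
    also have "\<dots> \<le> C1 * norm z ^ n * (C2 * norm b ^ m)"
      using C1 C2 by (intro mult_mono power_mono norm_mult_Q_power_le) auto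
    finally show ?thesis by (simp add: mult_ac)
  qed
  then have swap: "(\<Sum>n. \<Sum>m. f n m) = (\<Sum>m. \<Sum>n. f n m)" "summable (\<lambda>n. \<Sum>m. f n m)"
    using z b by (auto intro!: suminf_swap_geometric[where \<alpha> = "norm z" and \<beta> = "norm b" and C = "C1 * C2"])
  have "fp a n * fp b n / (fp Q n * fp c n) * z ^ n = ip b / ip c * (\<Sum>m. f n m)" for n
    unfolding inner1 using ipb c ip_split[of b n] ip_split[of c n] 
    by (auto simp: divide_simps)
  then have "phi21_series a b c Q z = (\<Sum>n. ip b / ip c * (\<Sum>m. f n m))"
    unfolding phi21_series_def by simp
  also have "\<dots> = ip b / ip c * (\<Sum>n. \<Sum>m. f n m)"
    by (rule suminf_mult[OF swap(2)])
  also have "(\<Sum>n. \<Sum>m. f n m) = (\<Sum>m. hterm (a * z) b c z m / ip z)"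
  proof -
    have "fp (c / b) m / fp Q m * b ^ m * (ip (a * z * Q ^ m) / ip (z * Q ^ m)) = hterm (a * z) b c z m / ip z" for m
      using ip_split[of z m] ipz b(2) by (auto simp: hterm_def prod_diff_eq divide_simps mult_ac)
    then show ?thesis unfolding swap(1) inner2 by simp
  qed
  also have "\<dots> = hsum (a * z) b c z / ip z"
    unfolding hsum_def by (rule suminf_divide[OF hterm_summable[OF b(1)]])
  finally show ?thesis by (simp add: heine_def)
qed

lemma phi21_series_sums:
  assumes "ip c \<noteq> 0" "norm z < 1"
  shows "(\<lambda>n. fp a n * fp b n / (fp Q n * fp c n) * z ^ n) sums phi21_series a b c Q z"
proof -
  obtain C where "\<And>n. norm (fp a n * fp b n / (fp Q n * fp c n)) \<le> C"
    using coeff_2phi1_bounded[OF assms(1)] by blast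
  then show ?thesis
    unfolding phi21_series_def by (intro summable_sums bounded_coeff_sums assms(2))
qed

text \<open>Replacing \<open>z\<close> by \<open>z Q\<close> multiplies the n-th coefficient by
  \<open>Q ^ n\<close>. The equation therefore encodes the coefficient recursion (1 - q^(n+1)) (1 -
  c q^n) U_(n+1) = (1 - a q^n) (1 - b q^n) U_n; \<open>L\<close> collects its left side and
  \<open>z * R\<close> its right side.\<close>

lemma phi21_series_qdiff:
  fixes a b :: complex
  assumes c: "ip c \<noteq> 0" and z: "norm z < 1"
  defines "u \<equiv> phi21_series a b c Q"
  shows "(1 - z) * u z - (1 + c / Q - (a + b) * z) * u (z * Q) + (c / Q - a * b * z) * u (z * Q\<^sup>2) = 0"
proof -
  define U where "U n = fp a n * fp b n / (fp Q n * fp c n)" for n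
  have small: "norm (z * Q ^ n) < 1" for n
    using norm_mult_Q_power_le[OF order_refl, of z n] z by simp
  have S: "(\<lambda>n. U n * (z * Q ^ k) ^ n) sums u (z * Q ^ k)" for k
    unfolding u_def U_def by (rule phi21_series_sums[OF c small])
  have S0: "(\<lambda>n. U n * z ^ n) sums u z" and S1: "(\<lambda>n. U n * (z * Q) ^ n) sums u (z * Q)"
    and S2: "(\<lambda>n. U n * (z * Q\<^sup>2) ^ n) sums u (z * Q\<^sup>2)"
    using S[of 0] S[of 1] S[of 2] by simp_all
  define L where "L = u z - (1 + c / Q) * u (z * Q) + c / Q * u (z * Q\<^sup>2)"
  define R where "R = u z - (a + b) * u (z * Q) + a * b * u (z * Q\<^sup>2)"
  have L0: "(\<lambda>n. U n * z ^ n - (1 + c / Q) * (U n * (z * Q) ^ n) + c / Q * (U n * (z * Q\<^sup>2) ^ n)) sums L"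
    unfolding L_def by (intro sums_add sums_diff sums_mult S0 S1 S2)
  have "(\<lambda>n. U n * (1 - Q ^ n) * (1 - c / Q * Q ^ n) * z ^ n) sums L"
    by (rule sums_cong[THEN iffD1, OF _ L0])
      (simp add: power_mult_distrib power_mult[symmetric] power_add mult_2 mult_2_right algebra_simps)
  then have "(\<lambda>n. U (Suc n) * (1 - Q ^ Suc n) * (1 - c / Q * Q ^ Suc n) * z ^ Suc n) sums L"
    by (subst sums_Suc_iff) simp
  moreover have "U (Suc n) * (1 - Q ^ Suc n) * (1 - c / Q * Q ^ Suc n) = U n * (1 - a * Q ^ n) * (1 - b * Q ^ n)" for n
    using fp_Q_nonzero[of "Suc n"] fp_nonzero[OF c, of "Suc n"] unfolding U_def fp_Suc
    by (simp add: divide_simps)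
  ultimately have L1: "(\<lambda>n. U n * (1 - a * Q ^ n) * (1 - b * Q ^ n) * z ^ Suc n) sums L"
    by (simp only:)
  have R0: "(\<lambda>n. z * (U n * z ^ n - (a + b) * (U n * (z * Q) ^ n) + a * b * (U n * (z * Q\<^sup>2) ^ n))) sums (z * R)"
    unfolding R_def by (intro sums_add sums_diff sums_mult S0 S1 S2)
  have "(\<lambda>n. U n * (1 - a * Q ^ n) * (1 - b * Q ^ n) * z ^ Suc n) sums (z * R)"
    by (rule sums_cong[THEN iffD1, OF _ R0])
      (simp add: power_mult_distrib power_mult[symmetric] power_add mult_2 mult_2_right algebra_simps)
  then have "L = z * R"
    using L1 sums_unique2 by blast
  then show ?thesis
    unfolding L_def R_def by (simp add: algebra_simps)
qed

section \<open>Continuation to the cut plane\<close>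

definition cut_plane :: "complex set" where
  "cut_plane = UNIV - complex_of_real ` {1..}"

lemma open_cut_plane: "open cut_plane"
proof -
  have "closed (complex_of_real ` {1..})"
    by (intro closed_injective_linear_image) (auto simp: linear_of_real inj_on_def)
  then show ?thesis by (simp add: cut_plane_def Compl_eq_Diff_UNIV[symmetric] open_Compl)
qed

lemma cut_plane_scale:
  assumes "z \<in> cut_plane" "0 \<le> t" "t \<le> 1"
  shows "complex_of_real t * z \<in> cut_plane"
proof (rule ccontr)
  assume "complex_of_real t * z \<notin> cut_plane"
  then obtain x where x: "x \<ge> 1" "complex_of_real t * z = complex_of_real x"
    by (auto simp: cut_plane_def)
  then have "t \<noteq> 0" by auto
  then have "z = complex_of_real (x / t)" "x / t \<ge> 1"
    using x assms(2,3) by (auto simp: field_simps)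
  then show False using assms(1) unfolding cut_plane_def by blast
qed

lemma cut_plane_mult_Q: "z \<in> cut_plane \<Longrightarrow> z * Q \<in> cut_plane"
  using cut_plane_scale[of z q] q_pos q_less_1 by (simp add: mult.commute)

lemma connected_cut_plane: "connected cut_plane"
proof (rule starlike_imp_connected)
  show "starlike cut_plane"
    unfolding starlike_def
  proof (intro bexI ballI)
    show "0 \<in> cut_plane" by (auto simp: cut_plane_def)
    show "closed_segment 0 z \<subseteq> cut_plane" if "z \<in> cut_plane" for z
      using cut_plane_scale[OF that] by (auto simp: in_segment scaleR_conv_of_real)
  qed
qed

lemma ball_subset_cut_plane: "ball 0 1 \<subseteq> cut_plane"
  by (auto simp: cut_plane_def)

lemma nonpos_in_cut_plane: "x \<le> 0 \<Longrightarrow> complex_of_real x \<in> cut_plane"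
  by (auto simp: cut_plane_def)

lemma ip_nonzero_cut_plane:
  assumes "z \<in> cut_plane"
  shows "ip z \<noteq> 0"
proof
  assume "ip z = 0"
  then obtain n where "z * Q ^ n = 1" using ip_eq_0_iff by blast
  then have "z = complex_of_real (1 / q ^ n)" by (simp add: field_simps)
  moreover have "1 / q ^ n \<ge> 1" using q_pos q_less_1 by (simp add: power_le_one)
  ultimately show False using assms unfolding cut_plane_def by blast
qed

lemma heine_holomorphic_cut_plane:
  assumes "norm b < 1"
  shows "heine a b c holomorphic_on cut_plane"
  unfolding heine_def
proof (cases "ip c = 0")
  case False
  show "(\<lambda>z. ip b / (ip c * ip z) * hsum (a * z) b c z) holomorphic_on cut_plane"
    using False assms
    by (intro holomorphic_intros hsum_holomorphic open_cut_plane) (auto simp: ip_nonzero_cut_plane)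
qed simp

text \<open>The series satisfies the equation in the unit disc, and the identity theorem carries it
  to the cut plane. The extension is essential because \<open>r q^k\<close> leaves the disc as
  \<open>k\<close> decreases.\<close>

lemma heine_qdiff:
  assumes b: "norm b < 1" "b \<noteq> 0" and c: "ip c \<noteq> 0" and z: "z \<in> cut_plane"
  shows "(1 - z) * heine a b c z - (1 + c / Q - (a + b) * z) * heine a b c (z * Q)
      + (c / Q - a * b * z) * heine a b c (z * Q\<^sup>2) = 0"
proof -
  let ?h = "heine a b c"
  define G where "G z = (1 - z) * ?h z - (1 + c / Q - (a + b) * z) * ?h (z * Q)
      + (c / Q - a * b * z) * ?h (z * Q\<^sup>2)" for z
  have h: "?h holomorphic_on cut_plane" by (rule heine_holomorphic_cut_plane[OF b(1)])
  have h1: "(\<lambda>z. ?h (z * Q)) holomorphic_on cut_plane"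
    by (rule holomorphic_on_compose_gen[OF _ h, of "\<lambda>z. z * Q" cut_plane, unfolded o_def])
      (auto intro!: holomorphic_intros cut_plane_mult_Q)
  have h2: "(\<lambda>z. ?h (z * Q\<^sup>2)) holomorphic_on cut_plane"
    by (rule holomorphic_on_compose_gen[OF _ h, of "\<lambda>z. z * Q\<^sup>2" cut_plane, unfolded o_def])
      (use cut_plane_mult_Q[OF cut_plane_mult_Q] in \<open>auto simp: power2_eq_square mult.assoc intro!: holomorphic_intros\<close>)
  have "G holomorphic_on cut_plane"
    unfolding G_def by (intro holomorphic_intros h h1 h2) auto
  moreover have "G z = 0" if "z \<in> ball 0 1" for z
  proof -
    have z: "norm z < 1" using that by simp
    have "norm (z * Q ^ n) < 1" for n
      using norm_mult_Q_power_le[OF order_refl, of z n] z by simp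
    from this[of 1] this[of 2] phi21_series_qdiff[OF c z, of a b] show ?thesis
      using z by (simp add: heine_transformation[OF _ b c] G_def)
  qed
  ultimately have "G z = 0"
    using analytic_continuation_open[of "ball 0 1" cut_plane G "\<lambda>_. 0" z]
      z ball_subset_cut_plane open_cut_plane connected_cut_plane by simp
  then show ?thesis by (simp add: G_def)
qed

text \<open>The transformed series converges for every \<open>z\<close> in the cut plane, so it is a
  continuation of the original one; by uniqueness it is the function selected by
  \<open>SOME\<close>.\<close>

lemma phi21_eq_heine:
  assumes b: "norm b < 1" "b \<noteq> 0" and c: "ip c \<noteq> 0" and z: "z \<in> cut_plane"
  shows "phi21 a b c Q z = heine a b c z"
proof (cases "norm z < 1")
  case True
  then show ?thesis by (simp add: phi21_def heine_transformation[OF _ b c])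
next
  case False
  define P where "P F \<longleftrightarrow> F holomorphic_on (UNIV - complex_of_real ` {1..}) \<and>
      (\<forall>u. norm u < 1 \<longrightarrow> F u = phi21_series a b c Q u)" for F
  have "P (heine a b c)"
    unfolding P_def using heine_holomorphic_cut_plane[OF b(1)] heine_transformation[OF _ b c]
    by (auto simp: cut_plane_def)
  then have F: "P (SOME F. P F)" by (rule someI[of P])
  have "(SOME F. P F) z = heine a b c z"
  proof (rule analytic_continuation_open[of "ball 0 1" cut_plane "SOME F. P F" "heine a b c" z])
    show "(SOME F. P F) holomorphic_on cut_plane" using F by (simp add: P_def cut_plane_def)
    show "(SOME F. P F) u = heine a b c u" if "u \<in> ball 0 1" for u
      using F that heine_transformation[OF _ b c, of u] by (simp add: P_def)
  qed (use z ball_subset_cut_plane open_cut_plane connected_cut_plane heine_holomorphic_cut_plane[OF b(1)] in auto)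
  then show ?thesis using False by (simp add: phi21_def P_def)
qed

end

section \<open>Casoratians and the connection formula\<close>

context q_base
begin

section \<open>Products and Heine sums at arguments x / q^n\<close>

lemma th_shift_ratio_div:
  assumes "x \<noteq> 0" "y \<noteq> 0"
  shows "th (x / Q ^ n) * y ^ n * th y = th (y / Q ^ n) * x ^ n * th x"
  using th_shift_ratio[OF assms, of "- int n"] assms
  by (simp add: power_int_minus divide_simps mult_ac)

lemma th_nonzero_shift:
  assumes "x \<noteq> 0" "th x \<noteq> 0"
  shows "th (x / Q ^ n) \<noteq> 0" "ip (x / Q ^ n) \<noteq> 0" "ip (x * Q ^ n) \<noteq> 0"
    "ip (Q / x * Q ^ n) \<noteq> 0"
proof -
  show "th (x / Q ^ n) \<noteq> 0"
  proof
    assume "th (x / Q ^ n) = 0"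
    then obtain k :: int where "x / Q ^ n = Q powi k"
      using assms(1) by (subst (asm) th_eq_0_iff) auto
    then have "x = Q powi (k + int n)"
      by (simp add: power_int_add field_simps)
    then show False using assms th_eq_0_iff by blast
  qed
  then show "ip (x / Q ^ n) \<noteq> 0" by (auto simp: th_def)
  have "ip x \<noteq> 0" "ip (Q / x) \<noteq> 0"
    using assms(2) by (auto simp: th_def)
  from ip_nonzero_shift[OF this(1)] ip_nonzero_shift[OF this(2)]
  show "ip (x * Q ^ n) \<noteq> 0" "ip (Q / x * Q ^ n) \<noteq> 0" .
qed

text \<open>The products on the left have large arguments. Completing each to a theta function makes
  the growth explicit through \<open>th_shift_ratio_div\<close> and leaves only the complementary
  products, whose arguments tend to 0.\<close>

lemma ip_ratio_eq:
  assumes x: "x \<noteq> 0" "th x \<noteq> 0" and y: "y \<noteq> 0" "th y \<noteq> 0"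
  shows "(y / x) ^ n * ip (x / Q ^ n) / ip (y / Q ^ n)
    = th x / th y * ip (Q / y * Q ^ n) / ip (Q / x * Q ^ n)"
proof -
  note nz = th_nonzero_shift[OF x, of n] th_nonzero_shift[OF y, of n]
  have t: "th (w / Q ^ n) = ip (w / Q ^ n) * ip (Q / w * Q ^ n)" for w
    by (simp add: th_def mult.commute divide_simps)
  show ?thesis
    using th_shift_ratio_div[OF x(1) y(1), of n] nz x y unfolding t
    by (simp add: divide_simps) (simp add: mult_ac)
qed

lemma ip_ratio_tendsto:
  assumes x: "x \<noteq> 0" "th x \<noteq> 0" and y: "y \<noteq> 0" "th y \<noteq> 0"
  shows "(\<lambda>n. (y / x) ^ n * ip (x / Q ^ n) / ip (y / Q ^ n)) \<longlonglongrightarrow> th x / th y"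
proof -
  have "(\<lambda>n. th x / th y * ip (Q / y * Q ^ n) / ip (Q / x * Q ^ n)) \<longlonglongrightarrow> th x / th y * 1 / 1"
    by (intro tendsto_intros ip_shift_tendsto) auto
  then show ?thesis
    by (simp add: ip_ratio_eq[OF assms])
qed

text \<open>Tannery's theorem: after scaling, the j-th term tends to a multiple of (c/b;q)_j /
  (q;q)_j (b y/x)^j, and the q-binomial theorem sums these limits. The two norm bounds on
  \<open>b\<close> and \<open>b * y / x\<close> give the majorant.\<close>

lemma hsum_asymptotic:
  assumes x: "x \<noteq> 0" "th x \<noteq> 0" and y: "y \<noteq> 0" "th y \<noteq> 0"
    and b: "b \<noteq> 0" "norm b < 1" "norm (b * y / x) < 1"
  shows "(\<lambda>n. (y / x) ^ n * (hsum (x / Q ^ n) b c (y / Q ^ n) / ip (y / Q ^ n)))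
    \<longlonglongrightarrow> th x / th y * (ip (c * y / x) / ip (b * y / x))"
proof -
  define a where "a = x / y"
  have a: "a \<noteq> 0" using x y by (simp add: a_def)
  define e where "e j = fp (c / b) j / fp Q j * b ^ j" for j
  obtain K where K: "K > 0" "\<And>n. norm (fp (c / b) n / fp Q n) \<le> K"
    using coeff_binomial_bounded by blast
  define s where "s m = (y / x) ^ m * ip (x / Q ^ m) / ip (y / Q ^ m)" for m
  define t where "t m = ip (x * Q ^ m) / ip (y * Q ^ m)" for m
  have s: "s \<longlonglongrightarrow> th x / th y"
    unfolding s_def by (rule ip_ratio_tendsto[OF x y])
  have "t \<longlonglongrightarrow> 1 / 1"
    unfolding t_def by (intro tendsto_intros ip_shift_tendsto) auto
  then obtain M1 where M1: "\<And>m. norm (t m) \<le> M1"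
    using convergent_imp_Bseq[OF convergentI] Bseq_def by blast
  obtain M2 where M2: "\<And>m. norm (s m) \<le> M2"
    using s convergent_imp_Bseq[OF convergentI] Bseq_def by blast
  define M where "M = max M1 M2"
  have M: "norm (t m) \<le> M" "norm (s m) \<le> M" for m
    using M1[of m] M2[of m] by (auto simp: M_def)
  have M0: "M \<ge> 0" using order_trans[OF norm_ge_zero M(1)] .
  define T where "T j n = (1 / a) ^ n * (hterm (x / Q ^ n) b c (y / Q ^ n) j / ip (y / Q ^ n))" for j n
  have T1: "T j n = e j * (1 / a) ^ n * (ip (x / Q ^ n * Q ^ j) / ip (y / Q ^ n * Q ^ j))" for j n
  proof -
    have "T j n = e j * (1 / a) ^ n * ip (x / Q ^ n * Q ^ j) * (fp (y / Q ^ n) j / ip (y / Q ^ n))"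
      unfolding T_def hterm_def e_def prod_diff_eq[OF b(1)] by simp
    then show ?thesis
      unfolding fp_over_ip[OF th_nonzero_shift(2)[OF y]] by simp
  qed
  \<comment> \<open>For \<open>j \<le> n\<close> the arguments x / Q^(n-j) are still outside the
    small range and the quotient is \<open>s\<close>; for \<open>j > n\<close> they are x Q^(j-n)
    and the quotient is \<open>t\<close>. Both sequences converge, so they share a bound.\<close>
  have T_le: "T j n = e j * (1 / a) ^ j * s (n - j)" if "j \<le> n" for j n
  proof -
    have p: "w / Q ^ n * Q ^ j = w / Q ^ (n - j)" for w
      using that by (simp add: power_diff)
    have "(1 / a) ^ n = (1 / a) ^ j * (y / x) ^ (n - j)"
      using that by (simp add: a_def power_add[symmetric])
    then show ?thesis
      unfolding T1 p s_def by simp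
  qed
  have T_gt: "T j n = e j * (1 / a) ^ n * t (j - n)" if "n < j" for j n
  proof -
    have "w / Q ^ n * Q ^ j = w * Q ^ (j - n)" for w
      using that by (simp add: power_diff)
    then show ?thesis unfolding T1 t_def by simp
  qed
  have e_le: "norm (e j) \<le> K * norm b ^ j" for j
    using K(2)[of j] unfolding e_def norm_mult norm_power by (intro mult_right_mono) auto
  have bound: "norm (T j n) \<le> K * M * (norm b ^ j + norm (b / a) ^ j)" for j n
  proof (cases "j \<le> n")
    case True
    have "norm (T j n) = norm (e j) * norm (1 / a) ^ j * norm (s (n - j))"
      using True by (simp add: T_le norm_mult norm_power)
    also have "\<dots> \<le> (K * norm b ^ j) * norm (1 / a) ^ j * M"
      using K M M0 e_le by (intro mult_mono) auto
    also have "\<dots> = K * M * norm (b / a) ^ j"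
      by (simp add: norm_divide power_divide)
    finally show ?thesis
      using K M0 by (simp add: distrib_left add_increasing)
  next
    case False
    have "norm (T j n) = norm (e j) * norm (1 / a) ^ n * norm (t (j - n))"
      using False by (simp add: T_gt norm_mult norm_power)
    also have "\<dots> \<le> (K * norm b ^ j) * (1 + norm (1 / a) ^ j) * M"
    proof (intro mult_mono)
      \<comment> \<open>Here \<open>n < j\<close>. The summand 1 covers
        \<open>norm (1 / a) \<le> 1\<close>, the power covers the other case.\<close>
      show "norm (1 / a) ^ n \<le> 1 + norm (1 / a) ^ j"
      proof (cases "norm (1 / a) \<le> 1")
        case True
        then have "norm (1 / a) ^ n \<le> 1" by (intro power_le_one) auto
        then show ?thesis by (simp add: add_increasing2)
      next
        case g: False
        then have "norm (1 / a) ^ n \<le> norm (1 / a) ^ j"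
          using False by (intro power_increasing) auto
        then show ?thesis by simp
      qed
    qed (use K M M0 e_le in auto)
    also have "\<dots> = K * M * (norm b ^ j + norm (b / a) ^ j)"
      by (simp add: norm_divide power_divide algebra_simps)
    finally show ?thesis .
  qed
  have lim: "(\<lambda>n. T j n) \<longlonglongrightarrow> e j * (1 / a) ^ j * (th x / th y)" for j
  proof (rule LIMSEQ_offset[where k = j])
    have "(\<lambda>n. e j * (1 / a) ^ j * s n) \<longlonglongrightarrow> e j * (1 / a) ^ j * (th x / th y)"
      by (intro tendsto_intros s)
    then show "(\<lambda>n. T j (n + j)) \<longlonglongrightarrow> e j * (1 / a) ^ j * (th x / th y)"
      by (simp add: T_le)
  qed
  have ba: "b / a = b * y / x" by (simp add: a_def)
  have "(\<lambda>n. \<Sum>j. T j n) \<longlonglongrightarrow> (\<Sum>j. e j * (1 / a) ^ j * (th x / th y))"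
  proof (rule tannerys_theorem[THEN conjunct2, THEN conjunct2, OF lim])
    show "\<forall>\<^sub>F (j, n) in at_top \<times>\<^sub>F sequentially. norm (T j n) \<le> K * M * (norm b ^ j + norm (b / a) ^ j)"
      using bound by (intro always_eventually) auto
    show "summable (\<lambda>j. K * M * (norm b ^ j + norm (b / a) ^ j))"
      using b by (intro summable_mult summable_add summable_geometric) (auto simp: ba)
  qed simp
  moreover have "(\<Sum>j. T j n) = (y / x) ^ n * (hsum (x / Q ^ n) b c (y / Q ^ n) / ip (y / Q ^ n))" for n
    using suminf_mult[OF summable_divide[OF hterm_summable[OF b(2)]], of "(1 / a) ^ n" "x / Q ^ n" c "y / Q ^ n" "ip (y / Q ^ n)"]
      suminf_divide[OF hterm_summable[OF b(2)], of "x / Q ^ n" c "y / Q ^ n" "ip (y / Q ^ n)"]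
    by (simp add: T_def hsum_def a_def)
  moreover have "(\<lambda>j. e j * (1 / a) ^ j * (th x / th y)) sums
      (ip (c / b * (b * y / x)) / ip (b * y / x) * (th x / th y))"
  proof -
    have "e j * (1 / a) ^ j = fp (c / b) j / fp Q j * (b * y / x) ^ j" for j
      by (simp add: e_def a_def power_mult_distrib power_divide)
    then show ?thesis
      using sums_mult2[OF q_binomial[OF b(3), of "c / b"], of "th x / th y"] by (simp only:)
  qed
  ultimately show ?thesis
    using b(1) by (simp add: sums_iff mult.commute)
qed

end

text \<open>\<open>generic\<close> replaces the assumptions on the zeros of c(y), from which the
  final theorem derives it. It keeps the poles off the unit circle and prevents the theta factors of
  c(y) and c(1/y) from vanishing together.\<close>

locale little_jacobi = q_base +
  fixes c d r :: real
  assumes r_neg: "r < 0" and c_pos: "0 < c" and c_le: "c \<le> q\<^sup>2"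
    and d_nz: "d \<noteq> 0" and d_less: "\<bar>d\<bar> < 1" and cd_less: "\<bar>c / d\<bar> < 1"
    and generic: "\<And>m::int. (d * r)\<^sup>2 \<noteq> q powi m"
begin

abbreviation "C \<equiv> complex_of_real c"
abbreviation "D \<equiv> complex_of_real d"
abbreviation "R \<equiv> complex_of_real r"

definition zk :: "int \<Rightarrow> complex" where "zk k = R * Q powi k"
text \<open>Up to a constant the reciprocal variable: \<open>Zk l\<close> is C Q / (D^2 zk l), so it
  tends to 0 as \<open>l\<close> tends to minus infinity.\<close>

definition Zk :: "int \<Rightarrow> complex" where "Zk l = C * Q powi (1 - l) / (D\<^sup>2 * R)"

definition f :: "int \<Rightarrow> complex \<Rightarrow> complex" where
  "f k y = heine (D / y) (D * y) C (zk k)"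
text \<open>The solution at infinity of the q-hypergeometric equation, 2phi1(bq/c, b; bq/a; q,
  cq/(abz)), for a = D/y, b = D y, c = C and z = \<open>zk l\<close>. The power belonging to it is
  added in \<open>Phi\<close>.\<close>

definition V :: "int \<Rightarrow> complex \<Rightarrow> complex" where
  "V l y = heine (Q * D * y / C) (D * y) (Q * y\<^sup>2) (Zk l)"
definition Phi :: "int \<Rightarrow> complex \<Rightarrow> complex" where
  "Phi l y = (D * y) powi (- l) * V l y"
text \<open>Multiplied by \<open>om\<close>, the Casoratian of two solutions of the recurrence is constant.\<close>

definition om :: "int \<Rightarrow> complex" where
  "om k = D powi (2 * k) * ip (C * Q powi (- k) / (D\<^sup>2 * R)) / ip (Q powi (1 - k) / R)"

lemma nz [simp]: "C \<noteq> 0" "D \<noteq> 0" "R \<noteq> 0" "c \<noteq> 0" "d \<noteq> 0" "r \<noteq> 0"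
  using c_pos d_nz r_neg by auto

lemma c_less_q: "c < q"
  using c_le mult_strict_left_mono[OF q_less_1 q_pos] by (simp add: power2_eq_square)

lemma ipC: "ip C \<noteq> 0"
  using c_less_q q_less_1 c_pos by (intro ip_nonzero_norm) simp

lemma zk_cut: "zk k \<in> cut_plane"
  using nonpos_in_cut_plane[of "r * q powi k"] r_neg q_pos
  by (simp add: zk_def of_real_power_int mult_nonpos_nonneg)

lemma neg_Q_powi: "t \<le> 0 \<Longrightarrow> ip (complex_of_real t * Q powi k) \<noteq> 0"
  using ip_nonzero_nonpos[of "t * q powi k"] q_pos
  by (simp add: of_real_power_int mult_nonpos_nonneg)

lemma Zk_eq: "Zk l = complex_of_real (c / (d\<^sup>2 * r)) * Q powi (1 - l)"
  by (simp add: Zk_def)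

lemma neg_cdr: "c / (d\<^sup>2 * r) < 0"
  using c_pos r_neg d_nz by (simp add: divide_pos_neg mult_pos_neg)

lemma Zk_cut: "Zk k \<in> cut_plane"
proof -
  have "c / (d\<^sup>2 * r) * q powi (1 - k) \<le> 0"
    using neg_cdr q_pos by (intro mult_nonpos_nonneg) auto
  from nonpos_in_cut_plane[OF this] show ?thesis
    unfolding Zk_eq by (simp only: of_real_mult of_real_power_int)
qed

lemma zk_nz: "zk k \<noteq> 0"
  by (auto simp: zk_def)

lemma zk_Suc: "zk (k + 1) = zk k * Q"
  by (simp add: zk_def power_int_add)

lemma Zk_Suc: "Zk k = Zk (k + 1) * Q"
  using power_int_add[of Q "1 - (k + 1)" 1] by (simp add: Zk_def)

text \<open>Heine's q-difference equation read along \<open>z = zk k\<close>. The variable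
  \<open>y\<close> enters only through \<open>D * y + D / y\<close>, so inversion of
  \<open>y\<close> preserves the solution space.\<close>

definition sol :: "complex \<Rightarrow> (int \<Rightarrow> complex) \<Rightarrow> bool" where
  "sol y X \<longleftrightarrow> (\<forall>k. (1 - zk k) * X k - (1 + C / Q - (D * y + D / y) * zk k) * X (k + 1)
      + (C / Q - D\<^sup>2 * zk k) * X (k + 2) = 0)"

lemma sol_inverse: "sol (1 / y) X \<longleftrightarrow> sol y X"
  by (simp add: sol_def add.commute)

lemma sol_f:
  assumes "y \<noteq> 0" "norm (D * y) < 1"
  shows "sol y (\<lambda>k. f k y)"
  unfolding sol_def
proof
  fix k
  have z2: "zk (k + 2) = zk k * Q\<^sup>2"
    using zk_Suc[of "k + 1"] zk_Suc[of k] by (simp add: power2_eq_square add.assoc mult.assoc)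
  show "(1 - zk k) * f k y - (1 + C / Q - (D * y + D / y) * zk k) * f (k + 1) y
      + (C / Q - D\<^sup>2 * zk k) * f (k + 2) y = 0"
    using heine_qdiff[OF assms(2) _ ipC zk_cut[of k], of "D / y"] assms(1)
    by (simp add: f_def zk_Suc z2 power2_eq_square add.commute[of "D * y" "D / y"])
qed

text \<open>\<open>V\<close> satisfies a q-difference equation in \<open>Zk\<close>, where raising
  \<open>k\<close> divides the argument by \<open>Q\<close>; the equation thus appears in reverse
  order. With the powers of \<open>D * y\<close> included, the common factor -(p z / y^2) turns its
  coefficients into those of \<open>sol\<close>.\<close>

lemma sol_Phi:
  assumes y: "y \<noteq> 0" "norm (D * y) < 1" and ipy: "ip (Q * y\<^sup>2) \<noteq> 0"
  shows "sol y (\<lambda>k. Phi k y)"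
  unfolding sol_def
proof
  fix k
  define Z where "Z = Zk (k + 2)"
  have Z1: "Zk (k + 1) = Z * Q" and Z0: "Zk k = Z * Q\<^sup>2"
    using Zk_Suc[of "k + 1"] Zk_Suc[of k] by (simp_all add: Z_def power2_eq_square add.assoc mult.assoc)
  have Zz: "Z = C / (Q * D\<^sup>2 * zk k)"
    by (simp add: Z_def Zk_def zk_def power_int_diff power_int_add divide_simps power2_eq_square)
  have eq: "(1 - Z) * V (k + 2) y - (1 + y\<^sup>2 - (Q * D * y / C + D * y) * Z) * V (k + 1) y
      + (y\<^sup>2 - Q * D\<^sup>2 * y\<^sup>2 / C * Z) * V k y = 0"
    using heine_qdiff[OF y(2) _ ipy Zk_cut[of "k + 2"], of "Q * D * y / C"] y(1)
    by (simp add: V_def Z_def[symmetric] Z1 Z0 power2_eq_square mult_ac)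
  define p where "p = (D * y) powi (- k)"
  have P: "Phi k y = p * V k y" "Phi (k + 1) y = p / (D * y) * V (k + 1) y"
      "Phi (k + 2) y = p / (D * y)\<^sup>2 * V (k + 2) y"
    using y(1) by (simp_all add: Phi_def p_def power_int_minus power_int_add power_int_diff divide_simps
      power2_eq_square)
  have comb: "K * A0 * v0 - K * A1 * v1 + K * A2 * v2 = K * (A2 * v2 - A1 * v1 + A0 * v0)"
    for K A0 A1 A2 v0 v1 v2 :: complex
    by (simp add: algebra_simps)
  define z where "z = zk k"
  have z: "z \<noteq> 0" "Z = C / (Q * D\<^sup>2 * z)" using zk_nz by (simp_all add: z_def Zz)
  have 0: "(1 - z) * p = - (p * z / y\<^sup>2) * (y\<^sup>2 - Q * D\<^sup>2 * y\<^sup>2 / C * Z)"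
    unfolding z(2) using y(1) z(1) by (simp add: field_simps)
  have 1: "(1 + C / Q - (D * y + D / y) * z) * (p / (D * y))
      = - (p * z / y\<^sup>2) * (1 + y\<^sup>2 - (Q * D * y / C + D * y) * Z)"
    unfolding z(2) using y(1) z(1) by (simp add: field_simps power2_eq_square)
  have 2: "(C / Q - D\<^sup>2 * z) * (p / (D * y)\<^sup>2) = - (p * z / y\<^sup>2) * (1 - Z)"
    unfolding z(2) using y(1) z(1) by (simp add: field_simps power2_eq_square)
  have "(1 - z) * Phi k y - (1 + C / Q - (D * y + D / y) * z) * Phi (k + 1) y
      + (C / Q - D\<^sup>2 * z) * Phi (k + 2) y
    = ((1 - z) * p) * V k y - ((1 + C / Q - (D * y + D / y) * z) * (p / (D * y))) * V (k + 1) y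
      + ((C / Q - D\<^sup>2 * z) * (p / (D * y)\<^sup>2)) * V (k + 2) y"
    unfolding P by (simp add: mult_ac)
  also have "\<dots> = - (p * z / y\<^sup>2) * ((1 - Z) * V (k + 2) y - (1 + y\<^sup>2 - (Q * D * y / C + D * y) * Z) * V (k + 1) y
      + (y\<^sup>2 - Q * D\<^sup>2 * y\<^sup>2 / C * Z) * V k y)"
    unfolding 0 1 2 by (rule comb)
  finally show "(1 - zk k) * Phi k y - (1 + C / Q - (D * y + D / y) * zk k) * Phi (k + 1) y
      + (C / Q - D\<^sup>2 * zk k) * Phi (k + 2) y = 0"
    unfolding eq by (simp add: z_def)
qed

lemma one_minus_zk: "1 - zk k \<noteq> 0"
  using ip_nonzero_cut_plane[OF zk_cut, of k] ip_rec[of "zk k"] by auto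

lemma coeff2_nz: "C / Q - D\<^sup>2 * zk k \<noteq> 0"
proof -
  have "c / q - d\<^sup>2 * (r * q powi k) > 0"
  proof -
    have "d\<^sup>2 * (r * q powi k) \<le> 0"
      using r_neg q_pos by (intro mult_nonneg_nonpos mult_nonpos_nonneg) auto
    moreover have "c / q > 0" using c_pos q_pos by simp
    ultimately show ?thesis by linarith
  qed
  then have "complex_of_real (c / q - d\<^sup>2 * (r * q powi k)) \<noteq> 0"
    by (metis less_irrefl of_real_eq_0_iff)
  then show ?thesis by (simp add: zk_def of_real_power_int)
qed

text \<open>Raising \<open>k\<close> adds one factor to each product in \<open>om\<close>, and
  together with \<open>D\<^sup>2\<close> these give the ratio of the outer coefficients of the
  recurrence.\<close>

lemma om_Suc: "om (k + 1) * (1 - zk k) = om k * (C / Q - D\<^sup>2 * zk k)"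
proof -
  define w where "w = Q powi (- k)"
  have w: "w \<noteq> 0" "zk k = R / w" "Q powi (- (k + 1)) = w / Q" "Q powi (1 - k) = w * Q" "Q powi (1 - (k + 1)) = w"
    "Q powi (- k) = w"
    by (simp_all add: w_def zk_def power_int_minus power_int_add power_int_diff divide_simps)
  have n1: "ip (w * Q / R) \<noteq> 0" "ip (w / R) \<noteq> 0"
    using neg_Q_powi[of "1 / r" "1 - k"] neg_Q_powi[of "1 / r" "- k"] r_neg w by (simp_all add: mult_ac)
  have e1: "ip (C * (w / Q) / (D\<^sup>2 * R)) = (1 - C * (w / Q) / (D\<^sup>2 * R)) * ip (C * w / (D\<^sup>2 * R))"
    using ip_rec[of "C * (w / Q) / (D\<^sup>2 * R)"] by simp
  have e2: "ip (w / R) = (1 - w / R) * ip (w * Q / R)"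
    using ip_rec[of "w / R"] by simp
  have "1 - w / R \<noteq> 0" using e2 n1 by auto
  have p: "D powi (2 * (k + 1)) = D powi (2 * k) * D\<^sup>2"
    by (simp add: power_int_add distrib_left)
  have "om (k + 1) = D powi (2 * k) * D\<^sup>2 * ((1 - C * (w / Q) / (D\<^sup>2 * R)) * ip (C * w / (D\<^sup>2 * R))) /
      ((1 - w / R) * ip (w * Q / R))"
    unfolding om_def p w e1 e2 by simp
  moreover have "om k = D powi (2 * k) * ip (C * w / (D\<^sup>2 * R)) / ip (w * Q / R)"
    unfolding om_def w by simp
  moreover have "P * D\<^sup>2 * ((1 - C * (w / Q) / (D\<^sup>2 * R)) * I) / ((1 - w / R) * I') * (1 - R / w)
      = P * I / I' * (C / Q - D\<^sup>2 * (R / w))" if "I' \<noteq> 0" for P I I' :: complex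
  proof -
    have e: "1 - R / w = - (R / w) * (1 - w / R)"
      using w(1) by (simp add: field_simps)
    show ?thesis
      unfolding e using \<open>1 - w / R \<noteq> 0\<close> w(1) that
      by (simp add: divide_simps power2_eq_square) (simp add: algebra_simps)
  qed
  ultimately show ?thesis
    using n1 by (simp only: w(2))
qed

section \<open>Casoratians and their constancy\<close>

definition cas :: "(int \<Rightarrow> complex) \<Rightarrow> (int \<Rightarrow> complex) \<Rightarrow> int \<Rightarrow> complex" where
  "cas X Y k = om k * (X k * Y (k + 1) - X (k + 1) * Y k)"

text \<open>Discrete Abel identity: substituting the recurrence for \<open>X k\<close> and
  \<open>Y k\<close> cancels the middle coefficient, and \<open>om_Suc\<close> absorbs the ratio of
  the other two.\<close>

lemma cas_step:
  assumes "sol y X" "sol y Y"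
  shows "cas X Y (k + 1) = cas X Y k"
proof -
  define B where "B = 1 + C / Q - (D * y + D / y) * zk k"
  have X: "(1 - zk k) * X k = B * X (k + 1) - (C / Q - D\<^sup>2 * zk k) * X (k + 2)"
    and Y: "(1 - zk k) * Y k = B * Y (k + 1) - (C / Q - D\<^sup>2 * zk k) * Y (k + 2)"
    using assms(1)[unfolded sol_def, rule_format, of k] assms(2)[unfolded sol_def, rule_format, of k]
    unfolding B_def by (simp_all add: algebra_simps)
  have "(1 - zk k) * (X k * Y (k + 1) - X (k + 1) * Y k)
      = ((1 - zk k) * X k) * Y (k + 1) - X (k + 1) * ((1 - zk k) * Y k)"
    by (simp add: algebra_simps)
  also have "\<dots> = (C / Q - D\<^sup>2 * zk k) * (X (k + 1) * Y (k + 2) - X (k + 2) * Y (k + 1))"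
    unfolding X Y by (simp add: algebra_simps)
  finally have W: "(1 - zk k) * (X k * Y (k + 1) - X (k + 1) * Y k)
      = (C / Q - D\<^sup>2 * zk k) * (X (k + 1) * Y (k + 2) - X (k + 2) * Y (k + 1))" .
  have "(1 - zk k) * cas X Y (k + 1) = (om (k + 1) * (1 - zk k)) * (X (k + 1) * Y (k + 2) - X (k + 2) * Y (k + 1))"
    by (simp add: cas_def add.assoc)
  also have "\<dots> = om k * ((C / Q - D\<^sup>2 * zk k) * (X (k + 1) * Y (k + 2) - X (k + 2) * Y (k + 1)))"
    by (simp add: om_Suc)
  also have "\<dots> = (1 - zk k) * cas X Y k"
    unfolding W[symmetric] cas_def by simp
  finally show ?thesis using one_minus_zk by simp
qed

lemma cas_const:
  assumes "sol y X" "sol y Y"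
  shows "cas X Y k = cas X Y 0"
proof (induction k rule: int_induct[of _ 0])
  case (step1 i)
  then show ?case using cas_step[OF assms, of i] by simp
next
  case (step2 i)
  then show ?case using cas_step[OF assms, of "i - 1"] by simp
qed simp

lemma heine_0:
  assumes "norm b < 1" "b \<noteq> 0" "ip e \<noteq> 0"
  shows "heine a b e 0 = 1"
proof -
  have "phi21_series a b e Q 0 = 1"
    unfolding phi21_series_def using powser_zero[of "\<lambda>n. fp a n * fp b n / (fp Q n * fp e n)"] by simp
  then show ?thesis using heine_transformation[OF _ assms, of 0 a] by simp
qed

lemma heine_tendsto_1:
  assumes "norm b < 1" "b \<noteq> 0" "ip e \<noteq> 0"
  shows "(\<lambda>n. heine a b e (x * Q ^ n)) \<longlonglongrightarrow> 1"
proof -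
  have "isCont (heine a b e) 0"
    using holomorphic_on_imp_continuous_on[OF heine_holomorphic_cut_plane[OF assms(1)]]
      open_cut_plane nonpos_in_cut_plane[of 0] continuous_on_eq_continuous_at by fastforce
  moreover have "(\<lambda>n. x * Q ^ n) \<longlonglongrightarrow> x * 0"
    by (intro tendsto_intros Q_power_tendsto_0)
  ultimately have "(\<lambda>n. heine a b e (x * Q ^ n)) \<longlonglongrightarrow> heine a b e 0"
    by (auto intro: isCont_tendsto_compose)
  then show ?thesis by (simp add: heine_0[OF assms])
qed

lemma unit_circle:
  assumes "norm y = 1"
  shows "y \<noteq> 0" "norm (D * y) < 1" "ip (Q * y\<^sup>2) \<noteq> 0" "norm (1 / y) = 1" "norm (D * (1 / y)) < 1"
  using assms d_less q_less_1 q_pos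
  by (auto simp: norm_mult norm_divide norm_power intro!: ip_nonzero_norm)

text \<open>Both D y and D / y lie in the unit disc here, so either may serve as the expansion
  parameter in Heine's formula, and \<open>phi21\<close> is symmetric in them.\<close>

lemma f_inverse:
  assumes "norm y = 1"
  shows "f k (1 / y) = f k y"
proof -
  note u = unit_circle[OF assms]
  have "f k y = phi21 (D / y) (D * y) C Q (zk k)"
    unfolding f_def using u by (intro phi21_eq_heine[symmetric] ipC zk_cut) auto
  also have "\<dots> = phi21 (D * y) (D / y) C Q (zk k)"
    by (rule phi21_commute)
  also have "\<dots> = f k (1 / y)"
    unfolding f_def using u phi21_eq_heine[OF u(5) _ ipC zk_cut, of "D / (1 / y)"] by simp
  finally show ?thesis by simp
qed

text \<open>Evaluated at \<open>k = -n\<close>: there \<open>Zk\<close> tends to 0, so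
  \<open>V\<close> tends to 1, and (D y)^n (D/y)^n = D^(2n) cancels the power in \<open>om\<close>.
  The limit y/D - 1/(D y) comes from the shifted exponents.\<close>

lemma cas_Phi_Phi:
  assumes "norm y = 1"
  shows "cas (\<lambda>k. Phi k y) (\<lambda>k. Phi k (1 / y)) 0 = (y - 1 / y) / D"
proof -
  let ?X = "\<lambda>k. Phi k y" and ?Y = "\<lambda>k. Phi k (1 / y)"
  note u = unit_circle[OF assms] and u' = unit_circle[OF unit_circle(4)[OF assms]]
  have sX: "sol y ?X" using sol_Phi u by blast
  have sY: "sol y ?Y" using sol_Phi[OF u'(1,2,3)] by (simp add: sol_inverse)
  have Zn: "Zk (- int n) = C * Q / (D\<^sup>2 * R) * Q ^ n" "Zk (- int n + 1) = C / (D\<^sup>2 * R) * Q ^ n" for n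
    by (simp_all add: Zk_def power_int_add)
  have V: "(\<lambda>n. V (- int n) w) \<longlonglongrightarrow> 1" "(\<lambda>n. V (- int n + 1) w) \<longlonglongrightarrow> 1" if "norm w = 1" for w
    unfolding V_def Zn by (rule heine_tendsto_1; use unit_circle[OF that] in simp)+
  have W: "(\<lambda>n. om (- int n) / D powi (2 * (- int n))) \<longlonglongrightarrow> 1 / 1"
  proof -
    have "om (- int n) / D powi (2 * (- int n)) = ip (C / (D\<^sup>2 * R) * Q ^ n) / ip (Q / R * Q ^ n)" for n
      by (simp add: om_def power_int_add)
    moreover have "(\<lambda>n. ip (C / (D\<^sup>2 * R) * Q ^ n) / ip (Q / R * Q ^ n)) \<longlonglongrightarrow> 1 / 1"
      by (intro tendsto_intros ip_shift_tendsto) auto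
    ultimately show ?thesis by (simp only:)
  qed
  have "cas ?X ?Y (- int n) = om (- int n) / D powi (2 * (- int n)) *
      (V (- int n) y * V (- int n + 1) (1 / y) * (y / D)
        - V (- int n + 1) y * V (- int n) (1 / y) * (1 / (D * y)))" for n
  proof -
    define p p' where "p = (D * y) ^ n" and "p' = (D * (1 / y)) ^ n"
    have e: "(w::complex) powi (- (- int n)) = w ^ n" "w powi (- (- int n + 1)) = w ^ n / w" if "w \<noteq> 0" for w
      using that power_int_diff[of w "int n" 1] by simp_all
    have yn: "D * y \<noteq> 0" "D * (1 / y) \<noteq> 0" using u(1) by simp_all
    have P: "Phi (- int n) y = p * V (- int n) y" "Phi (- int n + 1) y = p / (D * y) * V (- int n + 1) y"
      "Phi (- int n) (1 / y) = p' * V (- int n) (1 / y)"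
      "Phi (- int n + 1) (1 / y) = p' / (D * (1 / y)) * V (- int n + 1) (1 / y)"
      unfolding Phi_def p_def p'_def e[OF yn(1)] e[OF yn(2)] by (rule refl)+
    have "D powi (2 * (- int n)) = 1 / D powi (int (2 * n))"
      by (simp only: mult_minus_right power_int_minus of_nat_mult of_nat_numeral inverse_eq_divide)
    then have pp: "om (- int n) / D powi (2 * (- int n)) = om (- int n) * (p * p')"
      using u(1) by (simp add: p_def p'_def power_mult_distrib[symmetric] power_int_of_nat power_mult power2_eq_square
        del: of_nat_mult)
    show ?thesis
      unfolding cas_def P pp using u(1) by (simp add: algebra_simps)
  qed
  moreover have "(\<lambda>n. om (- int n) / D powi (2 * (- int n)) *
      (V (- int n) y * V (- int n + 1) (1 / y) * (y / D)
        - V (- int n + 1) y * V (- int n) (1 / y) * (1 / (D * y)))) \<longlonglongrightarrow>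
      1 / 1 * (1 * 1 * (y / D) - 1 * 1 * (1 / (D * y)))"
    by (intro tendsto_intros W V assms u(4))
  ultimately have "(\<lambda>n. cas ?X ?Y (- int n)) \<longlonglongrightarrow> y / D - 1 / (D * y)"
    by simp
  moreover have "(\<lambda>n. cas ?X ?Y (- int n)) = (\<lambda>_. cas ?X ?Y 0)"
    using cas_const[OF sX sY] by blast
  ultimately have "cas ?X ?Y 0 = y / D - 1 / (D * y)"
    by (simp add: LIMSEQ_const_iff)
  then show ?thesis using u(1) by (simp add: field_simps)
qed

section \<open>The limit k to plus infinity and the function c(y)\<close>

lemma th_neg: "t < 0 \<Longrightarrow> th (complex_of_real t) \<noteq> 0"
proof
  assume t: "t < 0" and "th (complex_of_real t) = 0"
  then obtain k :: int where "complex_of_real t = Q powi k"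
    by (subst (asm) th_eq_0_iff) auto
  then have "t = q powi k"
    by (metis of_real_eq_iff of_real_power_int)
  then show False using t q_pos by (metis less_asym zero_less_power_int)
qed

lemma c_fun_eq:
  assumes "y \<noteq> 0"
  shows "c_fun q c d r y = ip (C / (D * y)) * ip (D / y) * th (D * R * y) / (ip (1 / y\<^sup>2) * ip C * th R)"
  by (simp add: c_fun_def qpochs_inf_def th_def power_divide inverse_eq_divide mult_ac)

definition M :: "complex \<Rightarrow> complex" where
  "M y = ip (y\<^sup>2) * ip C * th R / (ip (C * y / D) * ip (D * y) * th (D * R / y))"

text \<open>True at zeros and poles as well: numerator and denominator merely change places, and
  \<open>x / 0 = 0\<close> applies alike on both sides.\<close>

lemma inverse_c_fun: "y \<noteq> 0 \<Longrightarrow> 1 / c_fun q c d r (1 / y) = M y"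
  by (simp add: c_fun_eq M_def power_divide divide_simps)

lemma th_unit_circle:
  assumes "norm y = 1"
  shows "th (D * R / y) \<noteq> 0"
proof
  assume "th (D * R / y) = 0"
  moreover have y: "y \<noteq> 0" using assms by auto
  ultimately obtain k :: int where k: "D * R / y = Q powi k"
    by (subst (asm) th_eq_0_iff) auto
  have "norm (D * R / y) = norm (Q powi k)" using k by simp
  then have "\<bar>d * r\<bar> = q powi k"
    using assms by (simp add: norm_divide norm_mult norm_power_int abs_mult)
  then have "(d * r)\<^sup>2 = q powi (k + k)"
    by (metis power2_abs power2_eq_square power_int_add q_nonzero)
  then show False using generic by blast
qed

text \<open>\<open>om\<close> is a quotient of products at W / q^n and U / q^n with U / W = D^2 Q /
  C, so \<open>ip_ratio_tendsto\<close> applies; the theta functions at U = Q/R and at R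
  agree.\<close>

lemma om_tendsto: "(\<lambda>n. om (int n) * (Q / C) ^ n) \<longlonglongrightarrow> th (C / (D\<^sup>2 * R)) / th R"
proof -
  define W where "W = C / (D\<^sup>2 * R)"
  define U where "U = Q / R"
  have "W = complex_of_real (c / (d\<^sup>2 * r))" by (simp add: W_def)
  then have W: "W \<noteq> 0" "th W \<noteq> 0"
    using th_neg[OF neg_cdr] by (simp_all add: W_def)
  have thU: "th U = th R" by (simp add: U_def th_flip)
  have U: "U \<noteq> 0" "th U \<noteq> 0"
    using th_neg[OF r_neg] by (simp_all add: thU) (simp add: U_def)
  have "om (int n) * (Q / C) ^ n = (U / W) ^ n * ip (W / Q ^ n) / ip (U / Q ^ n)" for n
  proof -
    have UW: "U / W = D\<^sup>2 * (Q / C)" by (simp add: U_def W_def)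
    have "D powi (2 * int n) = (D\<^sup>2) ^ n"
      by (metis of_nat_mult of_nat_numeral power_int_of_nat power_mult)
    moreover have "Q powi (1 - int n) = Q / Q ^ n"
      using power_int_diff[of Q 1 "int n"] by simp
    moreover have "Q powi (- int n) = 1 / Q ^ n"
      by (simp add: power_int_minus divide_simps)
    ultimately show ?thesis
      unfolding UW om_def by (simp add: W_def U_def power_mult_distrib power_divide mult_ac)
  qed
  then show ?thesis
    using ip_ratio_tendsto[OF W U] by (simp add: thU W_def)
qed

text \<open>Leading coefficient at plus infinity: \<open>Phi\<close> behaves like \<open>E y\<close>
  times (Q/C)^k.\<close>

definition E :: "complex \<Rightarrow> complex" where
  "E y = ip (D * y) / ip (Q * y\<^sup>2) * (th (Q\<^sup>2 * y / (D * R)) / th (C * Q / (D\<^sup>2 * R)))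
    * (ip (C * y / D) / ip (C / Q))"

lemma Phi_tendsto:
  assumes "norm y = 1"
  shows "(\<lambda>n. (C / Q) ^ n * Phi (int n) y) \<longlonglongrightarrow> E y"
proof -
  note u = unit_circle[OF assms]
  define X where "X = Q\<^sup>2 * y / (D * R)"
  define Z where "Z = C * Q / (D\<^sup>2 * R)"
  have "Z = complex_of_real (c * q / (d\<^sup>2 * r))" by (simp add: Z_def)
  moreover have "c * q / (d\<^sup>2 * r) < 0" using mult_neg_pos[OF neg_cdr q_pos] by simp
  ultimately have Z: "Z \<noteq> 0" "th Z \<noteq> 0"
    using th_neg[of "c * q / (d\<^sup>2 * r)"] by auto
  define s where "s = D * R / y"
  have s: "s \<noteq> 0" "th s \<noteq> 0"
    using u(1) th_unit_circle[OF assms] by (simp_all add: s_def)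
  have Xs: "X = Q / s * Q"
    using u(1) by (simp add: X_def s_def power2_eq_square)
  have "th (Q / s * Q) * (Q / s) \<noteq> 0"
    using s th_flip[OF s(1)] by (subst th_mult_Q) simp_all
  then have X: "X \<noteq> 0" "th X \<noteq> 0"
    using s(1) by (auto simp: Xs)
  have ratio: "D * y * Z / X = C / Q" "Q * y\<^sup>2 * Z / X = C * y / D"
    using u(1) by (simp_all add: X_def Z_def power2_eq_square)
  have CQ: "norm (C / Q) < 1"
    using c_less_q c_pos q_pos by (simp add: norm_divide)
  have ZX: "Z / X = C / (Q * D * y)"
    using u(1) by (simp add: X_def Z_def power2_eq_square)
  have lim: "(\<lambda>n. (Z / X) ^ n * (hsum (X / Q ^ n) (D * y) (Q * y\<^sup>2) (Z / Q ^ n) / ip (Z / Q ^ n)))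
      \<longlonglongrightarrow> th X / th Z * (ip (C * y / D) / ip (C / Q))"
    using hsum_asymptotic[OF X Z, of "D * y" "Q * y\<^sup>2"] u CQ by (simp only: ratio) simp
  have eq: "(C / Q) ^ n * Phi (int n) y = ip (D * y) / ip (Q * y\<^sup>2) *
      ((Z / X) ^ n * (hsum (X / Q ^ n) (D * y) (Q * y\<^sup>2) (Z / Q ^ n) / ip (Z / Q ^ n)))" for n
  proof -
    have Zn: "Zk (int n) = Z / Q ^ n"
      using power_int_diff[of Q 1 "int n"] by (simp add: Zk_def Z_def)
    have A: "Q * D * y / C * (Z / Q ^ n) = X / Q ^ n"
      by (simp add: X_def Z_def power2_eq_square mult_ac)
    have P: "(D * y) powi (- int n) = (1 / (D * y)) ^ n"
      by (simp add: power_int_minus power_divide inverse_eq_divide)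
    show ?thesis
      unfolding Phi_def V_def heine_def Zn A P ZX by (simp add: power_divide power_mult_distrib mult_ac)
  qed
  have "(\<lambda>n. (C / Q) ^ n * Phi (int n) y) \<longlonglongrightarrow> ip (D * y) / ip (Q * y\<^sup>2) *
      (th X / th Z * (ip (C * y / D) / ip (C / Q)))"
    unfolding eq by (intro tendsto_mult lim tendsto_const)
  then show ?thesis by (simp add: E_def X_def Z_def mult.assoc)
qed

text \<open>At plus infinity \<open>f\<close> tends to 1 while \<open>Phi\<close> grows like (Q/C)^k
  and \<open>om\<close> decays like (C/Q)^k. The factor Q/C - 1 is the difference of consecutive
  powers of the growing solution.\<close>

lemma cas_f_Phi_E:
  assumes "norm y = 1" and X: "sol y (\<lambda>k. f k y)"
  shows "cas (\<lambda>k. f k y) (\<lambda>k. Phi k y) 0 = th (C / (D\<^sup>2 * R)) / th R * (Q / C - 1) * E y"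
proof -
  note u = unit_circle[OF assms(1)]
  have Y: "sol y (\<lambda>k. Phi k y)" using sol_Phi u by blast
  have zn: "zk (int n) = R * Q ^ n" "zk (int n + 1) = R * Q * Q ^ n" for n
    by (simp_all add: zk_def power_int_add)
  have f: "(\<lambda>n. f (int n) y) \<longlonglongrightarrow> 1" "(\<lambda>n. f (int n + 1) y) \<longlonglongrightarrow> 1"
    unfolding f_def zn by (rule heine_tendsto_1; use u ipC in simp)+
  have P: "(\<lambda>n. (C / Q) ^ n * Phi (int n) y) \<longlonglongrightarrow> E y"
    by (rule Phi_tendsto[OF assms(1)])
  have "(\<lambda>n. (Q / C) * ((C / Q) ^ Suc n * Phi (int (Suc n)) y)) \<longlonglongrightarrow> (Q / C) * E y"
    using LIMSEQ_Suc[OF P] by (intro tendsto_mult tendsto_const)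
  then have P': "(\<lambda>n. (C / Q) ^ n * Phi (int n + 1) y) \<longlonglongrightarrow> Q / C * E y"
    by (simp add: add.commute)
  have "(\<lambda>n. (om (int n) * (Q / C) ^ n) * (f (int n) y * ((C / Q) ^ n * Phi (int n + 1) y)
      - f (int n + 1) y * ((C / Q) ^ n * Phi (int n) y)))
      \<longlonglongrightarrow> th (C / (D\<^sup>2 * R)) / th R * (1 * (Q / C * E y) - 1 * E y)"
    by (intro tendsto_intros om_tendsto f P P')
  moreover have "(om (int n) * (Q / C) ^ n) * (f (int n) y * ((C / Q) ^ n * Phi (int n + 1) y)
      - f (int n + 1) y * ((C / Q) ^ n * Phi (int n) y)) = cas (\<lambda>k. f k y) (\<lambda>k. Phi k y) 0" for n
  proof -
    have gen: "p * (a * (s * b) - a' * (s * b')) = (p * s) * (a * b - a' * b')" for p s a b a' b' :: complex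
      by (simp add: algebra_simps)
    have "(Q / C) ^ n * (C / Q) ^ n = 1" by (simp add: power_mult_distrib[symmetric])
    then have "(Q / C) ^ n * (f (int n) y * ((C / Q) ^ n * Phi (int n + 1) y)
      - f (int n + 1) y * ((C / Q) ^ n * Phi (int n) y)) = f (int n) y * Phi (int n + 1) y - f (int n + 1) y * Phi (int n) y"
      unfolding gen by simp
    then show ?thesis
      using cas_const[OF X Y, of "int n"] by (simp add: cas_def mult.assoc)
  qed
  ultimately have "cas (\<lambda>k. f k y) (\<lambda>k. Phi k y) 0 = th (C / (D\<^sup>2 * R)) / th R * (1 * (Q / C * E y) - 1 * E y)"
    by (simp add: LIMSEQ_const_iff)
  then show ?thesis by (simp add: algebra_simps)
qed

text \<open>Quasi-periodicity moves both theta functions of \<open>E\<close> back to those at D R /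
  y and C / (D^2 R), and the factor 1 - C/Q split off from \<open>ip (C / Q)\<close> cancels against
  Q/C - 1 up to a constant.\<close>

lemma E_eq:
  assumes "norm y = 1" "y\<^sup>2 \<noteq> 1"
  shows "th (C / (D\<^sup>2 * R)) / th R * (Q / C - 1) * E y = c_fun q c d r (1 / y) * (1 / y - y) / D"
proof -
  note u = unit_circle[OF assms(1)]
  define W where "W = C / (D\<^sup>2 * R)"
  have "W = complex_of_real (c / (d\<^sup>2 * r))" by (simp add: W_def)
  then have W: "W \<noteq> 0" "th W \<noteq> 0"
    using th_neg[OF neg_cdr] by (simp_all add: W_def)
  have thR: "th R \<noteq> 0" using th_neg[OF r_neg] .
  define t where "t = th (D * R / y)"
  define s where "s = D * R / y"
  have s: "s \<noteq> 0" using u(1) by (simp_all add: s_def)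
  have "th (Q / s * Q) * (Q / s) = - th (Q / s)"
    using s by (intro th_mult_Q) simp
  also have "th (Q / s) = t"
    using th_flip[OF s] by (simp only: t_def s_def)
  finally have "th (Q / s * Q) * (Q / s) = - t" .
  moreover have "Q / s * Q = Q\<^sup>2 * y / (D * R)"
    using u(1) by (simp add: s_def power2_eq_square)
  ultimately have "th (Q\<^sup>2 * y / (D * R)) * (Q / s) = - t" by (simp only:)
  then have th1: "th (Q\<^sup>2 * y / (D * R)) = - t * s / Q"
    using s by (simp add: divide_simps)
  have "th (W * Q) = - th W / W"
    using th_mult_Q[OF W(1)] W(1) by (simp add: field_simps)
  then have th2: "th (C * Q / (D\<^sup>2 * R)) = - th W / W"
    by (simp add: W_def)
  have ip1: "ip (C / Q) = (1 - C / Q) * ip C"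
    using ip_rec[of "C / Q"] by simp
  have "norm (C / Q) < 1" using c_less_q c_pos q_pos by (simp add: norm_divide)
  then have CQ: "1 - C / Q \<noteq> 0" by auto
  have ip2: "ip (y\<^sup>2) = (1 - y\<^sup>2) * ip (Q * y\<^sup>2)"
    using ip_rec[of "y\<^sup>2"] by (simp add: mult.commute)
  define a b e where "a = ip (D * y)" and "b = ip (C * y / D)" and "e = ip (Q * y\<^sup>2)"
  have e: "e \<noteq> 0" using u by (simp add: e_def)
  have y2: "1 - y\<^sup>2 \<noteq> 0" using assms(2) by simp
  have CF: "c_fun q c d r (1 / y) = b * a * t / ((1 - y\<^sup>2) * e * ip C * th R)"
    using u(1) c_fun_eq[of "1 / y"] by (simp add: ip2 power_divide a_def b_def e_def t_def)
  have "c_fun q c d r (1 / y) * (1 / y - y) / D = b * a * t / (e * ip C * th R * y * D)"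
  proof -
    have "1 / y - y = (1 - y\<^sup>2) / y" using u(1) by (simp add: field_simps power2_eq_square)
    then show ?thesis unfolding CF using y2 by (simp add: mult_ac)
  qed
  moreover have "th W / th R * (Q / C - 1) * E y = b * a * t / (e * ip C * th R * y * D)"
  proof -
    have "Q / C - 1 = Q / C * (1 - C / Q)" by (simp add: field_simps)
    then have "th W / th R * (Q / C - 1) * E y = th W / th R * (Q / C * (1 - C / Q)) *
      (a / e * (- t * s / Q / (- th W / W)) * (b / ((1 - C / Q) * ip C)))"
      by (simp add: E_def th1 th2 ip1 a_def b_def e_def)
    also have "\<dots> = a * b * t / (e * ip C * th R) * (W * s / C)"
      using W CQ by (simp add: mult_ac)
    also have "W * s / C = 1 / (y * D)"
      using u(1) by (simp add: W_def s_def power2_eq_square)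
    finally show ?thesis by (simp add: mult_ac)
  qed
  ultimately show ?thesis by (simp add: W_def)
qed

text \<open>Cramer's rule in the two-dimensional solution space: the coefficients are quotients of
  Casoratians. The one of \<open>f\<close> with \<open>Phi\<close> at 1/y follows from the one at y
  because \<open>f\<close> is invariant under inversion. At y^2 = 1 the two solutions
  \<open>Phi\<close> coincide, hence the exclusion.\<close>

theorem connection:
  assumes "norm y = 1" "y\<^sup>2 \<noteq> 1"
  shows "f l y = c_fun q c d r y * Phi l y + c_fun q c d r (1 / y) * Phi l (1 / y)"
proof -
  note u = unit_circle[OF assms(1)]
  define y' where "y' = 1 / y"
  have y': "norm y' = 1" "y'\<^sup>2 \<noteq> 1" "1 / y' = y"
    using assms u by (simp_all add: y'_def power_divide)
  note u' = unit_circle[OF y'(1)]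
  let ?F = "\<lambda>k. f k y" and ?X = "\<lambda>k. Phi k y" and ?Y = "\<lambda>k. Phi k y'"
  have sF: "sol y ?F" using sol_f u by blast
  have sF': "sol y' (\<lambda>k. f k y')" using sol_f u' by blast
  have FF: "f k y' = f k y" for k using f_inverse[OF assms(1)] by (simp add: y'_def)
  have sX: "sol y ?X" using sol_Phi u by blast
  have sY: "sol y ?Y" using sol_Phi[OF u'(1,2,3)] by (simp add: sol_inverse y'_def)
  have FX: "cas ?F ?X l = c_fun q c d r y' * (y' - y) / D"
    using cas_f_Phi_E[OF assms(1) sF] E_eq[OF assms] cas_const[OF sF sX, of l] by (simp add: y'_def)
  have FY: "cas ?F ?Y l = c_fun q c d r y * (y - y') / D"
    using cas_f_Phi_E[OF y'(1) sF'] E_eq[OF y'(1,2)] cas_const[OF sF sY, of l] y'(3) by (simp add: FF)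
  have XY: "cas ?X ?Y l = (y - y') / D"
    using cas_Phi_Phi[OF assms(1)] cas_const[OF sX sY, of l] by (simp add: y'_def)
  have "f l y * cas ?X ?Y l = cas ?F ?Y l * Phi l y - cas ?F ?X l * Phi l y'"
    by (simp add: cas_def algebra_simps)
  then have "f l y * ((y - y') / D) = (c_fun q c d r y * Phi l y + c_fun q c d r y' * Phi l y') * ((y - y') / D)"
    unfolding FX FY XY by (simp add: algebra_simps diff_divide_distrib)
  moreover have "(y - y') / D \<noteq> 0"
    using assms(2) u(1) by (auto simp: y'_def divide_simps power2_eq_square)
  ultimately show ?thesis by (simp add: y'_def)
qed

end

section \<open>Poles and residues\<close>

lemma residue_simple_zero:
  assumes f: "f analytic_on {p}" and g: "g analytic_on {p}"
    and g0: "g p = 0" and g': "(g has_field_derivative g') (at p)" "g' \<noteq> 0"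
  shows "residue (\<lambda>w. f w / g w) p = f p / g'"
proof -
  obtain e1 where e1: "e1 > 0" "f holomorphic_on ball p e1"
    using f by (auto simp: analytic_on_def)
  obtain e2 where e2: "e2 > 0" "g holomorphic_on ball p e2"
    using g by (auto simp: analytic_on_def)
  define e where "e = min e1 e2"
  have e: "e > 0" "f holomorphic_on ball p e" "g holomorphic_on ball p e"
    using e1 e2 by (auto simp: e_def elim!: holomorphic_on_subset)
  obtain t where t: "t > 0" "ball p t \<subseteq> ball p e" "inj_on g (ball p t)"
    using has_complex_derivative_locally_injective[OF e(3), of p] e(1) g'
    by (auto simp: DERIV_imp_deriv)
  have hf: "f holomorphic_on ball p t" and hg: "g holomorphic_on ball p t"
    using e t(2) holomorphic_on_subset by blast+
  have nz: "g w \<noteq> 0" if "w \<in> ball p t - {p}" for w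
    using inj_onD[OF t(3), of w p] that t(1) g0 by auto
  have *: "residue (\<lambda>w. h w / g w) p = h p / g'" if "h holomorphic_on ball p t" "h p \<noteq> 0" for h
    using that t(1) g0 g' by (intro residue_simple_pole_deriv[OF _ hg]) auto
  show ?thesis
  proof (cases "f p = 0")
    case True
    \<comment> \<open>The formula for a simple pole asks for a numerator not vanishing at
      \<open>p\<close>; f is the difference of f + 1 and 1, which do not vanish there.\<close>
    have "residue (\<lambda>w. (f w + 1) / g w - 1 / g w) p = residue (\<lambda>w. (f w + 1) / g w) p - residue (\<lambda>w. 1 / g w) p"
      using nz hf hg t(1) by (intro residue_diff[of "ball p t"] holomorphic_intros) (auto elim: holomorphic_on_subset)
    also have "\<dots> = (f p + 1) / g' - 1 / g'"
      using * [of "\<lambda>w. f w + 1"] *[of "\<lambda>_. 1"] True hf by (simp add: holomorphic_intros)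
    finally show ?thesis using True by (simp add: diff_divide_distrib[symmetric])
  qed (use * hf in blast)
qed

context q_base
begin

lemma ip_analytic [analytic_intros]:
  assumes "g analytic_on S"
  shows "(\<lambda>w. ip (g w)) analytic_on S"
  using analytic_on_compose_gen[OF assms, of ip UNIV] ip_holomorphic_UNIV
  by (simp add: analytic_on_open o_def)

lemma norm_Q_square_less:
  assumes "norm y \<le> 1"
  shows "norm (Q * y\<^sup>2) < 1"
proof -
  have "q * norm y ^ 2 \<le> q * 1"
    using assms q_pos by (intro mult_left_mono power_le_one) auto
  then show ?thesis
    using q_less_1 by (simp add: norm_mult norm_power)
qed

lemma th_analytic [analytic_intros]:
  assumes "g analytic_on S" "\<And>w. w \<in> S \<Longrightarrow> g w \<noteq> 0"
  shows "(\<lambda>w. th (g w)) analytic_on S"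
  unfolding th_def by (intro analytic_intros assms)

lemma th_has_derivative: "x \<noteq> 0 \<Longrightarrow> (th has_field_derivative deriv th x) (at x)"
  using th_analytic[of "\<lambda>w. w" "{x}"] by (auto simp: analytic_on_ident intro!: analytic_derivI)

lemma deriv_th_1: "deriv th 1 = - (ip Q)\<^sup>2"
proof -
  define h where "h x = ip (x * Q) * ip (Q / x)" for x
  have "h analytic_on {1}" unfolding h_def by (intro analytic_intros) auto
  then have h: "(h has_field_derivative deriv h 1) (at 1)"
    by (rule analytic_derivI)
  have th: "th = (\<lambda>x. (1 - x) * h x)"
  proof
    fix x show "th x = (1 - x) * h x"
      unfolding th_def h_def by (subst ip_rec[of x]) simp
  qed
  have "(th has_field_derivative (- h 1)) (at 1)"
    unfolding th by (rule derivative_eq_intros h refl)+ simp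
  then show ?thesis by (simp add: DERIV_imp_deriv h_def power2_eq_square)
qed

lemma th_Q_powi [simp]: "th (Q powi k) = 0"
  by (subst th_eq_0_iff) auto

text \<open>Differentiating \<open>th_mult_Q\<close> at a zero of \<open>th\<close> leaves one term
  of the product rule. The recursion yields the simplicity of all zeros and also the rapid growth of
  the derivatives that makes the residues summable.\<close>

lemma deriv_th_step: "deriv th (Q powi k) = - (Q powi (k + 1)) * deriv th (Q powi (k + 1))"
proof -
  define x where "x = Q powi k"
  have x: "x \<noteq> 0" "x * Q = Q powi (k + 1)" by (simp_all add: x_def power_int_add)
  have "((\<lambda>w. th (w * Q)) has_field_derivative deriv th (x * Q) * Q) (at x)"
    by (rule DERIV_chain2[OF th_has_derivative]) (use x(1) in \<open>auto intro!: derivative_eq_intros\<close>)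
  then have 1: "((\<lambda>w. th (w * Q) * w) has_field_derivative deriv th (x * Q) * Q * x) (at x)"
    using DERIV_mult[OF _ DERIV_ident, of "\<lambda>w. th (w * Q)" "deriv th (x * Q) * Q" x] by (simp add: x(2))
  have 2: "((\<lambda>w. - th w) has_field_derivative - deriv th x) (at x)"
    by (intro DERIV_minus th_has_derivative x(1))
  have "((\<lambda>w. th (w * Q) * w) has_field_derivative - deriv th x) (at x)"
    by (rule has_field_derivative_transform_within_open[OF 2, of "- {0}"])
      (use x(1) th_mult_Q in auto)
  then have "deriv th (x * Q) * Q * x = - deriv th x"
    using 1 DERIV_unique by blast
  then show ?thesis
    unfolding x(2)[symmetric] x_def[symmetric] by (simp add: mult_ac)
qed

lemma deriv_th_nonzero: "deriv th (Q powi k) \<noteq> 0"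
proof (induction k rule: int_induct[of _ 0])
  case base
  then show ?case by (simp add: deriv_th_1)
next
  case (step1 i)
  then show ?case using deriv_th_step[of i] by auto
next
  case (step2 i)
  then show ?case using deriv_th_step[of "i - 1"] by auto
qed

end

section \<open>The points where f and Phi are proportional\<close>

context little_jacobi
begin

text \<open>Zeros of th(D R / y), hence poles of 1/c(1/y); \<open>eta j\<close> is the reciprocal of
  the mass point q^p/(d r) with p = -j.\<close>

definition eta :: "int \<Rightarrow> complex" where "eta j = D * R * Q powi j"

lemma eta_nz [simp]: "eta j \<noteq> 0"
  by (simp add: eta_def)

lemma sol_eq_0:
  assumes "sol y X" and "X a = 0" "X (a + 1) = 0" and "k \<ge> a"
  shows "X k = 0"
proof -
  have "X k = 0 \<and> X (k + 1) = 0"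
    using assms(4)
  proof (induction k rule: int_ge_induct)
    case (step i)
    then show ?case
      using assms(1)[unfolded sol_def, rule_format, of i] coeff2_nz[of i] by (simp add: add.assoc)
  qed (use assms in simp)
  then show ?thesis ..
qed

lemma sol_diff_scale: "sol y X \<Longrightarrow> sol y Y \<Longrightarrow> sol y (\<lambda>k. X k - a * Y k)"
proof -
  assume 1: "sol y X" "sol y Y"
  have lin: "u * (x - a * x') - v * (z - a * z') + w * (t - a * t') = (u * x - v * z + w * t) - a * (u * x' - v * z' + w * t')"
    for u v w x x' z z' t t' :: complex by (simp add: algebra_simps)
  show ?thesis
    using 1 unfolding sol_def lin by simp
qed

text \<open>This is c(eta j), in the shape that the comparison of the two series produces;
  \<open>kappa_M\<close> makes the identification.\<close>

definition kappa :: "int \<Rightarrow> complex" where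
  "kappa j = (D * eta j) powi (j + 1) * ip (C / (D * eta j)) * ip (Q * (eta j)\<^sup>2) / (ip C * ip (Q * eta j / D))"

lemma ip_Q_powi_eq_0: "i \<le> 0 \<Longrightarrow> ip (Q powi i) = 0"
  by (rule ip_eq_0I[where n = "nat (- i)"]) (simp add: power_int_def power_inverse[symmetric] divide_simps)

lemma C_over_D_eta: "C / (D * eta j) = complex_of_real (c / (d\<^sup>2 * r)) * Q powi (- j)"
  by (simp add: eta_def power_int_minus power2_eq_square divide_simps)

lemma Q_eta_over_D: "Q * eta j / D = R * Q powi (j + 1)"
  by (simp add: eta_def power_int_add mult_ac)

text \<open>At \<open>y = eta j\<close> the factor \<open>(D z Q^n / y; Q)\<close> in the Heine series of \<open>f\<close> kills the first
  \<open>N\<close> terms, and after shifting the index the series of \<open>f\<close> and \<open>Phi\<close> coincide.\<close>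

lemma f_eta_low:
  assumes small: "norm (eta j) < 1" and k: "k = j + 1 - int N"
  shows "f k (eta j) = kappa j * Phi k (eta j)"
proof -
  define y where "y = eta j"
  define s where "s = C / (D * y)"
  define t where "t = Q * y / D"
  define z where "z = zk k"
  define Z where "Z = Zk k"
  have y: "y \<noteq> 0" "norm y < 1" using small by (simp_all add: y_def)
  have Dy: "norm (D * y) < 1" "D * y \<noteq> 0"
    using y d_less mult_strict_mono[of "\<bar>d\<bar>" 1 "norm y" 1] by (simp_all add: norm_mult)
  have ips: "ip s \<noteq> 0" unfolding s_def y_def C_over_D_eta by (rule neg_Q_powi) (use neg_cdr in simp)
  have ipt: "ip t \<noteq> 0" unfolding t_def y_def Q_eta_over_D by (rule neg_Q_powi) (use r_neg in simp)
  have Z: "Z = s * Q ^ N"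
    by (simp add: Z_def Zk_def s_def y_def eta_def k power_int_add power_int_diff power2_eq_square divide_simps)
  have z: "z * Q ^ N = t"
    by (simp add: z_def zk_def t_def y_def eta_def k power_int_add power_int_diff divide_simps)
  have ipz: "ip z \<noteq> 0" and ipZ: "ip Z \<noteq> 0"
    unfolding z_def Z_def using ip_nonzero_cut_plane zk_cut Zk_cut by blast+
  have A: "D / y * z = Q powi (1 - int N)"
    by (simp add: z_def zk_def y_def eta_def k power_int_add power_int_diff divide_simps)
  have A': "Q * D * y / C * Z = Q powi (1 + int N)"
    by (simp add: Z_def Zk_def y_def eta_def k power_int_add power_int_diff power2_eq_square divide_simps)
  \<comment> \<open>The two factors fp Q m and fp Q (N + m) exchange their origin: in
    \<open>f\<close> the first comes from the infinite product and the second from the denominator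
    of \<open>hterm\<close>, in \<open>V\<close> the other way round.\<close>
  define b where "b m = fp t m * fp Z m * (D * y) ^ m / (fp Q m * fp Q (N + m))" for m
  have ipQ: "ip (Q ^ Suc m) = ip Q / fp Q m" for m
    using ip_split[of Q m] by (simp add: field_simps)
  have termf: "hterm (Q powi (1 - int N)) (D * y) C z (m + N) / ip z
      = fp s N * (D * y) ^ N * ip Q / ip t * b m" for m
  proof -
    have 1: "Q powi (1 - int N) * Q ^ (m + N) = Q ^ Suc m"
      by (simp add: power_int_diff power_add)
    have 2: "fp z (m + N) / ip z = fp t m / ip t"
      using fp_over_ip[OF ipz, of "N + m"] fp_over_ip[OF ipt, of m]
      by (simp add: power_add mult.assoc[symmetric] z add.commute)
    have 3: "(\<Prod>i<m + N. D * y - C * Q ^ i) = fp s N * fp Z m * ((D * y) ^ N * (D * y) ^ m)"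
      unfolding prod_diff_eq[OF Dy(2)] s_def[symmetric] Z by (simp add: add.commute[of m] fp_add power_add)
    have "hterm (Q powi (1 - int N)) (D * y) C z (m + N) / ip z
        = (fp z (m + N) / ip z) * (\<Prod>i<m + N. D * y - C * Q ^ i) * ip (Q ^ Suc m) / fp Q (N + m)"
      unfolding hterm_def 1 by (simp add: add.commute)
    then show ?thesis
      unfolding 2 3 ipQ b_def by (simp add: mult_ac)
  qed
  have termV: "hterm (Q powi (1 + int N)) (D * y) (Q * y\<^sup>2) Z m = ip Q * b m" for m
  proof -
    have 1: "Q powi (1 + int N) * Q ^ m = Q ^ Suc (N + m)"
      by (simp add: power_int_add power_add)
    have 2: "Q * y\<^sup>2 / (D * y) = t" using y by (simp add: t_def power2_eq_square)
    show ?thesis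
      unfolding hterm_def 1 ipQ prod_diff_eq[OF Dy(2)] 2 b_def by (simp add: mult_ac)
  qed
  have sb: "summable b"
  proof -
    have "summable (\<lambda>m. ip Q * b m)"
      unfolding termV[symmetric] by (rule hterm_summable[OF Dy(1)])
    then show ?thesis by (simp add: summable_cmult_iff)
  qed
  have "hsum (Q powi (1 - int N)) (D * y) C z = (\<Sum>m. hterm (Q powi (1 - int N)) (D * y) C z (m + N))"
  proof -
    have "hterm (Q powi (1 - int N)) (D * y) C z n = 0" if "n < N" for n
    proof -
      have "Q powi (1 - int N) * Q ^ n = Q powi (1 - int N + int n)"
        by (simp add: power_int_add)
      then show ?thesis using ip_Q_powi_eq_0[of "1 - int N + int n"] that by (simp add: hterm_def)
    qed
    then show ?thesis
      unfolding hsum_def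
      by (subst suminf_split_initial_segment[OF hterm_summable[OF Dy(1)], of _ _ _ N]) simp
  qed
  also have "\<dots> = (\<Sum>m. ip z * (fp s N * (D * y) ^ N * ip Q / ip t * b m))"
    using termf ipz by (intro suminf_cong) (simp add: field_simps)
  also have "\<dots> = ip z * (fp s N * (D * y) ^ N * ip Q / ip t * suminf b)"
    using suminf_mult[OF summable_mult[OF sb], of "ip z" "fp s N * (D * y) ^ N * ip Q / ip t"]
      suminf_mult[OF sb, of "fp s N * (D * y) ^ N * ip Q / ip t"] by (simp only:)
  finally have F: "f k y = ip (D * y) / ip C * (fp s N * (D * y) ^ N * ip Q / ip t * suminf b)"
    unfolding f_def heine_def z_def[symmetric] A using ipz by simp
  have Vk: "V k y = ip (D * y) / (ip (Q * y\<^sup>2) * ip Z) * (ip Q * suminf b)"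
    unfolding V_def heine_def Z_def[symmetric] A' hsum_def termV using sb by (simp add: suminf_mult)
  have ipy: "ip (Q * y\<^sup>2) \<noteq> 0"
    using y by (intro ip_nonzero_norm norm_Q_square_less) simp
  have "(D * y) powi (j + 1) * (D * y) powi (- k) = (D * y) ^ N"
    using Dy(2) by (simp add: power_int_add[symmetric] k)
  moreover have "ip s = fp s N * ip Z" using ip_split[of s N] by (simp add: Z)
  ultimately show ?thesis
    unfolding kappa_def y_def[symmetric] s_def[symmetric] t_def[symmetric] Phi_def
    using F Vk ipy ipZ by (simp add: mult_ac)
qed

lemma D_eta_small:
  assumes "norm (eta j) < 1"
  shows "norm (D * eta j) < 1" "norm (C * eta j / D) < 1" "norm (Q * (eta j)\<^sup>2) < 1"
proof -
  have *: "a * norm (eta j) < 1" if "0 \<le> a" "a < 1" for a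
    using that assms mult_strict_mono[of a 1 "norm (eta j)" 1] by simp
  show "norm (D * eta j) < 1" using *[of "\<bar>d\<bar>"] d_less by (simp add: norm_mult)
  show "norm (C * eta j / D) < 1" using *[of "\<bar>c / d\<bar>"] cd_less by (simp add: norm_mult norm_divide)
  show "norm (Q * (eta j)\<^sup>2) < 1" using assms by (intro norm_Q_square_less) simp
qed

text \<open>The comparison of series reaches only \<open>k \<le> j + 1\<close>. Both sides solve the
  recurrence, whose last coefficient never vanishes, so equality at \<open>j\<close> and
  \<open>j + 1\<close> propagates upwards.\<close>

lemma f_eta:
  assumes small: "norm (eta j) < 1"
  shows "f k (eta j) = kappa j * Phi k (eta j)"
proof (cases "k \<le> j + 1")
  case True
  then show ?thesis using f_eta_low[OF small, of k "nat (j + 1 - k)"] by simp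
next
  case False
  define X where "X k = f k (eta j) - kappa j * Phi k (eta j)" for k
  note s = D_eta_small[OF small]
  have "sol (eta j) X"
    unfolding X_def using s ip_nonzero_norm[OF s(3)] by (intro sol_diff_scale sol_f sol_Phi) auto
  moreover have "X j = 0" "X (j + 1) = 0"
    using f_eta_low[OF small, of j 1] f_eta_low[OF small, of "j + 1" 0] by (simp_all add: X_def)
  ultimately have "X k = 0"
    using False sol_eq_0[of "eta j" X j k] by simp
  then show ?thesis by (simp add: X_def)
qed

lemma th_DR_eta: "th (D * R * eta j) \<noteq> 0"
proof
  assume "th (D * R * eta j) = 0"
  then obtain k :: int where "D * R * eta j = Q powi k"
    by (subst (asm) th_eq_0_iff) auto
  then have "(D * R)\<^sup>2 = Q powi (k - j)"
    by (simp add: eta_def power_int_diff power2_eq_square field_simps)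
  then have "complex_of_real ((d * r)\<^sup>2) = complex_of_real (q powi (k - j))"
    by (simp add: of_real_power_int)
  then show False using generic of_real_eq_iff by blast
qed

text \<open>With y = eta j, the numbers Q y^2 and Q y / D are the shifts by Q^(j+1) of D R y and R.
  \<open>th_shift_ratio\<close> for this pair converts the theta factors of \<open>M\<close> into
  the products of \<open>kappa\<close>.\<close>

lemma kappa_M: "kappa j * M (1 / eta j) = 1"
proof -
  define y where "y = eta j"
  define t where "t = R * Q powi (j + 1)"
  have y: "y \<noteq> 0" by (simp add: y_def)
  have ty: "Q * y / D = t" by (simp add: t_def y_def Q_eta_over_D)
  have tD: "Q / t = D / y" using y by (simp add: ty[symmetric])
  have ips: "ip (C / (D * y)) \<noteq> 0"
    unfolding y_def C_over_D_eta by (rule neg_Q_powi) (use neg_cdr in simp)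
  have "r * q powi (j + 1) < 0" using r_neg q_pos by (simp add: mult_neg_pos)
  from th_neg[OF this] have tht: "th t \<noteq> 0"
    by (simp add: t_def of_real_power_int)
  have thx: "th (D * R * y) \<noteq> 0" unfolding y_def by (rule th_DR_eta)
  have xQ: "D * R * y * Q powi (j + 1) = Q * y\<^sup>2"
    by (simp add: y_def eta_def power_int_add power2_eq_square mult_ac)
  have main: "th (Q * y\<^sup>2) * (D * y) powi (j + 1) * th R = th t * th (D * R * y)"
  proof -
    have "th (Q * y\<^sup>2) * (D * R * y) powi (j + 1) * th R = th t * R powi (j + 1) * th (D * R * y)"
      using th_shift_ratio[of "D * R * y" R "j + 1"] y unfolding xQ t_def by simp
    moreover have "(D * R * y) powi (j + 1) = (D * y) powi (j + 1) * R powi (j + 1)"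
      by (simp add: power_int_mult_distrib mult_ac)
    ultimately show ?thesis by (simp add: mult_ac)
  qed
  have M: "M (1 / y) = ip (1 / y\<^sup>2) * ip C * th R / (ip (C / (D * y)) * ip (D / y) * th (D * R * y))"
    by (simp add: M_def power_divide mult_ac)
  have t1: "th t = ip t * ip (D / y)" by (simp add: th_def tD)
  have t2: "th (Q * y\<^sup>2) = ip (Q * y\<^sup>2) * ip (1 / y\<^sup>2)" using y by (simp add: th_def)
  have "kappa j * M (1 / y) = (ip (Q * y\<^sup>2) * ip (1 / y\<^sup>2)) * (D * y) powi (j + 1) * th R
      / ((ip t * ip (D / y)) * th (D * R * y))"
    unfolding kappa_def y_def[symmetric] M ty using ips ipC by (simp add: mult_ac)
  then show ?thesis
    unfolding t1[symmetric] t2[symmetric] main y_def[symmetric] using tht thx by simp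
qed

lemma f_eta_M: "norm (eta j) < 1 \<Longrightarrow> f k (eta j) * M (1 / eta j) = Phi k (eta j)"
  using f_eta[of j k] kappa_M[of j] by (simp add: mult_ac)

section \<open>Holomorphy near the closed disc and residues\<close>

definition dom :: "complex set" where
  "dom = {y. norm (D * y) < 1 \<and> norm (C * y / D) < 1 \<and> norm (Q * y\<^sup>2) < 1}"

lemma open_dom: "open dom"
  unfolding dom_def by (intro open_Collect_conj open_Collect_less continuous_intros) auto

lemma dom_nonzero: "y \<in> dom \<Longrightarrow> ip (D * y) \<noteq> 0" "y \<in> dom \<Longrightarrow> ip (C * y / D) \<noteq> 0"
  "y \<in> dom \<Longrightarrow> ip (Q * y\<^sup>2) \<noteq> 0" "y \<in> dom \<Longrightarrow> norm (D * y) < 1"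
  unfolding dom_def by (simp_all add: ip_nonzero_norm)

lemma dom_star: "y \<in> dom \<Longrightarrow> norm w \<le> norm y \<Longrightarrow> w \<in> dom"
proof -
  assume y: "y \<in> dom" and w: "norm w \<le> norm y"
  have 1: "norm (a * w) \<le> norm (a * y)" for a :: complex
    using w by (simp add: norm_mult mult_left_mono)
  have 2: "norm (Q * w\<^sup>2) \<le> norm (Q * y\<^sup>2)"
    using w q_pos by (simp add: norm_mult norm_power power_mono)
  show "w \<in> dom"
    using y 1[of D] 1[of "C / D"] 2 by (auto simp: dom_def)
qed

lemma cball_subset_dom: "norm y \<le> 1 \<Longrightarrow> y \<in> dom"
proof -
  have "(1 :: complex) \<in> dom"
    using d_less cd_less q_less_1 by (simp add: dom_def norm_divide)
  then show "norm y \<le> 1 \<Longrightarrow> y \<in> dom" using dom_star by simp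
qed

lemma f_holomorphic: "f k holomorphic_on (dom - {0})"
  unfolding f_def heine_def using ipC ip_nonzero_cut_plane[OF zk_cut, of k]
  by (intro holomorphic_intros hsum_holomorphic) (auto simp: open_dom open_delete dom_nonzero)

lemma V_holomorphic: "V l holomorphic_on dom"
  unfolding V_def heine_def using ip_nonzero_cut_plane[OF Zk_cut, of l]
  by (intro holomorphic_intros hsum_holomorphic) (auto simp: open_dom dom_nonzero)

lemma Phi_holomorphic: "Phi l holomorphic_on (dom - {0})"
  unfolding Phi_def
  by (intro holomorphic_intros holomorphic_on_subset[OF V_holomorphic]) auto

text \<open>The part of \<open>M\<close> without its poles: the theta function that produces them is
  split off, so \<open>N\<close> is holomorphic at 0 too.\<close>

definition N :: "complex \<Rightarrow> complex" where
  "N y = ip (y\<^sup>2) * ip C * th R / (ip (C * y / D) * ip (D * y))"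

lemma M_eq_N: "M y = N y / th (D * R / y)"
  by (simp add: M_def N_def)

lemma N_holomorphic: "N holomorphic_on dom"
  unfolding N_def by (intro holomorphic_intros) (auto simp: dom_nonzero)

definition integrand :: "int \<Rightarrow> int \<Rightarrow> complex \<Rightarrow> complex" where
  "integrand k l y = f k y * Phi l y * M y / y"

lemma residue_integrand:
  assumes small: "norm (eta j) < 1"
  shows "residue (integrand k l) (eta j) =
    - (f k (eta j) * Phi l (eta j) * N (eta j) * eta j / (D * R * deriv th (Q powi (- j))))"
proof -
  have "eta j \<in> dom - {0}" using cball_subset_dom small by simp
  note an = holomorphic_on_imp_analytic_at[OF _ _ this]
  have o: "open (dom - {0})" by (intro open_delete open_dom)
  have p: "D * R / eta j = Q powi (- j)" by (simp add: eta_def power_int_minus divide_simps)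
  have "((\<lambda>y. th (D * R / y)) has_field_derivative (deriv th (Q powi (- j)) * (- (D * R / (eta j)\<^sup>2)))) (at (eta j))"
  proof (rule DERIV_chain2[where f = th and g = "\<lambda>y. D * R / y"])
    show "(th has_field_derivative deriv th (Q powi (- j))) (at (D * R / eta j))"
      unfolding p by (rule th_has_derivative) simp
    show "((\<lambda>y. D * R / y) has_field_derivative - (D * R / (eta j)\<^sup>2)) (at (eta j))"
      by (auto intro!: derivative_eq_intros simp: power2_eq_square)
  qed
  then have "residue (\<lambda>y. (f k y * Phi l y * N y / y) / th (D * R / y)) (eta j)
      = (f k (eta j) * Phi l (eta j) * N (eta j) / eta j) / (deriv th (Q powi (- j)) * (- (D * R / (eta j)\<^sup>2)))"
    by (intro residue_simple_zero)
      (auto simp: p deriv_th_nonzero intro!: analytic_intros an[OF f_holomorphic o] an[OF Phi_holomorphic o]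
        an[OF holomorphic_on_subset[OF N_holomorphic] o])
  then show ?thesis
    by (simp add: integrand_def[abs_def] M_eq_N mult_ac power2_eq_square)
qed

text \<open>At the reciprocal point \<open>M\<close> itself is regular, by \<open>generic\<close>
  and the signs of the parameters. The pole is the simple zero of th(D R y) in 1/c(y) = N(1/y) /
  th(D R y).\<close>

lemma residue_dual:
  assumes small: "norm (eta j) < 1"
  shows "residue (\<lambda>y. 1 / (c_fun q c d r (inverse y) * c_fun q c d r y * y)) (1 / eta j)
    = M (1 / eta j) * N (eta j) * eta j / (D * R * deriv th (Q powi (- j)))"
proof -
  define y where "y = 1 / eta j"
  have y: "y \<noteq> 0" "1 / y = eta j" by (simp_all add: y_def)
  have "eta j \<in> dom" using cball_subset_dom small by simp
  note aN = holomorphic_on_imp_analytic_at[OF N_holomorphic open_dom this]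
  have p: "D * R * y = Q powi (- j)" by (simp add: y_def eta_def power_int_minus divide_simps)
  have aN': "(\<lambda>w. N (1 / w)) analytic_on {y}"
  proof -
    have "(\<lambda>w. 1 / w) analytic_on {y}"
      using y(1) by (intro analytic_intros) auto
    then show ?thesis
      using analytic_on_compose[of "\<lambda>w. 1 / w" "{y}" N] aN y(2) by (simp add: o_def)
  qed
  have n1: "ip (C * y / D) \<noteq> 0"
  proof -
    have "C * y / D = C / (D * eta j)" by (simp add: y_def mult.commute)
    then show ?thesis
      unfolding C_over_D_eta using neg_Q_powi[of "c / (d\<^sup>2 * r)" "- j"] neg_cdr by simp
  qed
  have n2: "ip (D * y) \<noteq> 0"
    using neg_Q_powi[of "1 / r" "- j"] r_neg
    by (simp add: y_def eta_def power_int_minus divide_simps)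
  have n3: "th (D * R / y) \<noteq> 0"
    using th_DR_eta[of j] by (simp add: y_def)
  have aM: "M analytic_on {y}"
    unfolding M_def using n1 n2 n3 y(1) by (intro analytic_intros) auto
  have "((\<lambda>y. th (D * R * y)) has_field_derivative (deriv th (Q powi (- j)) * (D * R))) (at y)"
  proof (rule DERIV_chain2[where f = th])
    show "(th has_field_derivative deriv th (Q powi (- j))) (at (D * R * y))"
      unfolding p by (rule th_has_derivative) simp
  qed (auto intro!: derivative_eq_intros)
  then have "residue (\<lambda>w. (M w * N (1 / w) / w) / th (D * R * w)) y
      = (M y * N (1 / y) / y) / (deriv th (Q powi (- j)) * (D * R))"
    using y(1) by (intro residue_simple_zero)
      (auto simp: p deriv_th_nonzero intro!: analytic_intros aM aN')
  moreover have "residue (\<lambda>w. 1 / (c_fun q c d r (inverse w) * c_fun q c d r w * w)) y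
      = residue (\<lambda>w. (M w * N (1 / w) / w) / th (D * R * w)) y"
  proof (rule residue_cong)
    have "eventually (\<lambda>w. w \<noteq> 0) (nhds y)"
      using y(1) by (rule t1_space_nhds)
    then show "eventually (\<lambda>w. 1 / (c_fun q c d r (inverse w) * c_fun q c d r w * w)
        = (M w * N (1 / w) / w) / th (D * R * w)) (at y)"
      unfolding eventually_at_filter
    proof eventually_elim
      case (elim w)
      have 1: "1 / c_fun q c d r (inverse w) = M w" using inverse_c_fun[OF elim] by (simp add: inverse_eq_divide)
      have 2: "1 / c_fun q c d r w = N (1 / w) / th (D * R * w)"
        using inverse_c_fun[of "1 / w"] elim by (simp add: M_eq_N)
      have "1 / (c_fun q c d r (inverse w) * c_fun q c d r w * w)
          = (1 / c_fun q c d r (inverse w)) * (1 / c_fun q c d r w) / w" by simp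
      then show ?case unfolding 1 2 by simp
    qed
  qed simp
  ultimately show ?thesis
    unfolding y_def[symmetric] using y by (simp add: mult_ac y_def)
qed

text \<open>Replacing D R / y by D R y reverses the sign of the derivative of the theta factor, and
  \<open>f_eta_M\<close> exchanges one \<open>f\<close> together with \<open>M (1 / eta j)\<close>
  for \<open>Phi\<close>.\<close>

lemma dual_term:
  assumes "norm (eta j) < 1"
  shows "residue (\<lambda>y. 1 / (c_fun q c d r (inverse y) * c_fun q c d r y * y)) (1 / eta j)
      * f k (eta j) * f l (eta j) = - residue (integrand k l) (eta j)"
  unfolding residue_dual[OF assms] residue_integrand[OF assms] f_eta_M[OF assms, symmetric]
  by simp

end

section \<open>Contours between the poles\<close>

text \<open>The two circles are joined along the imaginary axis, which the real points \<open>pts\<close> avoid.\<close>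

lemma residue_theorem_annulus:
  fixes f :: "complex \<Rightarrow> complex"
  assumes r: "0 \<le> r0" "r0 < r1" "r1 < r2" "r2 < r3"
    and hol: "f holomorphic_on {z. r0 < norm z \<and> norm z < r3} - pts"
    and pts: "finite pts" "pts \<subseteq> \<real>" "\<And>p. p \<in> pts \<Longrightarrow> r1 < norm p \<and> norm p < r2"
  shows "contour_integral (circlepath 0 r2) f - contour_integral (circlepath 0 r1) f
    = 2 * pi * \<i> * (\<Sum>p\<in>pts. residue f p)"
proof -
  define S where "S = {z::complex. r0 < norm z \<and> norm z < r3}"
  \<comment> \<open>The shift by a quarter turn makes each circle start on the positive imaginary
    axis, where the segment \<open>L\<close> meets it.\<close>
  define C where "C = (\<lambda>x::real. shiftpath (1 / 4) (circlepath 0 x))"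
  define L where "L = linepath (\<i> * r2) (\<i> * r1)"
  define \<gamma> where "\<gamma> = (C r2 +++ L) +++ (reversepath (C r1) +++ reversepath L)"
  have openS: "open S"
    unfolding S_def by (intro open_Collect_conj open_Collect_less continuous_intros)
  have connS: "connected S"
    using connected_annulus(1)[of r0 "0::complex" r3] by (simp add: S_def)
  have vC: "valid_path (C x)" for x
    unfolding C_def by (intro valid_path_shiftpath) auto
  have vL: "valid_path L" by (simp add: L_def)
  have e: "exp (2 * of_real pi * \<i> * of_real (1 / 4)) = \<i>"
    using cis_conv_exp[of "pi / 2"] cis_pi_half by (simp add: mult_ac)
  have psC: "pathstart (C x) = \<i> * x" "pathfinish (C x) = \<i> * x" for x
  proof -
    have "circlepath 0 x (1 / 4) = \<i> * x"
      using e by (simp add: circlepath mult_ac)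
    moreover have "pathstart (C x) = circlepath 0 x (1 / 4)" "pathfinish (C x) = circlepath 0 x (1 / 4)"
      unfolding C_def by (simp_all add: pathstart_shiftpath pathfinish_shiftpath)
    ultimately show "pathstart (C x) = \<i> * x" "pathfinish (C x) = \<i> * x" by simp_all
  qed
  have psL: "pathstart L = \<i> * r2" "pathfinish L = \<i> * r1"
    by (simp_all add: L_def)
  have imC: "path_image (C x) = {z. norm z = x}" if "x > 0" for x
    using that by (simp add: C_def path_image_shiftpath sphere_def)
  have imL: "path_image L \<subseteq> {z. r1 \<le> norm z \<and> norm z \<le> r2 \<and> Re z = 0 \<and> Im z > 0}"
  proof
    fix z assume "z \<in> path_image L"
    then obtain u where u: "0 \<le> u" "u \<le> 1" "z = (1 - u) *\<^sub>R (\<i> * r2) + u *\<^sub>R (\<i> * r1)"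
      by (auto simp: L_def in_segment)
    then have z: "z = \<i> * complex_of_real ((1 - u) * r2 + u * r1)"
      by (simp add: scaleR_conv_of_real algebra_simps)
    have "(1 - u) * r1 + u * r1 \<le> (1 - u) * r2 + u * r1" "(1 - u) * r2 + u * r1 \<le> (1 - u) * r2 + u * r2"
      using u r by (auto intro!: add_mono mult_left_mono)
    moreover define v where "v = (1 - u) * r2 + u * r1"
    ultimately have "r1 \<le> v" "v \<le> r2"
      by (simp_all add: algebra_simps)
    then show "z \<in> {z. r1 \<le> norm z \<and> norm z \<le> r2 \<and> Re z = 0 \<and> Im z > 0}"
      using r unfolding z v_def[symmetric] by (simp add: norm_mult)
  qed
  have r1: "r1 > 0" and r2: "r2 > 0" using r by auto
  have vg: "valid_path \<gamma>"
    unfolding \<gamma>_def by (intro valid_path_join vC vL) (simp_all add: psC psL vC vL)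
  have ptsL: "p \<notin> path_image L" if "p \<in> pts" for p
  proof
    assume "p \<in> path_image L"
    then have "Im p > 0" using imL by auto
    moreover have "Im p = 0" using pts(2) that by (auto simp: complex_is_Real_iff)
    ultimately show False by simp
  qed
  have img: "path_image \<gamma> = {z. norm z = r2} \<union> {z. norm z = r1} \<union> path_image L"
    unfolding \<gamma>_def by (auto simp: path_image_join psC psL imC[OF r1] imC[OF r2])
  have sub: "path_image \<gamma> \<subseteq> S - pts"
    using imL r ptsL pts(3) unfolding img by (fastforce simp: S_def)
  \<comment> \<open>\<open>L\<close> is traversed in both directions, so only the two circles
    contribute.\<close>
  have wn: "winding_number \<gamma> z = winding_number (circlepath 0 r2) z - winding_number (circlepath 0 r1) z"
    if "norm z \<noteq> r1" "norm z \<noteq> r2" "z \<notin> path_image L" for z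
    using that imC[OF r1] imC[OF r2] vC vL unfolding \<gamma>_def
    by (simp add: winding_number_join winding_number_reversepath valid_path_imp_path psC psL path_image_join)
      (simp add: C_def winding_number_shiftpath sphere_def r1 r2 less_imp_le)
  have out: "winding_number (circlepath 0 x) z = 0" if "0 < x" "x < norm z" for x and z :: complex
    by (rule winding_number_zero_outside[of _ "cball 0 x"]) (use that in \<open>auto simp: sphere_def\<close>)
  have ins: "winding_number (circlepath 0 x) z = 1" if "norm z < x" for x and z :: complex
    using winding_number_circlepath[of z 0 x] that by simp
  have "winding_number \<gamma> z = 0" if "z \<notin> S" for z
  proof -
    have n: "norm z \<noteq> r1" "norm z \<noteq> r2" "z \<notin> path_image L"
      using that sub r unfolding img S_def by auto
    show ?thesis
    proof (cases "norm z \<le> r0")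
      case True
      then show ?thesis unfolding wn[OF n] using r ins[of z r1] ins[of z r2] by simp
    next
      case False
      then have "norm z \<ge> r3" using that by (simp add: S_def)
      then show ?thesis unfolding wn[OF n] using r r1 r2 out[of r1 z] out[of r2 z] by simp
    qed
  qed
  then have "contour_integral \<gamma> f = 2 * pi * \<i> * (\<Sum>p\<in>pts. winding_number \<gamma> p * residue f p)"
    using hol sub
    by (intro Residue_theorem[OF openS connS pts(1) _ vg])
      (auto simp: S_def[symmetric] \<gamma>_def psC psL)
  also have "(\<Sum>p\<in>pts. winding_number \<gamma> p * residue f p) = (\<Sum>p\<in>pts. residue f p)"
  proof (intro sum.cong refl)
    fix p assume p: "p \<in> pts"
    show "winding_number \<gamma> p * residue f p = residue f p"
      using pts(3)[OF p] ptsL[OF p] r1 by (subst wn) (simp_all add: out ins)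
  qed
  finally have "contour_integral \<gamma> f = 2 * pi * \<i> * (\<Sum>p\<in>pts. residue f p)" .
  moreover have "contour_integral \<gamma> f = contour_integral (circlepath 0 r2) f - contour_integral (circlepath 0 r1) f"
  proof -
    have int: "f contour_integrable_on g" if "valid_path g" "path_image g \<subseteq> path_image \<gamma>" for g
      using that sub hol pts(1) openS unfolding S_def[symmetric]
      by (intro contour_integrable_holomorphic_simple[of f "S - pts"]) (auto intro: open_Diff finite_imp_closed)
    have i: "f contour_integrable_on C r2" "f contour_integrable_on C r1" "f contour_integrable_on L"
      by (rule int; use vC vL in \<open>auto simp: img imC r1 r2\<close>)+
    have cc: "contour_integral (C x) f = contour_integral (circlepath 0 x) f" for x
      unfolding C_def by (intro contour_integral_shiftpath) auto
    show ?thesis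
      unfolding \<gamma>_def using i vC vL
      by (simp add: contour_integral_reversepath contour_integrable_reversepath cc psC psL)
  qed
  ultimately show ?thesis by simp
qed

context q_base
begin

text \<open>Here \<open>norm x\<close> is \<open>q powr (- m - 1/2)\<close>, halfway between two zeros of the product.\<close>

lemma fp_lower_bound:
  obtains \<beta> where "\<beta> > 0"
    "\<And>x m n. norm x * q ^ m * sqrt q = 1 \<Longrightarrow> n \<ge> 1 \<Longrightarrow> norm (fp x n) \<ge> \<beta> * norm x"
proof -
  define s where "s = sqrt q"
  have s: "s > 0" "s < 1" "s * s = q" using q_pos q_less_1 by (simp_all add: s_def)
  have "ip (complex_of_real s) \<noteq> 0" using s by (intro ip_nonzero_norm) simp
  then obtain B where B: "B > 0" "\<And>n. norm (1 / fp (complex_of_real s) n) \<le> B"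
    using inverse_fp_bounded by blast
  define g where "g n = (\<Prod>j<n. 1 - s * q ^ j)" for n
  have sq: "s * q ^ j \<le> s" for j
    using s q_pos q_less_1 by (simp add: mult_left_le power_le_one)
  have pos: "0 < 1 - s * q ^ j" "1 - s * q ^ j \<le> 1" for j
    using le_less_trans[OF sq s(2), of j] s(1) q_pos by simp_all
  have gpos: "g n > 0" for n
    unfolding g_def using pos by (intro prod_pos) auto
  have "complex_of_real (g n) = fp (complex_of_real s) n" for n
    by (simp add: g_def qpoch_def)
  then have gB': "norm (1 / complex_of_real (g n)) \<le> B" for n using B(2) by simp
  have gB: "1 / B \<le> g n" for n
    using gB'[of n] gpos[of n] B(1) by (simp add: norm_divide field_simps)
  define b where "b = 1 / B"
  have b: "b > 0" "b \<le> g n" for n using B gB by (simp_all add: b_def)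
  have b1: "b \<le> 1" using b(2)[of 0] by (simp add: g_def)
  have "norm (fp x n) \<ge> (b * b) * norm x" if x: "norm x * q ^ m * s = 1" and n: "n \<ge> 1" for x m n
  proof -
    define a where "a = norm x"
    define u where "u i = norm (1 - x * Q ^ i)" for i
    have a: "a * q ^ m * s = 1" "a > 0" using x s q_pos by (auto simp: a_def zero_less_mult_iff)
    have u_low: "u i \<ge> \<bar>a * q ^ i - 1\<bar>" for i
      using norm_triangle_ineq3[of "x * Q ^ i" 1] by (simp add: u_def a_def norm_mult norm_power norm_minus_commute)
    \<comment> \<open>Since a q^m = 1/s, the factors up to index m are at least a q^i (1 - s
      q^(m-i)), and those beyond (\<open>hi\<close>) at least 1 - s q^(i-m-1). The deviations on
      each side form partial products of (s;q)_inf, bounded below by \<open>b\<close>. Every a q^i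
      with \<open>i \<le> m\<close> is at least 1, so retaining the one at i = 0 gives the factor
      \<open>norm x\<close>.\<close>
    have lo: "a * q ^ i * (1 - s * q ^ (m - i)) \<le> u i" "1 \<le> a * q ^ i" if "i \<le> m" for i
    proof -
      have qm: "q ^ m = q ^ i * q ^ (m - i)" using that by (simp add: power_add[symmetric])
      have "a * q ^ i * (s * q ^ (m - i)) = 1" using a(1) by (simp add: qm mult_ac)
      then show "a * q ^ i * (1 - s * q ^ (m - i)) \<le> u i"
        using u_low[of i] by (simp add: algebra_simps)
      have "s * q ^ (m - i) \<le> 1" using pos[of "m - i"] by simp
      then have "a * q ^ i * (s * q ^ (m - i)) \<le> a * q ^ i * 1"
        using a q_pos by (intro mult_left_mono) auto
      then show "1 \<le> a * q ^ i" using \<open>a * q ^ i * (s * q ^ (m - i)) = 1\<close> by simp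
    qed
    have hi: "1 - s * q ^ i \<le> u (Suc m + i)" for i
    proof -
      have "a * q ^ (Suc m + i) = (a * q ^ m * s) * s * q ^ i"
        by (simp add: power_add s(3)[symmetric] mult_ac)
      then have "a * q ^ (Suc m + i) = s * q ^ i" using a(1) by simp
      then show ?thesis using u_low[of "Suc m + i"] by simp
    qed
    have prod_le: "(\<Prod>i<k. u i) \<ge> a * b" if "1 \<le> k" "k \<le> Suc m" for k
    proof -
      have "a * b \<le> (\<Prod>i<k. a * q ^ i) * (\<Prod>i<k. 1 - s * q ^ (m - i))"
      proof (intro mult_mono)
        have "(\<Prod>i<k. a * q ^ i) = a * (\<Prod>i\<in>{1..<k}. a * q ^ i)"
          using that prod.atLeast_Suc_lessThan[of 0 k "\<lambda>i. a * q ^ i"] by (simp add: atLeast0LessThan)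
        moreover have "1 \<le> (\<Prod>i\<in>{1..<k}. a * q ^ i)"
          using that lo(2) by (intro prod_ge_1) auto
        ultimately show "a \<le> (\<Prod>i<k. a * q ^ i)" using a(2) by simp
        have "b \<le> g (Suc m)" by (rule b)
        also have "g (Suc m) = (\<Prod>i<Suc m. 1 - s * q ^ (m - i))"
          unfolding g_def using prod.nat_diff_reindex[of "\<lambda>j. 1 - s * q ^ j" "Suc m"] by simp
        also have "\<dots> = (\<Prod>i<k. 1 - s * q ^ (m - i)) * (\<Prod>i\<in>{k..<Suc m}. 1 - s * q ^ (m - i))"
        proof -
          have "{..<Suc m} = {..<k} \<union> {k..<Suc m}" using that by auto
          then show ?thesis by (metis prod.union_disjoint finite_lessThan finite_atLeastLessThan ivl_disj_int_one(2))
        qed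
        also have "\<dots> \<le> (\<Prod>i<k. 1 - s * q ^ (m - i)) * 1"
          using pos by (intro mult_left_mono prod_le_1 prod_nonneg) (auto intro: less_imp_le)
        finally show "b \<le> (\<Prod>i<k. 1 - s * q ^ (m - i))" by simp
      qed (use a b q_pos in \<open>auto intro!: prod_nonneg intro: less_imp_le\<close>)
      also have "\<dots> = (\<Prod>i<k. a * q ^ i * (1 - s * q ^ (m - i)))"
        by (simp add: prod.distrib)
      also have "\<dots> \<le> (\<Prod>i<k. u i)"
        using that lo(1) pos a q_pos by (intro prod_mono) (auto intro: less_imp_le)
      finally show ?thesis .
    qed
    have "(\<Prod>i<n. u i) \<ge> a * b * b"
    proof (cases "n \<le> Suc m")
      case True
      have "a * b * b \<le> a * b * 1" using a b b1 by (intro mult_left_mono) auto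
      then show ?thesis using prod_le[OF n True] by simp
    next
      case False
      then obtain k where k: "n = Suc m + k" using le_Suc_ex[of "Suc m" n] by auto
      have "(\<Prod>i<n. u i) = (\<Prod>i<Suc m. u i) * (\<Prod>i<k. u (Suc m + i))"
      proof -
        have "(\<Prod>i<p + k. u i) = (\<Prod>i<p. u i) * (\<Prod>i<k. u (p + i))" for p
          by (induction k) (simp_all add: mult_ac)
        then show ?thesis unfolding k .
      qed
      also have "\<dots> \<ge> (a * b) * g k"
      proof (rule mult_mono)
        show "0 \<le> (\<Prod>i<Suc m. u i)" by (intro prod_nonneg) (simp add: u_def)
        show "g k \<le> (\<Prod>i<k. u (Suc m + i))"
          unfolding g_def using hi pos by (intro prod_mono) (auto intro: less_imp_le)
        show "0 \<le> g k" using gpos[of k] by simp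
      qed (rule prod_le; simp)
      finally show ?thesis using b(2)[of k] a b(1)
        by (meson less_imp_le mult_left_mono mult_pos_pos order_trans)
    qed
    then show ?thesis by (simp add: qpoch_def prod_norm u_def a_def mult_ac)
  qed
  moreover have "b * b > 0" using b(1) by simp
  ultimately show ?thesis using that unfolding s_def by blast
qed

end

section \<open>Asymptotics at the origin\<close>

context q_base
begin

lemma q_powi_conv_powr: "q powi j = q powr (of_int j)"
  using powr_real_of_int'[of q j] q_pos by simp

lemma q_powi_inject: "q powi i = q powi j \<longleftrightarrow> i = j"
  using q_pos q_less_1 by (simp add: q_powi_conv_powr powr_inj)

lemma q_powi_less: "q powi i < q powi j \<longleftrightarrow> j < i"
  using q_pos q_less_1 by (simp add: q_powi_conv_powr powr_def mult_less_cancel_right)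

end

context little_jacobi
begin

definition xk :: "int \<Rightarrow> complex \<Rightarrow> complex" where
  "xk k y = D * zk k / y"

text \<open>\<open>f\<close> with the growing factor \<open>ip (xk k y)\<close> taken out of the
  Heine sum: ip(x q^n) = ip(x) / fp x n. The denominators are what suppress the terms with n > 0
  near the origin.\<close>

definition fsum :: "int \<Rightarrow> complex \<Rightarrow> complex" where
  "fsum k y = (\<Sum>n. hterm 0 (D * y) C (zk k) n / fp (xk k y) n)"

text \<open>The index m is existentially quantified so that approaching 0 through these circles is a
  limit within a single set.\<close>

definition mid_circles :: "int \<Rightarrow> complex set" where
  "mid_circles k = {y. \<exists>m. norm (xk k y) * q ^ m * sqrt q = 1}"

lemma mid_circles_nz: "y \<in> mid_circles k \<Longrightarrow> y \<noteq> 0"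
  by (auto simp: mid_circles_def xk_def)

lemma th_xk:
  assumes "y \<in> mid_circles k"
  shows "th (xk k y) \<noteq> 0"
proof
  assume 0: "th (xk k y) = 0"
  obtain m where m: "norm (xk k y) * q ^ m * sqrt q = 1"
    using assms by (auto simp: mid_circles_def)
  then have "xk k y \<noteq> 0" by auto
  then obtain i :: int where "xk k y = Q powi i"
    using 0 th_eq_0_iff by blast
  then have "norm (xk k y) = q powi i" by (simp add: norm_power_int)
  then have "q powi (i + int m) * sqrt q = 1" using m by (simp add: power_int_add)
  \<comment> \<open>Squaring removes the root and leaves an odd power of \<open>q\<close> equal to
    1, a parity contradiction.\<close>
  then have "(q powi (i + int m) * sqrt q)\<^sup>2 = 1" by simp
  moreover have "q powi (e + e + 1) = (q powi e * sqrt q)\<^sup>2" for e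
  proof -
    have "q powi (e + e + 1) = q powi e * q powi e * q"
      by (subst power_int_add, simp, subst power_int_add) simp_all
    then show ?thesis using q_pos by (simp add: power_mult_distrib power2_eq_square[of "q powi e"])
  qed
  ultimately have "q powi (i + int m + (i + int m) + 1) = q powi 0"
    by (simp only: power_int_0_right)
  then have "i + int m + (i + int m) + 1 = 0"
    unfolding q_powi_inject .
  then show False by presburger
qed

lemma hterm_fsum_bound:
  obtains K where "K > 0"
    "\<And>y n. norm y \<le> 1 \<Longrightarrow> norm (hterm 0 (D * y) C (zk k) n) \<le> K * \<bar>d\<bar> ^ n"
proof -
  obtain K where K: "K > 0" "\<And>A b c' z n. norm A \<le> 0 \<Longrightarrow> norm b \<le> \<bar>d\<bar> \<Longrightarrow> norm c' \<le> norm C \<Longrightarrow>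
      norm z \<le> norm (zk k) \<Longrightarrow> norm (hterm A b c' z n) \<le> K * \<bar>d\<bar> ^ n"
    using hterm_bound[of "\<bar>d\<bar>" 0 "norm C" "norm (zk k)"] d_nz by (metis zero_less_abs_iff)
  have "norm (hterm 0 (D * y) C (zk k) n) \<le> K * \<bar>d\<bar> ^ n" if "norm y \<le> 1" for y n
  proof (rule K(2))
    show "norm (D * y) \<le> \<bar>d\<bar>"
      using mult_left_mono[OF that, of "\<bar>d\<bar>"] by (simp add: norm_mult)
  qed simp_all
  then show ?thesis using K(1) that by blast
qed

text \<open>By \<open>fp_lower_bound\<close> every denominator from n = 1 on is at least a multiple
  of |xk k y|, which is inversely proportional to |y|. The remaining geometric series in |d| is
  bounded uniformly, so the tail is O(|y|).\<close>

lemma fsum_bound: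
  obtains K where "\<And>y. y \<in> mid_circles k \<Longrightarrow> norm y \<le> 1 \<Longrightarrow> norm (fsum k y - 1) \<le> K * norm y"
proof -
  obtain K where K: "K > 0"
    "\<And>y n. norm y \<le> 1 \<Longrightarrow> norm (hterm 0 (D * y) C (zk k) n) \<le> K * \<bar>d\<bar> ^ n"
    using hterm_fsum_bound by blast
  obtain \<beta> where \<beta>: "\<beta> > 0"
    "\<And>x m n. norm x * q ^ m * sqrt q = 1 \<Longrightarrow> n \<ge> 1 \<Longrightarrow> norm (fp x n) \<ge> \<beta> * norm x"
    using fp_lower_bound by blast
  define K' where "K' = K / (\<beta> * norm (D * zk k)) * (1 / (1 - \<bar>d\<bar>))"
  have "norm (fsum k y - 1) \<le> K' * norm y" if y: "y \<in> mid_circles k" "norm y \<le> 1" for y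
  proof -
    define t where "t n = hterm 0 (D * y) C (zk k) n / fp (xk k y) n" for n
    have y0: "y \<noteq> 0" using y mid_circles_nz by blast
    define x where "x = norm (xk k y)"
    have x: "x > 0" "x = norm (D * zk k) / norm y"
      using y0 zk_nz by (simp_all add: x_def xk_def norm_divide norm_mult)
    have t_le: "norm (t (Suc n)) \<le> K / (\<beta> * x) * \<bar>d\<bar> ^ n" for n
    proof -
      have "\<beta> * x \<le> norm (fp (xk k y) (Suc n))"
        using y(1) \<beta>(2) by (auto simp: mid_circles_def x_def)
      then have "norm (t (Suc n)) \<le> (K * \<bar>d\<bar> ^ Suc n) / (\<beta> * x)"
        unfolding t_def norm_divide using K(2)[OF y(2), of "Suc n"] x(1) \<beta>(1) K(1) by (intro frac_le) simp_all
      also have "\<dots> \<le> (K * \<bar>d\<bar> ^ n) / (\<beta> * x)"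
        using d_less K(1) \<beta>(1) x(1) by (intro divide_right_mono mult_left_mono power_decreasing) auto
      finally show ?thesis by simp
    qed
    have geo: "(\<lambda>n. K / (\<beta> * x) * \<bar>d\<bar> ^ n) sums (K / (\<beta> * x) * (1 / (1 - \<bar>d\<bar>)))"
      using d_less by (intro sums_mult geometric_sums) auto
    have sn: "summable (\<lambda>n. norm (t (Suc n)))"
      by (rule summable_comparison_test[OF _ sums_summable[OF geo]]) (use t_le in auto)
    then have "summable (\<lambda>n. t (Suc n))" by (rule summable_norm_cancel)
    then have st: "summable t" by (simp add: summable_Suc_iff)
    have "t 0 = 1" by (simp add: t_def hterm_def)
    moreover have "fsum k y = suminf t"
      unfolding fsum_def t_def[abs_def] ..
    ultimately have "fsum k y - 1 = (\<Sum>n. t (Suc n))"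
      using suminf_split_head[OF st] by simp
    also have "norm \<dots> \<le> (\<Sum>n. norm (t (Suc n)))" by (rule summable_norm[OF sn])
    also have "\<dots> \<le> K / (\<beta> * x) * (1 / (1 - \<bar>d\<bar>))"
      using sums_le[OF t_le summable_sums[OF sn] geo] .
    also have "\<dots> = K' * norm y" using y0 by (simp add: K'_def x(2))
    finally show ?thesis .
  qed
  then show ?thesis using that by blast
qed

lemma fsum_tendsto: "(fsum k \<longlongrightarrow> 1) (at 0 within mid_circles k)"
proof -
  obtain K where K: "\<And>y. y \<in> mid_circles k \<Longrightarrow> norm y \<le> 1 \<Longrightarrow> norm (fsum k y - 1) \<le> K * norm y"
    using fsum_bound by blast
  have lim: "((\<lambda>y. K * norm y) \<longlongrightarrow> 0) (at 0 within mid_circles k)"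
    by (intro tendsto_mult_right_zero tendsto_norm_zero tendsto_ident_at)
  have le: "eventually (\<lambda>y. norm (fsum k y - 1) \<le> K * norm y) (at 0 within mid_circles k)"
    unfolding eventually_at
  proof (intro exI[of _ 1] conjI ballI impI)
    fix y assume "y \<in> mid_circles k" "y \<noteq> 0 \<and> dist y 0 < 1"
    then show "norm (fsum k y - 1) \<le> K * norm y" by (intro K) simp_all
  qed simp
  have "((\<lambda>y. fsum k y - 1) \<longlongrightarrow> 0) (at 0 within mid_circles k)"
    by (rule Lim_null_comparison[OF le lim])
  then show ?thesis by (simp add: LIM_zero_iff)
qed

lemma f_eq_fsum:
  assumes y: "y \<in> mid_circles k" and small: "norm (D * y) < 1"
  shows "f k y = ip (D * y) * ip (xk k y) / (ip C * ip (zk k)) * fsum k y"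
proof -
  have y0: "y \<noteq> 0" using y mid_circles_nz by blast
  have ipx: "ip (xk k y) \<noteq> 0" using th_xk[OF y] by (auto simp: th_def)
  have t: "hterm 0 (D * y) C (zk k) n / fp (xk k y) n = hterm (xk k y) (D * y) C (zk k) n / ip (xk k y)" for n
    using ip_split[of "xk k y" n] fp_nonzero[OF ipx, of n] ipx by (simp add: hterm_def)
  have "fsum k y = hsum (xk k y) (D * y) C (zk k) / ip (xk k y)"
    unfolding fsum_def t hsum_def by (rule suminf_divide[OF hterm_summable[OF small]])
  moreover have "D / y * zk k = xk k y" by (simp add: xk_def)
  ultimately show ?thesis using ipx by (simp add: f_def heine_def)
qed

text \<open>Here the essential singularity disappears: th R / th(D R / y) equals (y/D)^k th(zk k) /
  th(xk k y), and the last denominator contains the growing factor \<open>ip (xk k y)\<close> of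
  \<open>f\<close>.\<close>

lemma fM_eq:
  assumes y: "y \<in> mid_circles k" "y \<in> dom"
  shows "f k y * M y = ip (y\<^sup>2) / ip (C * y / D) * (y / D) powi k * (ip (Q / zk k) / ip (Q * y / (D * zk k))) * fsum k y"
proof -
  have y0: "y \<noteq> 0" using y mid_circles_nz by blast
  note nz = dom_nonzero[OF y(2)]
  define x where "x = D * R / y"
  have x: "x \<noteq> 0" "xk k y = x * Q powi k" using y0 by (simp_all add: x_def xk_def zk_def)
  have thX: "th (xk k y) \<noteq> 0" using th_xk[OF y(1)] .
  have thx: "th x \<noteq> 0"
  proof
    assume "th x = 0"
    then obtain i :: int where "x = Q powi i" using x(1) th_eq_0_iff by blast
    then have "xk k y = Q powi (i + k)" by (simp add: x(2) power_int_add)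
    then show False using thX by (simp only: th_Q_powi)
  qed
  have "th (xk k y) * x powi k * th R = th (zk k) * R powi k * th x"
    using th_shift_ratio[of x R k] x by (simp add: zk_def)
  moreover have "R powi k = x powi k * (y / D) powi k"
    using y0 by (simp add: x_def power_int_mult_distrib[symmetric])
  ultimately have "x powi k * (th (xk k y) * th R) = x powi k * (th (zk k) * (y / D) powi k * th x)"
    by (simp add: mult_ac)
  then have key: "th (xk k y) * th R = th (zk k) * (y / D) powi k * th x"
    using x(1) by simp
  have Xx: "th (xk k y) = ip (xk k y) * ip (Q * y / (D * zk k))"
    by (simp add: th_def xk_def)
  have ipX: "ip (xk k y) \<noteq> 0" "ip (Q * y / (D * zk k)) \<noteq> 0" using thX by (auto simp: Xx)
  have ipz: "ip (zk k) \<noteq> 0" by (rule ip_nonzero_cut_plane[OF zk_cut])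
  have r: "th R / th x = th (zk k) * (y / D) powi k / th (xk k y)"
    using key thx thX by (simp add: field_simps)
  have "f k y * M y = ip (y\<^sup>2) / ip (C * y / D) * (ip (xk k y) / ip (zk k)) * (th R / th x) * fsum k y"
    unfolding f_eq_fsum[OF y(1) nz(4)] M_def x_def[symmetric] using nz ipC by (simp add: mult_ac)
  also have "\<dots> = ip (y\<^sup>2) / ip (C * y / D) * (y / D) powi k * (ip (Q / zk k) / ip (Q * y / (D * zk k))) * fsum k y"
    unfolding r Xx using ipX ipz by (simp add: th_def)
  finally show ?thesis .
qed

lemma V_0: "V l 0 = 1 / ip (Zk l)"
proof -
  have "hterm 0 0 0 (Zk l) = (\<lambda>n. if n = 0 then 1 else 0)"
    by (rule ext) (auto simp: hterm_def power_0_left)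
  then have "hsum 0 0 0 (Zk l) = 1"
    unfolding hsum_def using sums_unique[OF sums_single[of 0 "\<lambda>_. 1::complex"]] by simp
  then show ?thesis by (simp add: V_def heine_def)
qed

lemma w_sq_eq: "complex_of_real (w_sq q c d r k) = D powi (2 * k) * (ip (Zk k) / ip (Q / zk k))"
proof -
  have 1: "Zk k = complex_of_real (c * q powi (1 - k) / (d\<^sup>2 * r))"
    by (simp add: Zk_def of_real_power_int)
  have 2: "Q / zk k = complex_of_real (q powi (1 - k) / r)"
    using power_int_diff[of Q 1 k] by (simp add: zk_def of_real_power_int)
  show ?thesis unfolding 1 2 ip_of_real by (simp add: w_sq_def of_real_power_int)
qed

lemma integrand_limit:
  assumes "l \<le> k"
  shows "((\<lambda>y. f k y * Phi l y * M y) \<longlongrightarrow> (if k = l then 1 / complex_of_real (w_sq q c d r k) else 0))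
    (at 0 within mid_circles k)"
proof -
  \<comment> \<open>The power (y/D)^k from \<open>fM_eq\<close> and (D y)^(-l) from
    \<open>Phi\<close> combine to a multiple of y^(k-l). For \<open>l \<le> k\<close> this is a
    natural power, so \<open>G\<close> is continuous at 0, with nonzero limit only for k =
    l.\<close>
  define G where "G y = D powi (- k - l) * y ^ nat (k - l) * V l y * (ip (y\<^sup>2) / ip (C * y / D)
    * (ip (Q / zk k) / ip (Q * y / (D * zk k))))" for y
  have V: "(V l \<longlongrightarrow> V l 0) (at 0 within mid_circles k)"
  proof -
    have "isCont (V l) 0"
      using holomorphic_on_imp_continuous_on[OF V_holomorphic] cball_subset_dom[of 0]
        continuous_on_eq_continuous_at[OF open_dom] by (metis norm_zero zero_le_one)
    then show ?thesis
      using continuous_at_imp_continuous_at_within continuous_within by blast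
  qed
  have "(G \<longlongrightarrow> D powi (- k - l) * 0 ^ nat (k - l) * V l 0 * (ip (0\<^sup>2) / ip (C * 0 / D)
    * (ip (Q / zk k) / ip (Q * 0 / (D * zk k))))) (at 0 within mid_circles k)"
    unfolding G_def using zk_nz by (intro tendsto_intros V) auto
  then have "((\<lambda>y. G y * fsum k y) \<longlongrightarrow> (D powi (- k - l) * 0 ^ nat (k - l) * V l 0 * (ip (0\<^sup>2) / ip (C * 0 / D)
    * (ip (Q / zk k) / ip (Q * 0 / (D * zk k))))) * 1) (at 0 within mid_circles k)"
    by (intro tendsto_mult fsum_tendsto)
  moreover have "(D powi (- k - l) * 0 ^ nat (k - l) * V l 0 * (ip (0\<^sup>2) / ip (C * 0 / D)
    * (ip (Q / zk k) / ip (Q * 0 / (D * zk k))))) * 1 = (if k = l then 1 / complex_of_real (w_sq q c d r k) else 0)"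
  proof (cases "k = l")
    case True
    have "D powi (- k - k) = 1 / D powi (2 * k)"
    proof -
      have "- k - k = - (2 * k)" by simp
      then show ?thesis by (simp only: power_int_minus inverse_eq_divide)
    qed
    then show ?thesis using True by (simp add: w_sq_eq V_0)
  qed (use assms in \<open>simp add: power_0_left\<close>)
  moreover have "eventually (\<lambda>y. G y * fsum k y = f k y * Phi l y * M y) (at 0 within mid_circles k)"
    unfolding eventually_at
  proof (intro exI[of _ 1] conjI ballI impI)
    fix y assume y: "y \<in> mid_circles k" "y \<noteq> 0 \<and> dist y 0 < 1"
    then have dom: "y \<in> dom" by (intro cball_subset_dom) simp
    have "y ^ nat (k - l) = y powi (k - l)" using assms by (simp add: power_int_def)
    also have "\<dots> = y powi k * y powi (- l)" using y by (simp add: power_int_diff power_int_minus divide_simps)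
    finally have e1: "y ^ nat (k - l) = y powi k * y powi (- l)" .
    have e2: "D powi (- k - l) = D powi (- k) * D powi (- l)"
      by (simp add: power_int_diff power_int_minus divide_simps)
    have e3: "(y / D) powi k = y powi k * D powi (- k)"
      by (simp add: power_int_divide_distrib power_int_minus divide_simps)
    have "f k y * Phi l y * M y = (f k y * M y) * ((D powi (- l) * y powi (- l)) * V l y)"
      by (simp add: Phi_def power_int_mult_distrib)
    then show "G y * fsum k y = f k y * Phi l y * M y"
      unfolding fM_eq[OF y(1) dom] G_def e1 e2 e3 by (simp add: mult_ac)
  qed simp
  ultimately show ?thesis
    by (simp only: Lim_transform_eventually)
qed

end

section \<open>Summability and the integral over the half circle\<close>

context little_jacobi
begin

lemma norm_eta: "norm (eta j) = \<bar>d * r\<bar> * q powi j"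
  by (simp add: eta_def norm_mult abs_mult norm_power_int)

lemma norm_eta_less: "norm (eta i) < norm (eta j) \<longleftrightarrow> j < i"
  by (simp add: norm_eta q_powi_less)

lemma norm_eta_inject: "norm (eta i) = norm (eta j) \<longleftrightarrow> i = j"
  by (simp add: norm_eta q_powi_inject)

lemma norm_eta_neq_1: "norm (eta j) \<noteq> 1"
proof
  assume "norm (eta j) = 1"
  then have "\<bar>d * r\<bar> = q powi (- j)"
    using q_pos by (simp add: norm_eta power_int_minus field_simps)
  then have "(d * r)\<^sup>2 = q powi (- j + - j)"
    using power2_abs[of "d * r"] by (simp only: power2_eq_square power_int_add[OF disjI1[OF q_nonzero]])
  then show False using generic by blast
qed

lemma first_pole:
  obtains j0 where "\<And>j. norm (eta j) < 1 \<longleftrightarrow> j0 \<le> j"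
proof -
  define a where "a = \<bar>d * r\<bar>"
  have a: "a > 0" by (simp add: a_def)
  have lnq: "ln q < 0" using q_pos q_less_1 by simp
  have "norm (eta j) < 1 \<longleftrightarrow> \<lfloor>- ln a / ln q\<rfloor> + 1 \<le> j" for j
  proof -
    have "norm (eta j) < 1 \<longleftrightarrow> ln (a * q powr (of_int j)) < 0"
      using a q_pos by (simp add: norm_eta a_def[symmetric] q_powi_conv_powr)
    also have "\<dots> \<longleftrightarrow> ln a + of_int j * ln q < 0"
      using a q_pos by (simp add: ln_mult ln_powr)
    also have "\<dots> \<longleftrightarrow> - ln a / ln q < of_int j"
      unfolding neg_divide_less_eq[OF lnq] by linarith
    also have "\<dots> \<longleftrightarrow> \<lfloor>- ln a / ln q\<rfloor> < j"
      by (simp add: floor_less_iff)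
    finally show ?thesis by (simp only: add1_zle_eq)
  qed
  then show ?thesis using that by blast
qed

lemma norm_ip_Q_powi_le: "norm (ip (Q powi i)) \<le> 1"
proof (cases "i \<le> 0")
  case False
  have "norm (fp (Q powi i) n) \<le> 1" for n
  proof -
    have "norm (1 - Q powi i * Q ^ m) \<le> 1" for m
    proof -
      have "Q powi i * Q ^ m = complex_of_real (q powi i * q ^ m)"
        by (simp add: of_real_power_int)
      moreover have "q powi i \<le> 1"
        using q_powi_less[of i 0] False by simp
      then have "q powi i * q ^ m \<le> 1" "0 \<le> q powi i * q ^ m"
        using q_pos q_less_1 by (simp_all add: mult_le_one power_le_one)
      ultimately have "norm (1 - Q powi i * Q ^ m) = \<bar>1 - q powi i * q ^ m\<bar>"
        by (metis norm_of_real of_real_1 of_real_diff)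
      then show ?thesis
        using \<open>q powi i * q ^ m \<le> 1\<close> \<open>0 \<le> q powi i * q ^ m\<close> by simp
    qed
    then show ?thesis
      unfolding qpoch_def prod_norm[symmetric] by (intro prod_le_1) auto
  qed
  then show ?thesis
    by (intro Lim_bounded[OF tendsto_norm[OF qpoch_tendsto]]) auto
qed (simp add: ip_Q_powi_eq_0)

text \<open>Although \<open>f\<close> is unbounded near 0, at \<open>eta j\<close> the first
  parameter of the Heine sum is Q^(k-j), and the infinite product is at most 1 in norm at every
  integer power of q.\<close>

lemma f_eta_bounded:
  obtains K where "K > 0" "\<And>j. norm (eta j) < 1 \<Longrightarrow> norm (f k (eta j)) \<le> K"
proof -
  obtain K0 where K0: "K0 > 0"
    "\<And>y n. norm y \<le> 1 \<Longrightarrow> norm (hterm 0 (D * y) C (zk k) n) \<le> K0 * \<bar>d\<bar> ^ n"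
    using hterm_fsum_bound by blast
  define K where "K = exp (1 / (1 - q)) / norm (ip C * ip (zk k)) * (K0 * (1 / (1 - \<bar>d\<bar>)))"
  have "norm (f k (eta j)) \<le> K" if small: "norm (eta j) < 1" for j
  proof -
    define y where "y = eta j"
    have Dy: "norm (D * y) < 1" using D_eta_small[OF small] by (simp add: y_def)
    have A: "D / y * zk k = Q powi (k - j)"
      by (simp add: y_def eta_def zk_def power_int_diff divide_simps)
    have le: "norm (hterm (Q powi (k - j)) (D * y) C (zk k) n) \<le> K0 * \<bar>d\<bar> ^ n" for n
    proof -
      have 1: "hterm (Q powi (k - j)) (D * y) C (zk k) n = hterm 0 (D * y) C (zk k) n * ip (Q powi (k - j + int n))"
        by (simp add: hterm_def power_int_add)
      have "norm (hterm 0 (D * y) C (zk k) n) * norm (ip (Q powi (k - j + int n))) \<le> K0 * \<bar>d\<bar> ^ n * 1"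
        using small K0 by (intro mult_mono K0(2) norm_ip_Q_powi_le) (simp_all add: y_def)
      then show ?thesis unfolding 1 norm_mult by simp
    qed
    have geo: "(\<lambda>n. K0 * \<bar>d\<bar> ^ n) sums (K0 * (1 / (1 - \<bar>d\<bar>)))"
      using d_less by (intro sums_mult geometric_sums) auto
    have sn: "summable (\<lambda>n. norm (hterm (Q powi (k - j)) (D * y) C (zk k) n))"
      by (rule hterm_summable_norm[OF Dy])
    have "norm (hsum (Q powi (k - j)) (D * y) C (zk k)) \<le> K0 * (1 / (1 - \<bar>d\<bar>))"
      unfolding hsum_def using summable_norm[OF sn] sums_le[OF le summable_sums[OF sn] geo] by linarith
    moreover have "norm (ip (D * y)) \<le> exp (1 / (1 - q))"
      using Dy by (intro norm_ip_le) simp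
    ultimately show ?thesis
      unfolding y_def[symmetric] f_def heine_def A K_def norm_mult norm_divide
      by (intro mult_mono divide_right_mono) auto
  qed
  moreover have "K > 0"
    using K0 d_less ipC ip_nonzero_cut_plane[OF zk_cut] by (simp add: K_def)
  ultimately show ?thesis using that by blast
qed

lemma bounded_on_disc:
  assumes "h holomorphic_on dom"
  obtains K where "K > 0" "\<And>y. norm y \<le> 1 \<Longrightarrow> norm (h y) \<le> K"
proof -
  have "compact (h ` cball 0 1)"
    using holomorphic_on_imp_continuous_on[OF assms] cball_subset_dom
    by (intro compact_continuous_image compact_cball) (auto elim!: continuous_on_subset)
  then obtain K where K: "K > 0" "\<forall>z\<in>h ` cball 0 1. norm z \<le> K"
    using compact_imp_bounded bounded_pos by blast
  show ?thesis by (rule that[OF K(1)]) (use K(2) in simp)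
qed

text \<open>All factors of the residue are bounded except the power of D eta j from
  \<open>Phi\<close> and the derivative of \<open>th\<close>. Their quotient \<open>b\<close> has
  consecutive ratios q^(j0-l) q^n tending to 0: the derivative grows faster than any geometric
  sequence.\<close>

lemma residues_summable:
  assumes j0: "\<And>j. norm (eta j) < 1 \<longleftrightarrow> j0 \<le> j"
  shows "summable (\<lambda>n. norm (residue (integrand k l) (eta (j0 + int n))))"
proof -
  define b where "b n = norm (D * eta (j0 + int n)) powi (- l) / norm (deriv th (Q powi (- (j0 + int n))))" for n
  have b_Suc: "b (Suc n) = (q powi (- l + j0) * q ^ n) * b n" for n
  proof -
    define j where "j = j0 + int n"
    have j': "j0 + int (Suc n) = j + 1" by (simp add: j_def)
    have 1: "norm (D * eta (j + 1)) = norm (D * eta j) * q"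
      by (simp add: norm_mult norm_eta power_int_add)
    have "norm (deriv th (Q powi (- (j + 1)))) = q powi (- j) * norm (deriv th (Q powi (- j)))"
      using arg_cong[OF deriv_th_step[of "- (j + 1)"], of norm] by (simp add: norm_mult norm_power_int)
    then have "b (Suc n) = norm (D * eta j) powi (- l) * q powi (- l) / (q powi (- j) * norm (deriv th (Q powi (- j))))"
      unfolding b_def j' 1 power_int_mult_distrib by simp
    also have "\<dots> = q powi (- l) * q powi j * b n"
      by (simp add: b_def j_def[symmetric] power_int_minus divide_simps)
    also have "q powi (- l) * q powi j = q powi (- l + j0) * q ^ n"
      by (simp only: j_def power_int_add[OF disjI1[OF q_nonzero]] power_int_of_nat mult.assoc)
    finally show ?thesis .
  qed
  have "(\<lambda>n. q powi (- l + j0) * q ^ n) \<longlonglongrightarrow> q powi (- l + j0) * 0"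
    using q_pos q_less_1 by (intro tendsto_intros LIMSEQ_power_zero) auto
  then have "eventually (\<lambda>n. q powi (- l + j0) * q ^ n < 1 / 2) sequentially"
    by (rule order_tendstoD) simp
  then obtain n0 where n0: "\<And>n. n \<ge> n0 \<Longrightarrow> q powi (- l + j0) * q ^ n < 1 / 2"
    by (auto simp: eventually_sequentially)
  have b0: "b n \<ge> 0" for n by (simp add: b_def)
  have sb: "summable b"
  proof (rule summable_ratio_test[of "1 / 2" n0])
    fix n assume "n0 \<le> n"
    then show "norm (b (Suc n)) \<le> 1 / 2 * norm (b n)"
      using mult_right_mono[OF less_imp_le[OF n0], of n "b n"] b0[of n] b0[of "Suc n"]
      by (simp add: b_Suc)
  qed simp
  obtain Kf where Kf: "Kf > 0" "\<And>j. norm (eta j) < 1 \<Longrightarrow> norm (f k (eta j)) \<le> Kf"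
    using f_eta_bounded by blast
  obtain KV where KV: "KV > 0" "\<And>y. norm y \<le> 1 \<Longrightarrow> norm (V l y) \<le> KV"
    using bounded_on_disc[OF V_holomorphic] by blast
  obtain KN where KN: "KN > 0" "\<And>y. norm y \<le> 1 \<Longrightarrow> norm (N y) \<le> KN"
    using bounded_on_disc[OF N_holomorphic] by blast
  define K where "K = Kf * KV * KN / norm (D * R)"
  have "norm (residue (integrand k l) (eta (j0 + int n))) \<le> K * b n" for n
  proof -
    define j where "j = j0 + int n"
    have small: "norm (eta j) < 1" using j0[of j] by (simp add: j_def)
    have "norm (residue (integrand k l) (eta j))
        = norm (f k (eta j)) * norm (V l (eta j)) * norm (N (eta j)) * norm (eta j) / norm (D * R) * b n"
      unfolding residue_integrand[OF small] b_def j_def[symmetric] Phi_def norm_minus_cancel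
      by (simp add: norm_mult norm_divide norm_power_int mult_ac)
    also have "\<dots> \<le> Kf * KV * KN * 1 / norm (D * R) * b n"
      using small Kf KV KN b0
      by (intro mult_right_mono divide_right_mono mult_mono Kf(2) KV(2) KN(2)) auto
    finally show ?thesis by (simp add: K_def j_def)
  qed
  then show ?thesis
    by (intro summable_comparison_test[OF _ summable_mult[OF sb, of K]]) auto
qed

section \<open>The weight on the unit circle\<close>

lemma M_nonzero_circle:
  assumes "norm y = 1" "y\<^sup>2 \<noteq> 1"
  shows "M y \<noteq> 0"
proof -
  have y: "y \<in> dom" using assms cball_subset_dom by simp
  have "ip (y\<^sup>2) \<noteq> 0"
    using ip_rec[of "y\<^sup>2"] dom_nonzero(3)[OF y] assms(2) by (auto simp: mult.commute)
  then show ?thesis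
    using dom_nonzero[OF y] ipC th_neg[OF r_neg] th_unit_circle[OF assms(1)] by (simp add: M_def)
qed

lemma M_zero_circle: "y\<^sup>2 = 1 \<Longrightarrow> M y = 0"
  using ip_rec[of 1] by (simp add: M_def)

lemma c_fun_M:
  assumes "y \<noteq> 0"
  shows "c_fun q c d r (1 / y) = 1 / M y" "c_fun q c d r y = 1 / M (1 / y)"
  using inverse_c_fun[of y, symmetric] inverse_c_fun[of "1 / y", symmetric] assms by simp_all

lemma weight_identity:
  assumes y: "norm y = 1"
  shows "f k y * f l y * (M y * M (1 / y)) = f k y * Phi l y * M y + f k (1 / y) * Phi l (1 / y) * M (1 / y)"
proof (cases "y\<^sup>2 = 1")
  case True
  then have "(1 / y)\<^sup>2 = 1" by (simp add: power_divide)
  then show ?thesis using M_zero_circle True by simp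
next
  case False
  note u = unit_circle[OF y]
  have F': "(1 / y)\<^sup>2 \<noteq> 1" using False u(1) by (simp add: power_divide)
  have nz: "M y \<noteq> 0" "M (1 / y) \<noteq> 0"
    using M_nonzero_circle y False u(4) F' by auto
  have "f l y = Phi l y / M (1 / y) + Phi l (1 / y) / M y"
    using connection[OF y False, of l] c_fun_M[OF u(1)] by simp
  then show ?thesis
    using nz by (simp add: f_inverse[OF y] field_simps)
qed

lemma cnj_c_fun: "cnj (c_fun q c d r y) = c_fun q c d r (cnj y)"
  by (simp add: c_fun_def qpochs_inf_def cnj_ip)

text \<open>All parameters are real, so conjugating c(y) conjugates only y, and on the unit circle
  that is inversion.\<close>

lemma weight_eq:
  assumes y: "norm y = 1"
  shows "1 / (complex_of_real (cmod (c_fun q c d r y)))\<^sup>2 = M y * M (1 / y)"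
proof -
  have y0: "y \<noteq> 0" using y by auto
  have "y * cnj y = 1" using complex_norm_square[of y] y by simp
  then have "cnj y = 1 / y" using y0 by (simp add: field_simps)
  then have "(complex_of_real (cmod (c_fun q c d r y)))\<^sup>2 = c_fun q c d r y * c_fun q c d r (1 / y)"
    using complex_norm_square[of "c_fun q c d r y"] by (simp add: cnj_c_fun)
  then have "1 / (complex_of_real (cmod (c_fun q c d r y)))\<^sup>2 = (1 / c_fun q c d r (1 / y)) * (1 / c_fun q c d r y)"
    by simp
  moreover have "1 / c_fun q c d r y = M (1 / y)"
    using inverse_c_fun[of "1 / y"] y0 by simp
  ultimately show ?thesis
    by (simp only: inverse_c_fun[OF y0])
qed

lemma f_fun_eq:
  assumes "y \<noteq> 0" "norm (D * y) < 1"
  shows "f_fun q c d r k (mu y) = f k y"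
proof -
  have "f_fun q c d r k (mu y) = phi21 (D * y) (D / y) C Q (complex_of_real (r * q powi k))"
    by (rule f_fun_mu[OF assms(1)])
  also have "\<dots> = phi21 (D / y) (D * y) C Q (zk k)"
    by (subst phi21_commute) (simp add: zk_def of_real_power_int)
  also have "\<dots> = f k y"
    unfolding f_def using assms by (intro phi21_eq_heine ipC zk_cut) auto
  finally show ?thesis .
qed

lemma continuous_on_circle: "continuous_on (sphere 0 1) (\<lambda>y. f k y * Phi l y * M y)"
proof -
  have sub: "sphere 0 1 \<subseteq> dom - {0}" using cball_subset_dom by auto
  have "(\<lambda>y. f k y * Phi l y * (N y / th (D * R / y))) holomorphic_on (dom - {0}) \<inter> {y. th (D * R / y) \<noteq> 0}"
    unfolding th_def
    by (intro holomorphic_intros holomorphic_on_subset[OF f_holomorphic] holomorphic_on_subset[OF Phi_holomorphic]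
      holomorphic_on_subset[OF N_holomorphic]) auto
  then have "continuous_on ((dom - {0}) \<inter> {y. th (D * R / y) \<noteq> 0}) (\<lambda>y. f k y * Phi l y * M y)"
    unfolding M_eq_N by (rule holomorphic_on_imp_continuous_on)
  then show ?thesis
    by (rule continuous_on_subset) (use sub th_unit_circle in auto)
qed

text \<open>The two summands of \<open>weight_identity\<close> are interchanged by t -> -t.
  Reflecting the second one turns the half circle into the full circle, with a single summand as
  integrand.\<close>

lemma integral_half_circle:
  fixes g :: "real \<Rightarrow> complex"
  assumes g: "\<And>t. g t = f k (cis t) * f l (cis t) * (M (cis t) * M (1 / cis t))"
  shows "g absolutely_integrable_on {0..pi}"
    "\<i> * integral {0..pi} g = contour_integral (circlepath 0 1) (integrand k l)"
proof -
  define h where "h y = f k y * Phi l y * M y" for y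
  have hc: "continuous_on A (\<lambda>t. h (cis (u t)))" if "continuous_on A u" for A :: "real set" and u
  proof -
    have "continuous_on A (\<lambda>t. cis (u t))" using that by (rule continuous_on_cis)
    then show ?thesis
      by (rule continuous_on_compose2[OF continuous_on_circle[of k l, folded h_def]]) auto
  qed
  have inv: "1 / cis t = cis (- t)" for t
    by (metis cis_inverse inverse_eq_divide)
  have gh: "g t = h (cis t) + h (cis (- t))" for t
    using weight_identity[of "cis t" k l, OF norm_cis] unfolding g h_def inv .
  have cg: "continuous_on {0..pi} g"
    unfolding gh[abs_def] by (intro continuous_on_add hc continuous_intros)
  show "g absolutely_integrable_on {0..pi}"
    by (rule absolutely_integrable_continuous_real[OF cg])
  have int: "(\<lambda>t. h (cis (u t))) integrable_on {a..b}" if "continuous_on {a..b} u" for a b :: real and u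
    by (rule integrable_continuous_real[OF hc[OF that]])
  have "((\<lambda>t. h (cis t)) has_integral integral {pi..2 * pi} (\<lambda>t. h (cis t))) (cbox pi (2 * pi))"
    using int[of pi "2 * pi" "\<lambda>t. t"] by (simp add: integrable_integral)
  from has_integral_affinity[OF this, of "- 1" "2 * pi"]
  have "((\<lambda>t. h (cis (2 * pi - t))) has_integral integral {pi..2 * pi} (\<lambda>t. h (cis t)))
      ((\<lambda>x. 2 * pi - x) ` {pi..2 * pi})"
    by (simp add: minus_mult_left[symmetric] cong: image_cong)
  moreover have "(\<lambda>x. 2 * pi - x) ` {pi..2 * pi} = {0..pi}"
    by simp
  moreover have "cis (2 * pi - t) = cis (- t)" for t
  proof -
    have "cis (2 * pi - t) = cis (2 * pi) * cis (- t)" by (simp only: cis_mult diff_conv_add_uminus)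
    then show ?thesis by (simp only: cis_2pi mult_1)
  qed
  ultimately have refl: "integral {0..pi} (\<lambda>t. h (cis (- t))) = integral {pi..2 * pi} (\<lambda>t. h (cis t))"
    by (simp add: integral_unique)
  have "integral {0..pi} g = integral {0..pi} (\<lambda>t. h (cis t)) + integral {0..pi} (\<lambda>t. h (cis (- t)))"
    unfolding gh[abs_def] by (intro integral_add int continuous_intros)
  also have "\<dots> = integral {0..2 * pi} (\<lambda>t. h (cis t))"
    unfolding refl by (intro Henstock_Kurzweil_Integration.integral_combine int continuous_intros) auto
  finally have G: "integral {0..pi} g = integral {0..2 * pi} (\<lambda>t. h (cis t))" .
  have "((\<lambda>t. \<i> * h (cis t)) has_integral \<i> * integral {0..2 * pi} (\<lambda>t. h (cis t))) {0..2 * pi}"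
    by (intro has_integral_mult_right integrable_integral int continuous_intros)
  then have "((\<lambda>t. integrand k l (0 + complex_of_real 1 * cis t) * complex_of_real 1 * \<i> * cis t) has_integral
      \<i> * integral {0..2 * pi} (\<lambda>t. h (cis t))) {0..2 * pi}"
    by (rule has_integral_eq[rotated]) (simp add: integrand_def h_def)
  then have "(integrand k l has_contour_integral \<i> * integral {0..2 * pi} (\<lambda>t. h (cis t))) (circlepath 0 1)"
    unfolding circlepath_def by (subst has_contour_integral_part_circlepath_iff) auto
  then show "\<i> * integral {0..pi} g = contour_integral (circlepath 0 1) (integrand k l)"
    unfolding G by (rule contour_integral_unique[symmetric])
qed

end

section \<open>Orthogonality\<close>

context little_jacobi
begin

lemma integrand_holomorphic:
  assumes "A \<subseteq> dom - {0}" "\<And>j. eta j \<notin> A"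
  shows "integrand k l holomorphic_on A"
proof -
  have "th (D * R / y) \<noteq> 0" if "y \<in> A" for y
  proof
    assume "th (D * R / y) = 0"
    moreover have "y \<noteq> 0" using that assms(1) by auto
    ultimately obtain i :: int where "D * R / y = Q powi i"
      by (subst (asm) th_eq_0_iff) auto
    then have "y = eta (- i)"
      using \<open>y \<noteq> 0\<close> by (simp add: eta_def power_int_minus field_simps)
    then show False using assms(2) that by blast
  qed
  moreover have "y \<noteq> 0" if "y \<in> A" for y using that assms(1) by auto
  moreover have "A \<subseteq> dom" using assms(1) by auto
  ultimately have "(\<lambda>y. f k y * Phi l y * (N y / th (D * R / y)) / y) holomorphic_on A"
    unfolding th_def using assms(1)
    by (intro holomorphic_intros holomorphic_on_subset[OF f_holomorphic] holomorphic_on_subset[OF Phi_holomorphic]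
      holomorphic_on_subset[OF N_holomorphic]) auto
  then show ?thesis by (simp add: integrand_def[abs_def] M_eq_N)
qed

text \<open>The annulus around the contours must extend strictly beyond the unit circle.\<close>

lemma dom_radius:
  obtains \<rho> where "\<rho> > 1" "ball 0 \<rho> \<subseteq> dom"
proof -
  have "(1::complex) \<in> dom" by (rule cball_subset_dom) simp
  then obtain e where e: "e > 0" "ball 1 e \<subseteq> dom"
    using open_dom open_contains_ball by blast
  have "complex_of_real (1 + e / 2) \<in> ball 1 e"
    using e(1) by (simp add: dist_norm norm_divide)
  then have "complex_of_real (1 + e / 2) \<in> dom" using e(2) by blast
  moreover have "norm (complex_of_real (1 + e / 2)) = 1 + e / 2"
    using e(1) by (subst norm_of_real) simp
  ultimately have "ball 0 (1 + e / 2) \<subseteq> dom"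
    using dom_star[of "complex_of_real (1 + e / 2)"] by auto
  then show ?thesis using that[of "1 + e / 2"] e(1) by simp
qed

text \<open>Geometric mean of the moduli of two consecutive poles, those with indices j0 + n and j0
  + n - 1.\<close>

definition radius :: "int \<Rightarrow> nat \<Rightarrow> real" where
  "radius j0 n = norm (eta (j0 + int n)) / sqrt q"

lemma radius_pos: "radius j0 n > 0"
  using q_pos by (simp add: radius_def)

lemma radius_bounds: "norm (eta (j0 + int n)) < radius j0 n" "radius j0 n < norm (eta (j0 + int n - 1))"
proof -
  define a where "a = norm (eta (j0 + int n))"
  have a: "a > 0" by (simp add: a_def)
  have s: "0 < sqrt q" "sqrt q < 1" "sqrt q * sqrt q = q"
    using q_pos q_less_1 by simp_all
  have "a * sqrt q < a * 1" using a s by (intro mult_strict_left_mono) auto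
  then show "norm (eta (j0 + int n)) < radius j0 n"
    using s by (simp add: radius_def a_def[symmetric] pos_less_divide_eq)
  have "norm (eta (j0 + int n - 1)) = a / q"
    by (simp add: a_def norm_eta power_int_diff power_int_add)
  moreover have "q < sqrt q" using mult_strict_left_mono[OF s(2,1)] s(3) by simp
  then have "a / sqrt q < a / q" using a q_pos by (intro divide_strict_left_mono) auto
  ultimately show "radius j0 n < norm (eta (j0 + int n - 1))"
    by (simp add: radius_def a_def)
qed

lemma contour_shift:
  assumes j0: "\<And>j. norm (eta j) < 1 \<longleftrightarrow> j0 \<le> j" and n: "n \<ge> 1"
  shows "contour_integral (circlepath 0 1) (integrand k l) - contour_integral (circlepath 0 (radius j0 n)) (integrand k l)
    = 2 * pi * \<i> * (\<Sum>i<n. residue (integrand k l) (eta (j0 + int i)))"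
    and "integrand k l contour_integrable_on circlepath 0 (radius j0 n)"
proof -
  obtain \<rho>0 where \<rho>0: "\<rho>0 > 1" "ball 0 \<rho>0 \<subseteq> dom"
    using dom_radius by blast
  \<comment> \<open>The outer radius stays inside \<open>dom\<close> and does not pass the next pole
    \<open>eta (j0 - 1)\<close>, which lies strictly outside the unit circle by
    \<open>norm_eta_neq_1\<close>.\<close>
  define \<rho> where "\<rho> = min \<rho>0 (norm (eta (j0 - 1)))"
  have "norm (eta (j0 - 1)) > 1"
    using j0[of "j0 - 1"] norm_eta_neq_1[of "j0 - 1"] by linarith
  then have \<rho>: "\<rho> > 1" "ball 0 \<rho> \<subseteq> dom" "\<rho> \<le> norm (eta (j0 - 1))"
    using \<rho>0 by (auto simp: \<rho>_def)
  define pts where "pts = (\<lambda>i. eta (j0 + int i)) ` {..<n}"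
  define S where "S = {y :: complex. norm (eta (j0 + int n)) < norm y \<and> norm y < \<rho>}"
  have r1: "radius j0 n < 1"
    using radius_bounds(2)[of j0 n] j0[of "j0 + int n - 1"] n by linarith
  have hol: "integrand k l holomorphic_on S - pts"
  proof (rule integrand_holomorphic)
    show "S - pts \<subseteq> dom - {0}" using \<rho>(2) by (auto simp: S_def subset_eq)
    show "eta j \<notin> S - pts" for j
    proof
      assume "eta j \<in> S - pts"
      then have "norm (eta (j0 + int n)) < norm (eta j)" "norm (eta j) < norm (eta (j0 - 1))" "eta j \<notin> pts"
        using \<rho>(3) by (auto simp: S_def)
      then have "j < j0 + int n" "j0 - 1 < j" "eta j \<notin> pts" by (simp_all add: norm_eta_less)
      then show False
        by (auto simp: pts_def image_iff dest: bspec[of _ _ "nat (j - j0)"])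
    qed
  qed
  have ptsb: "radius j0 n < norm p \<and> norm p < 1" if p: "p \<in> pts" for p
  proof -
    obtain i where i: "i < n" "p = eta (j0 + int i)" using p unfolding pts_def by blast
    have "norm (eta (j0 + int n - 1)) \<le> norm p"
      using norm_eta_less[of "j0 + int i" "j0 + int n - 1"] i by (simp add: not_less[symmetric])
    moreover have "norm p < 1" using j0[of "j0 + int i"] i by simp
    ultimately show ?thesis using radius_bounds(2)[of j0 n] by simp
  qed
  have inj: "inj_on (\<lambda>i. eta (j0 + int i)) {..<n}"
    by (intro inj_onI) (metis norm_eta_inject add_left_cancel of_nat_eq_iff)
  have real: "eta j \<in> \<real>" for j
  proof -
    have "eta j = complex_of_real (d * r * q powi j)" by (simp add: eta_def of_real_power_int)
    then show ?thesis by (metis Reals_of_real)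
  qed
  have "contour_integral (circlepath 0 1) (integrand k l) - contour_integral (circlepath 0 (radius j0 n)) (integrand k l)
      = 2 * pi * \<i> * (\<Sum>p\<in>pts. residue (integrand k l) p)"
    using hol ptsb radius_bounds(1)[of j0 n] r1 \<rho>(1) real
    by (intro residue_theorem_annulus[of "norm (eta (j0 + int n))" _ _ \<rho>])
      (auto simp: S_def pts_def)
  also have "(\<Sum>p\<in>pts. residue (integrand k l) p) = (\<Sum>i<n. residue (integrand k l) (eta (j0 + int i)))"
    unfolding pts_def by (subst sum.reindex[OF inj]) simp
  finally show "contour_integral (circlepath 0 1) (integrand k l) - contour_integral (circlepath 0 (radius j0 n)) (integrand k l)
    = 2 * pi * \<i> * (\<Sum>i<n. residue (integrand k l) (eta (j0 + int i)))" .
  have "sphere 0 (radius j0 n) \<subseteq> S - pts"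
    using radius_bounds(1)[of j0 n] r1 \<rho>(1) by (auto simp: S_def dest: ptsb)
  then show "integrand k l contour_integrable_on circlepath 0 (radius j0 n)"
    using radius_pos[of j0 n]
    by (intro contour_integrable_continuous_circlepath)
      (auto intro!: continuous_on_subset[OF holomorphic_on_imp_continuous_on[OF hol]])
qed

lemma radius_mid_circle:
  assumes "k < j0 + int n" and y: "norm y = radius j0 n"
  shows "y \<in> mid_circles k"
proof -
  \<comment> \<open>On this circle |xk k y| = q^(k - j0 - n + 1/2), so this m makes the exponent
    vanish; it is a natural number because the circle index has passed k.\<close>
  define m where "m = nat (j0 + int n - k - 1)"
  have m: "int m = j0 + int n - k - 1" using assms by (simp add: m_def)
  have s: "sqrt q * sqrt q = q" using q_pos by simp
  have "norm (xk k y) = norm (D * R) * q powi k / (\<bar>d * r\<bar> * q powi (j0 + int n) / sqrt q)"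
    by (simp add: xk_def zk_def norm_mult norm_divide norm_power_int y radius_def norm_eta)
  also have "\<dots> = q powi (k - (j0 + int n)) * sqrt q"
    by (simp add: norm_mult abs_mult power_int_diff)
  finally have "norm (xk k y) * q ^ m * sqrt q = q powi (k - (j0 + int n)) * q powi (int m) * (sqrt q * sqrt q)"
    by (simp add: mult_ac)
  also have "\<dots> = q powi (k - (j0 + int n)) * q powi (int m) * q powi 1" by (simp add: s)
  also have "\<dots> = q powi (k - (j0 + int n) + int m + 1)" by (simp only: power_int_add[OF disjI1[OF q_nonzero]])
  also have "k - (j0 + int n) + int m + 1 = 0" using m by simp
  finally show ?thesis by (auto simp: mid_circles_def)
qed

lemma small_circles_limit:
  assumes j0: "\<And>j. norm (eta j) < 1 \<longleftrightarrow> j0 \<le> j" and lk: "l \<le> k"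
  defines "L \<equiv> (if k = l then 1 / complex_of_real (w_sq q c d r k) else 0)"
  shows "(\<lambda>n. contour_integral (circlepath 0 (radius j0 n)) (integrand k l)) \<longlonglongrightarrow> 2 * pi * \<i> * L"
proof (rule LIMSEQ_I)
  fix e :: real assume e: "e > 0"
  define e' where "e' = e / (4 * pi)"
  have e': "e' > 0" using e by (simp add: e'_def)
  have "eventually (\<lambda>y. dist (f k y * Phi l y * M y) L < e') (at 0 within mid_circles k)"
    using integrand_limit[OF lk] e' unfolding L_def by (rule tendstoD)
  then obtain \<delta> where \<delta>: "\<delta> > 0" "\<And>y. y \<in> mid_circles k \<Longrightarrow> y \<noteq> 0 \<Longrightarrow> norm y < \<delta> \<Longrightarrow>
      norm (f k y * Phi l y * M y - L) < e'"
    unfolding eventually_at by (auto simp: dist_norm)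
  have "(\<lambda>n. \<bar>d * r\<bar> * q powi j0 * q ^ n / sqrt q) \<longlonglongrightarrow> \<bar>d * r\<bar> * q powi j0 * 0 / sqrt q"
    using q_pos q_less_1 by (intro tendsto_intros LIMSEQ_power_zero) auto
  then have "(\<lambda>n. radius j0 n) \<longlonglongrightarrow> 0"
    by (simp add: radius_def norm_eta power_int_add mult.assoc)
  then have "eventually (\<lambda>n. radius j0 n < \<delta>) sequentially"
    using \<delta>(1) by (rule order_tendstoD)
  then obtain n1 where n1: "\<And>n. n \<ge> n1 \<Longrightarrow> radius j0 n < \<delta>"
    by (auto simp: eventually_sequentially)
  show "\<exists>no. \<forall>n\<ge>no. norm (contour_integral (circlepath 0 (radius j0 n)) (integrand k l) - 2 * pi * \<i> * L) < e"
  proof (intro exI allI impI)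
    fix n assume n: "n \<ge> n1 + 1 + nat (k - j0 + 1)"
    then have n': "n \<ge> 1" "k < j0 + int n" "n \<ge> n1" by linarith+
    define \<rho> where "\<rho> = radius j0 n"
    have \<rho>: "\<rho> > 0" by (simp add: \<rho>_def radius_pos)
    \<comment> \<open>Subtracting L/y, whose integral is known, leaves an integrand below e'/\<rho>;
      the circumference cancels the radius.\<close>
    have "((\<lambda>y. L / (y - 0)) has_contour_integral 2 * pi * \<i> * L) (circlepath 0 \<rho>)"
      using Cauchy_integral_circlepath_simple[of "\<lambda>_. L" 0 \<rho> 0] \<rho> by simp
    moreover have "(integrand k l has_contour_integral contour_integral (circlepath 0 \<rho>) (integrand k l)) (circlepath 0 \<rho>)"
      unfolding \<rho>_def using contour_shift(2)[OF j0 n'(1)] by (rule has_contour_integral_integral)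
    ultimately have "((\<lambda>y. integrand k l y - L / (y - 0)) has_contour_integral
        contour_integral (circlepath 0 \<rho>) (integrand k l) - 2 * pi * \<i> * L) (circlepath 0 \<rho>)"
      by (rule has_contour_integral_diff[rotated])
    then have "norm (contour_integral (circlepath 0 \<rho>) (integrand k l) - 2 * pi * \<i> * L) \<le> e' / \<rho> * (2 * pi * \<rho>)"
    proof (rule has_contour_integral_bound_circlepath)
      fix y :: complex assume y: "norm (y - 0) = \<rho>"
      then have y0: "y \<noteq> 0" "norm y = \<rho>" using \<rho> by auto
      have "y \<in> mid_circles k" using radius_mid_circle[OF n'(2), of y] y by (simp add: \<rho>_def)
      then have "norm (f k y * Phi l y * M y - L) < e'"
        using \<delta>(2) y0 n1[OF n'(3)] by (simp add: \<rho>_def)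
      moreover have "integrand k l y - L / (y - 0) = (f k y * Phi l y * M y - L) / y"
        by (simp add: integrand_def diff_divide_distrib)
      ultimately show "norm (integrand k l y - L / (y - 0)) \<le> e' / \<rho>"
        using \<rho> y0 by (simp add: norm_divide divide_right_mono less_imp_le)
    qed (use \<rho> e' in auto)
    also have "e' / \<rho> * (2 * pi * \<rho>) = e / 2" using \<rho> by (simp add: e'_def)
    also have "\<dots> < e" using e by simp
    finally show "norm (contour_integral (circlepath 0 (radius j0 n)) (integrand k l) - 2 * pi * \<i> * L) < e"
      by (simp add: \<rho>_def)
  qed
qed

theorem dual_orthogonality:
  fixes g :: "real \<Rightarrow> complex" and P :: "int set" and s :: "int \<Rightarrow> complex"
  assumes lk: "l \<le> k"
  assumes g: "\<And>t. g t = f_fun q c d r k (cos t) * f_fun q c d r l (cos t)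
      / (complex_of_real (cmod (c_fun q c d r (exp (\<i> * t))))) ^ 2"
    and P: "P = {p::int. \<bar>q powi p / (d * r)\<bar> > 1}"
    and s: "\<And>p. s p = residue (\<lambda>y. 1 / (c_fun q c d r (inverse y) * c_fun q c d r y * y)) (complex_of_real (q powi p / (d * r)))
      * f_fun q c d r k (mu (complex_of_real (q powi p / (d * r)))) * f_fun q c d r l (mu (complex_of_real (q powi p / (d * r))))"
  shows "g absolutely_integrable_on {0..pi} \<and> s summable_on P \<and>
     1 / complex_of_real (2 * pi) * integral {0..pi} g + (\<Sum>\<^sub>\<infinity>p\<in>P. s p)
       = (if k = l then 1 / complex_of_real (w_sq q c d r k) else 0)"
proof -
  define L where "L = (if k = l then 1 / complex_of_real (w_sq q c d r k) else 0)"
  obtain j0 where j0: "\<And>j. norm (eta j) < 1 \<longleftrightarrow> j0 \<le> j" using first_pole by blast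
  have gt: "g t = f k (cis t) * f l (cis t) * (M (cis t) * M (1 / cis t))" for t
  proof -
    note u = unit_circle[OF norm_cis, of t]
    have "mu (cis t) = complex_of_real (cos t)"
      by (simp add: mu_def cis_inverse complex_eq_iff)
    then have F: "f_fun q c d r i (complex_of_real (cos t)) = f i (cis t)" for i
      using f_fun_eq[OF u(1,2), of i] by simp
    have e: "exp (\<i> * complex_of_real t) = cis t" by (simp add: cis_conv_exp)
    have "g t = f k (cis t) * f l (cis t) * (1 / (complex_of_real (cmod (c_fun q c d r (cis t))))\<^sup>2)"
      unfolding g e F by simp
    then show ?thesis by (simp only: weight_eq[OF norm_cis])
  qed
  note I = integral_half_circle[OF gt]
  define I1 where "I1 = contour_integral (circlepath 0 1) (integrand k l)"
  have I1: "1 / complex_of_real (2 * pi) * integral {0..pi} g = I1 / (2 * pi * \<i>)"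
    unfolding I1_def I(2)[symmetric] by simp
  define \<sigma> where "\<sigma> n = residue (integrand k l) (eta (j0 + int n))" for n
  have eta_inv: "complex_of_real (q powi p / (d * r)) = 1 / eta (- p)" for p
    by (simp add: eta_def of_real_power_int power_int_minus divide_simps)
  have s_eta: "s p = - residue (integrand k l) (eta (- p))" if "norm (eta (- p)) < 1" for p
  proof -
    have "mu (1 / eta (- p)) = mu (eta (- p))" by (simp add: mu_def add.commute inverse_eq_divide)
    then have "f_fun q c d r i (mu (1 / eta (- p))) = f i (eta (- p))" for i
      using f_fun_eq[OF eta_nz D_eta_small(1)[OF that]] by simp
    then show ?thesis
      unfolding s eta_inv using dual_term[OF that, of k l] by simp
  qed
  define h where "h n = - (j0 + int n)" for n
  have P_iff: "p \<in> P \<longleftrightarrow> j0 \<le> - p" for p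
  proof -
    have "\<bar>q powi p / (d * r)\<bar> = norm (1 / eta (- p))"
      unfolding eta_inv[symmetric] by (simp only: norm_of_real)
    also have "\<dots> = 1 / norm (eta (- p))" by (simp add: norm_divide)
    finally have "p \<in> P \<longleftrightarrow> 1 < 1 / norm (eta (- p))"
      by (simp only: P mem_Collect_eq)
    also have "\<dots> \<longleftrightarrow> norm (eta (- p)) < 1"
      by (subst less_divide_eq_1_pos) simp_all
    finally show ?thesis by (simp only: j0)
  qed
  have bij: "bij_betw h UNIV P"
  proof (rule bij_betwI')
    show "h x = h y \<longleftrightarrow> x = y" for x y by (simp add: h_def)
    show "h x \<in> P" for x by (simp add: h_def P_iff)
    show "\<exists>x\<in>UNIV. y = h x" if "y \<in> P" for y
      using that by (intro bexI[of _ "nat (- y - j0)"]) (auto simp: h_def P_iff)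
  qed
  have sh: "s (h n) = - \<sigma> n" for n
  proof -
    have "- h n = j0 + int n" by (simp add: h_def)
    then show ?thesis
      using s_eta[of "h n"] j0[of "j0 + int n"] unfolding \<sigma>_def by simp
  qed
  \<comment> \<open>The contour limit gives convergence of the ordered partial sums only; the
    unordered sum over \<open>P\<close> also needs absolute summability.\<close>
  have sm: "summable (\<lambda>n. norm (s (h n)))"
    using residues_summable[OF j0, of k l] by (simp add: sh \<sigma>_def)
  have "(\<lambda>n. contour_integral (circlepath 0 (radius j0 n)) (integrand k l)) \<longlonglongrightarrow> 2 * pi * \<i> * L"
    unfolding L_def by (rule small_circles_limit[OF j0 lk])
  then have "(\<lambda>n. (I1 - contour_integral (circlepath 0 (radius j0 n)) (integrand k l)) / (2 * pi * \<i>))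
      \<longlonglongrightarrow> (I1 - 2 * pi * \<i> * L) / (2 * pi * \<i>)"
    by (intro tendsto_intros) auto
  moreover have "eventually (\<lambda>n. (I1 - contour_integral (circlepath 0 (radius j0 n)) (integrand k l)) / (2 * pi * \<i>)
      = (\<Sum>i<n. \<sigma> i)) sequentially"
    using eventually_ge_at_top[of 1]
  proof eventually_elim
    case (elim n)
    show ?case
      unfolding I1_def contour_shift(1)[OF j0 elim] \<sigma>_def by simp
  qed
  ultimately have "(\<lambda>n. \<Sum>i<n. \<sigma> i) \<longlonglongrightarrow> (I1 - 2 * pi * \<i> * L) / (2 * pi * \<i>)"
    by (rule Lim_transform_eventually)
  then have "(\<lambda>n. - \<sigma> n) sums (- ((I1 - 2 * pi * \<i> * L) / (2 * pi * \<i>)))"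
    unfolding sums_def[symmetric] by (rule sums_minus)
  then have "((\<lambda>n. s (h n)) has_sum (- ((I1 - 2 * pi * \<i> * L) / (2 * pi * \<i>)))) UNIV"
    using norm_summable_imp_has_sum[OF sm] by (simp add: sh)
  then have hs: "(s has_sum (- ((I1 - 2 * pi * \<i> * L) / (2 * pi * \<i>)))) P"
    using has_sum_reindex_bij_betw[OF bij] by blast
  have "I1 / (2 * pi * \<i>) + (- ((I1 - 2 * pi * \<i> * L) / (2 * pi * \<i>))) = L"
    by (simp add: field_simps)
  then show ?thesis
    using I(1) hs infsumI[OF hs] unfolding I1 L_def[symmetric] by (auto intro: has_sum_imp_summable)
qed

end

theorem corollary5p9:
  fixes q c d r :: real and k l :: int
    and g :: "real \<Rightarrow> complex" and P :: "int set" and s :: "int \<Rightarrow> complex"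
  assumes "0 < q" "q < 1" and "r < 0" and "0 < c" "c \<le> q ^ 2"
    and "d \<noteq> 0" "\<bar>d\<bar> < 1" "\<bar>c / d\<bar> < 1"
    and "\<forall>y \<in> c_zeros q c d r. zorder (c_fun q c d r) y = 1"
    and "\<forall>y \<in> c_zeros q c d r. inverse y \<in> c_dom q \<and> c_fun q c d r (inverse y) \<noteq> 0"
  defines "g \<equiv> \<lambda>t::real. f_fun q c d r k (cos t) * f_fun q c d r l (cos t)
                          / (cmod (c_fun q c d r (exp (\<i> * t)))) ^ 2"
    and "P \<equiv> {p::int. \<bar>q powi p / (d * r)\<bar> > 1}"
    and "s \<equiv> \<lambda>p::int. let y\<^sub>p = complex_of_real (q powi p / (d * r)) in
            residue (\<lambda>y. 1 / (c_fun q c d r (inverse y) * c_fun q c d r y * y)) y\<^sub>p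
            * f_fun q c d r k (mu y\<^sub>p) * f_fun q c d r l (mu y\<^sub>p)"
  shows "g absolutely_integrable_on {0..pi} \<and> s summable_on P \<and>
         1 / complex_of_real (2 * pi) * integral {0..pi} g + (\<Sum>\<^sub>\<infinity>p\<in>P. s p)
           = (if k = l then 1 / complex_of_real (w_sq q c d r k) else 0)"
proof -
  interpret q_base q by unfold_locales (use assms(1,2) in auto)
  \<comment> \<open>otherwise \<open>1 / (d r q^j)\<close> is, for large \<open>j\<close>, a zero of \<open>c_fun\<close> whose inverse is outside \<open>c_dom\<close>\<close>
  have generic: "(d * r)\<^sup>2 \<noteq> q powi m" for m :: int
  proof
    assume m: "(d * r)\<^sup>2 = q powi m"
    \<comment> \<open>This size of j makes n = m + 2 j positive, so the inverse square of y below is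
      Q^n, inside the unit disc.\<close>
    define j where "j = nat (\<bar>m\<bar> + 1)"
    define n where "n = nat (m + 2 * int j)"
    have n: "n > 0" "int n = m + 2 * int j" by (auto simp: n_def j_def)
    define y where "y = 1 / (complex_of_real (d * r) * Q ^ j)"
    have dr: "d * r \<noteq> 0" using assms(3,6) by auto
    then have y0: "y \<noteq> 0" by (simp add: y_def)
    have "(complex_of_real (d * r) * Q ^ j)\<^sup>2 = complex_of_real ((d * r)\<^sup>2 * q powi (2 * int j))"
      by (simp add: power_mult_distrib of_real_power_int power_int_def nat_mult_distrib power_mult mult.commute[of _ "2::nat"])
        (simp add: power_mult[symmetric] mult.commute)
    also have "(d * r)\<^sup>2 * q powi (2 * int j) = q ^ n"
      unfolding m by (metis n(2) power_int_add power_int_of_nat q_nonzero)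
    finally have ysq: "inverse y ^ 2 = Q ^ n" by (simp add: y_def)
    have "norm (Q ^ n) < 1" using n(1) q_pos q_less_1 by (simp add: norm_power power_less_one_iff)
    then have dom: "y \<in> c_dom q"
      using y0 ip_nonzero_norm by (simp add: c_dom_def ysq)
    have "complex_of_real d * complex_of_real r * y * Q ^ j = 1"
      using dr by (simp add: y_def)
    then have "ip (complex_of_real d * complex_of_real r * y) = 0" by (rule ip_eq_0I)
    then have "c_fun q c d r y = 0" by (simp add: c_fun_def qpochs_inf_def)
    then have "inverse y \<in> c_dom q"
      using assms(10) dom by (auto simp: c_zeros_def)
    moreover have "(inverse (inverse y))\<^sup>2 * Q ^ n = 1"
      using y0 by (simp add: ysq[symmetric] power_inverse)
    then have "ip ((inverse (inverse y))\<^sup>2) = 0" by (rule ip_eq_0I)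
    ultimately show False by (simp add: c_dom_def)
  qed
  interpret little_jacobi q c d r
    by unfold_locales (use assms generic in auto)
  show ?thesis
  proof (cases "l \<le> k")
    case True
    show ?thesis
      by (rule dual_orthogonality[OF True _ P_def[THEN meta_eq_to_obj_eq]]) (simp_all add: g_def s_def Let_def cos_of_real)
  next
    case False
    then have "k \<le> l" "k \<noteq> l" by auto
    \<comment> \<open>Integrand and mass terms are symmetric in \<open>k\<close> and
      \<open>l\<close>, so their roles may be exchanged.\<close>
    have "g absolutely_integrable_on {0..pi} \<and> s summable_on P \<and>
         1 / complex_of_real (2 * pi) * integral {0..pi} g + (\<Sum>\<^sub>\<infinity>p\<in>P. s p)
           = (if l = k then 1 / complex_of_real (w_sq q c d r l) else 0)"
      by (rule dual_orthogonality[OF \<open>k \<le> l\<close> _ P_def[THEN meta_eq_to_obj_eq]])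
        (simp_all add: g_def s_def Let_def cos_of_real mult_ac)
    then show ?thesis using \<open>k \<noteq> l\<close> by simp
  qed
qed

end
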